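(* As subrings of the ring of holomorphic functions on the upper half plane, $$\mathcal M(\Gamma(2))_{\mathbb M}=\mathbb C\big[E_{2,2}(\tau/2),\,E_{2,2}(\tau)\big]=\mathbb C\big[(\eta^{\flat})^4,(\eta^{\sharp})^4\big],$$ $$\mathcal M(\Gamma(3))_{\mathbb M}=\mathbb C\big[E_{\chi_3}(\tau/3),\,E_{\chi_3}(\tau)\big]=\mathbb C\big[\eta^{\bot},\eta^{\top}\big].$$
   Context: $\Gamma(N)\subset \mathrm{SL}_2(\mathbb Z)$ is the principal congruence subgroup of level $N$; $\mathbb M=\{0,1,2,\dots\}$; $\tau$ is the variable in the upper half plane $\mathcal H$, and $q^r=e^{2\pi i r\tau}$. $\mathcal M(\Gamma(N))_k$ is the $\mathbb C$-vector space of (holomorphic) modular forms of weight $k$ for $\Gamma(N)$, and $\mathcal M(\Gamma(N))_{\mathbb M}=\bigoplus_{k\in\mathbb M}\mathcal M(\Gamma(N))_k$ is the graded ring. $\mathbb C[f,g]$ denotes the $\mathbb C$-subalgebra generated by $f,g$. $E_{2,2}=1+24\sum_{n\ge1}\big(\sum_{d\mid n,\,2\nmid d}d\big)q^n$ (weight 2). $E_{\chi_3}=1+6\sum_{n\ge1}\big(\sum_{d\mid n}\chi_3(d)\big)q^n$ (weight 1), where $\chi_3$ is the nontrivial Dirichlet character modulo $3$. $\eta(\tau)=q^{1/24}\prod_{n\ge1}(1-q^n)$, and $\eta^{\flat}(\tau)=\eta(\tau/2)^2/\eta(\tau)$, $\eta^{\sharp}(\tau)=\eta(2\tau)^2/\eta(\tau)$,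 $\eta^{\bot}(\tau)=\eta(\tau/3)^3/\eta(\tau)$, $\eta^{\top}(\tau)=\eta(3\tau)^3/\eta(\tau)$. *)

theory Defs
  imports "HOL-Analysis.Analysis" "HOL-Algebra.Generated_Rings" "HOL-Number_Theory.Cong"
    "HOL-Computational_Algebra.Polynomial"
begin

subsection \<open>The ring of holomorphic functions on the upper half plane\<close>

definition uhp :: "complex set"
  where "uhp = {\<tau>. Im \<tau> > 0}"

text \<open>Functions on the upper half plane are functions on the complex numbers that are
  \<^const>\<open>extensional\<close> on \<^term>\<open>uhp\<close>, so that equality in the ring is equality on
  \<^term>\<open>uhp\<close>.\<close>

definition holo_ring :: "(complex \<Rightarrow> complex) ring"
  where "holo_ring =
    \<lparr> carrier = {f \<in> extensional uhp. f holomorphic_on uhp},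
      mult = (\<lambda>f g. \<lambda>\<tau>\<in>uhp. f \<tau> * g \<tau>),
      one = (\<lambda>\<tau>\<in>uhp. 1),
      zero = (\<lambda>\<tau>\<in>uhp. 0),
      add = (\<lambda>f g. \<lambda>\<tau>\<in>uhp. f \<tau> + g \<tau>) \<rparr>"

text \<open>The subalgebra generated by a set is the subring generated by it and the constants.\<close>

definition generate_algebra :: "(complex \<Rightarrow> complex) set \<Rightarrow> (complex \<Rightarrow> complex) set"
  where "generate_algebra S = generate_ring holo_ring (range (\<lambda>c. \<lambda>\<tau>\<in>uhp. c) \<union> S)"

lemma restrict_holo_carrier:
  assumes "f holomorphic_on uhp"
  shows "(\<lambda>\<tau>\<in>uhp. f \<tau>) \<in> carrier holo_ring"
proof -
  have "(\<lambda>\<tau>\<in>uhp. f \<tau>) holomorphic_on uhp"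
    by (rule holomorphic_transform[OF assms]) auto
  then show ?thesis by (simp add: holo_ring_def)
qed

lemma cring_holo_ring: "cring holo_ring"
proof (rule cringI)
  show "abelian_group holo_ring"
  proof (rule abelian_groupI)
    fix f assume f: "f \<in> carrier holo_ring"
    have "(\<lambda>\<tau>\<in>uhp. - f \<tau>) \<in> carrier holo_ring"
      using f by (intro restrict_holo_carrier holomorphic_intros) (auto simp: holo_ring_def)
    moreover have "(\<lambda>\<tau>\<in>uhp. - f \<tau>) \<oplus>\<^bsub>holo_ring\<^esub> f = \<zero>\<^bsub>holo_ring\<^esub>"
      by (auto simp: holo_ring_def fun_eq_iff restrict_def)
    ultimately show "\<exists>g\<in>carrier holo_ring. g \<oplus>\<^bsub>holo_ring\<^esub> f = \<zero>\<^bsub>holo_ring\<^esub>"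
      by blast
    show "\<zero>\<^bsub>holo_ring\<^esub> \<oplus>\<^bsub>holo_ring\<^esub> f = f"
      using f by (auto simp: holo_ring_def fun_eq_iff restrict_def extensional_def)
  next
    fix f g assume "f \<in> carrier holo_ring" "g \<in> carrier holo_ring"
    then have "(\<lambda>\<tau>\<in>uhp. f \<tau> + g \<tau>) \<in> carrier holo_ring"
      by (intro restrict_holo_carrier holomorphic_intros) (auto simp: holo_ring_def)
    then show "f \<oplus>\<^bsub>holo_ring\<^esub> g \<in> carrier holo_ring"
      by (simp add: holo_ring_def)
  next
    have "(\<lambda>\<tau>\<in>uhp. 0) \<in> carrier holo_ring"
      by (intro restrict_holo_carrier holomorphic_intros)
    then show "\<zero>\<^bsub>holo_ring\<^esub> \<in> carrier holo_ring"
      by (simp add: holo_ring_def)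
  qed (auto simp: holo_ring_def fun_eq_iff restrict_def algebra_simps)
next
  show "comm_monoid holo_ring"
  proof (rule comm_monoidI)
    fix f g assume "f \<in> carrier holo_ring" "g \<in> carrier holo_ring"
    then have "(\<lambda>\<tau>\<in>uhp. f \<tau> * g \<tau>) \<in> carrier holo_ring"
      by (intro restrict_holo_carrier holomorphic_intros) (auto simp: holo_ring_def)
    then show "f \<otimes>\<^bsub>holo_ring\<^esub> g \<in> carrier holo_ring"
      by (simp add: holo_ring_def)
  next
    have "(\<lambda>\<tau>\<in>uhp. 1) \<in> carrier holo_ring"
      by (intro restrict_holo_carrier holomorphic_intros)
    then show "\<one>\<^bsub>holo_ring\<^esub> \<in> carrier holo_ring"
      by (simp add: holo_ring_def)
  next
    fix f assume "f \<in> carrier holo_ring"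
    then show "\<one>\<^bsub>holo_ring\<^esub> \<otimes>\<^bsub>holo_ring\<^esub> f = f"
      by (auto simp: holo_ring_def fun_eq_iff restrict_def extensional_def)
  qed (auto simp: holo_ring_def fun_eq_iff restrict_def algebra_simps)
qed (auto simp: holo_ring_def fun_eq_iff restrict_def algebra_simps)


subsection \<open>Modular forms for principal congruence subgroups\<close>

definition SL2Z :: "(int ^ 2 ^ 2) set"
  where "SL2Z = {A. det A = 1}"

definition Gamma :: "nat \<Rightarrow> (int ^ 2 ^ 2) set"
  where "Gamma N = {A \<in> SL2Z. \<forall>i j. [A $ i $ j = (mat 1 :: int ^ 2 ^ 2) $ i $ j] (mod int N)}"

definition autom_factor :: "int ^ 2 ^ 2 \<Rightarrow> complex \<Rightarrow> complex"
  where "autom_factor A \<tau> = of_int (A $ 2 $ 1) * \<tau> + of_int (A $ 2 $ 2)"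

definition moebius_act :: "int ^ 2 ^ 2 \<Rightarrow> complex \<Rightarrow> complex"
  where "moebius_act A \<tau> = (of_int (A $ 1 $ 1) * \<tau> + of_int (A $ 1 $ 2)) / autom_factor A \<tau>"

definition slash :: "nat \<Rightarrow> (complex \<Rightarrow> complex) \<Rightarrow> int ^ 2 ^ 2 \<Rightarrow> complex \<Rightarrow> complex"
  where "slash k f A \<tau> = f (moebius_act A \<tau>) / autom_factor A \<tau> ^ k"

definition q_pow :: "real \<Rightarrow> complex \<Rightarrow> complex"
  where "q_pow r \<tau> = exp (2 * of_real pi * \<i> * of_real r * \<tau>)"

text \<open>A function on \<^term>\<open>uhp\<close> of period \<open>N\<close> is holomorphic at infinity if it is
  \<open>g (q_pow (1/N) \<tau>)\<close> where \<open>g\<close> is holomorphic on the whole unit disc, including the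
  point \<open>0\<close> which corresponds to infinity.\<close>

definition holo_at_infinity :: "nat \<Rightarrow> (complex \<Rightarrow> complex) \<Rightarrow> bool"
  where "holo_at_infinity N f \<longleftrightarrow>
    (\<exists>g. g holomorphic_on ball 0 1 \<and> (\<forall>\<tau>\<in>uhp. f \<tau> = g (q_pow (1 / real N) \<tau>)))"

text \<open>Every cusp is of the form \<open>A \<infinity>\<close> with \<open>A \<in> SL2Z\<close>.\<close>

definition modular_forms :: "nat \<Rightarrow> nat \<Rightarrow> (complex \<Rightarrow> complex) set"
  where "modular_forms N k = {f \<in> carrier holo_ring.
    (\<forall>A\<in>Gamma N. \<forall>\<tau>\<in>uhp. f (moebius_act A \<tau>) = autom_factor A \<tau> ^ k * f \<tau>) \<and>
    (\<forall>A\<in>SL2Z. holo_at_infinity N (slash k f A))}"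

text \<open>The sum of the spaces of modular forms of all weights, which is direct by
  \<open>modular_forms_independent\<close> below.\<close>

definition modular_forms_ring :: "nat \<Rightarrow> (complex \<Rightarrow> complex) set"
  where "modular_forms_ring N =
    {(\<lambda>\<tau>\<in>uhp. \<Sum>k\<in>K. f k \<tau>) |K f. finite K \<and> (\<forall>k\<in>K. f k \<in> modular_forms N k)}"

lemma modular_forms_independent:
  assumes "N > 0" "finite K" "\<And>k. k \<in> K \<Longrightarrow> f k \<in> modular_forms N k"
    and sum0: "\<And>\<tau>. \<tau> \<in> uhp \<Longrightarrow> (\<Sum>k\<in>K. f k \<tau>) = 0"
    and "k \<in> K" "\<tau> \<in> uhp"
  shows "f k \<tau> = 0"
proof -
  define p where "p = (\<Sum>k\<in>K. Polynomial.monom (f k \<tau>) k)"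
  define A :: "nat \<Rightarrow> int ^ 2 ^ 2"
    where "A m = vector [vector [1, 0], vector [int (N * m), 1]]" for m
  have A_entries: "A m $ 1 $ 1 = 1" "A m $ 1 $ 2 = 0" "A m $ 2 $ 1 = int (N * m)" "A m $ 2 $ 2 = 1" for m
    by (simp_all add: A_def)
  have detA: "det (A m) = 1" for m
    by (simp add: det_2 A_entries)
  have A_Gamma: "A m \<in> Gamma N" for m
    unfolding Gamma_def SL2Z_def
    by (auto simp: detA forall_2 A_entries mat_def cong_def)
  have nz: "autom_factor (A m) \<tau> \<noteq> 0" for m
  proof
    assume 0: "autom_factor (A m) \<tau> = 0"
    then have "Im (autom_factor (A m) \<tau>) = 0" by simp
    then have "N * m = 0"
      using \<open>\<tau> \<in> uhp\<close> by (auto simp: autom_factor_def A_entries uhp_def)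
    with 0 show False
      unfolding autom_factor_def A_entries by auto
  qed
  have act: "moebius_act (A m) \<tau> \<in> uhp" for m
  proof -
    have "Im (moebius_act (A m) \<tau>) = Im \<tau> / (cmod (autom_factor (A m) \<tau>))\<^sup>2"
      unfolding moebius_act_def Im_divide cmod_power2
      by (simp add: autom_factor_def A_entries algebra_simps)
    then show ?thesis
      using \<open>\<tau> \<in> uhp\<close> nz[of m] by (simp add: uhp_def)
  qed
  have root: "poly p (autom_factor (A m) \<tau>) = 0" for m
  proof -
    have "poly p (autom_factor (A m) \<tau>) = (\<Sum>k\<in>K. autom_factor (A m) \<tau> ^ k * f k \<tau>)"
      by (simp add: p_def poly_sum poly_monom mult.commute)
    also have "\<dots> = (\<Sum>k\<in>K. f k (moebius_act (A m) \<tau>))"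
    proof (rule sum.cong)
      fix k assume "k \<in> K"
      then show "autom_factor (A m) \<tau> ^ k * f k \<tau> = f k (moebius_act (A m) \<tau>)"
        using assms(3)[of k] A_Gamma[of m] \<open>\<tau> \<in> uhp\<close> by (simp add: modular_forms_def)
    qed simp
    also have "\<dots> = 0" by (rule sum0[OF act])
    finally show ?thesis .
  qed
  have "inj (\<lambda>m. autom_factor (A m) \<tau>)"
    using \<open>N > 0\<close> \<open>\<tau> \<in> uhp\<close>
    by (auto simp: inj_def autom_factor_def A_entries uhp_def)
  then have "infinite (range (\<lambda>m. autom_factor (A m) \<tau>))"
    by (rule range_inj_infinite)
  moreover have "range (\<lambda>m. autom_factor (A m) \<tau>) \<subseteq> {x. poly p x = 0}"
    using root by auto
  ultimately have "p = 0"
    using poly_roots_finite finite_subset by blast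
  then have "Polynomial.coeff p k = 0" by simp
  then show ?thesis
    using \<open>finite K\<close> \<open>k \<in> K\<close> by (simp add: p_def coeff_sum)
qed


subsection \<open>Eisenstein series\<close>

definition E22 :: "complex \<Rightarrow> complex"
  where "E22 \<tau> = 1 + 24 * (\<Sum>n. of_nat (\<Sum>d | d dvd Suc n \<and> \<not> 2 dvd d. d) * q_pow (real (Suc n)) \<tau>)"

definition chi3 :: "nat \<Rightarrow> int"
  where "chi3 n = (if [n = 1] (mod 3) then 1 else if [n = 2] (mod 3) then - 1 else 0)"

definition E_chi3 :: "complex \<Rightarrow> complex"
  where "E_chi3 \<tau> = 1 + 6 * (\<Sum>n. of_int (\<Sum>d | d dvd Suc n. chi3 d) * q_pow (real (Suc n)) \<tau>)"


subsection \<open>Eta quotients\<close>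

definition eta :: "complex \<Rightarrow> complex"
  where "eta \<tau> = q_pow (1 / 24) \<tau> * (\<Prod>n. 1 - q_pow (real (Suc n)) \<tau>)"

definition eta_flat :: "complex \<Rightarrow> complex"
  where "eta_flat \<tau> = eta (\<tau> / 2) ^ 2 / eta \<tau>"

definition eta_sharp :: "complex \<Rightarrow> complex"
  where "eta_sharp \<tau> = eta (2 * \<tau>) ^ 2 / eta \<tau>"

definition eta_bot :: "complex \<Rightarrow> complex"
  where "eta_bot \<tau> = eta (\<tau> / 3) ^ 3 / eta \<tau>"

definition eta_top :: "complex \<Rightarrow> complex"
  where "eta_top \<tau> = eta (3 * \<tau>) ^ 3 / eta \<tau>"

end

theory Submission
  imports Defs "HOL-Complex_Analysis.Complex_Analysis"
begin

text \<open>
  Both rings are treated alike. Let \<open>p\<close> be 2 or 3, let \<open>E\<close> be the Eisenstein series in question, of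
  weight \<open>w\<close> (2 for \<open>p = 2\<close>, 1 for \<open>p = 3\<close>), and put \<open>t = (E(\<tau>/p) - E(\<tau>)) / r\<close> with \<open>r = 24\<close> or \<open>6\<close> and
  \<open>b = E - s t\<close> with \<open>s = 8\<close> or \<open>3\<close>. Then \<open>t\<close> has a simple zero at infinity (in \<open>q^(1/p)\<close>), \<open>b\<close> has the value 1 there,
  and the two functions span the same plane as \<open>E(\<tau>/p)\<close> and \<open>E(\<tau>)\<close>.

  Why \<open>E\<close> is modular. The odd function \<open>z \<mapsto> polar z \<tau>\<close> with simple poles on the lattice \<open>\<int> + \<int>\<tau>\<close>, period
  1 and \<open>polar (z + \<tau>) \<tau> = polar z \<tau> - 1\<close>, is determined by these properties, because the difference of
  two such functions is odd, entire and doubly periodic, hence zero by Liouville. The lattice only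
  depends on \<open>\<tau>\<close> up to the action of \<open>SL2Z\<close> and scaling, so \<open>polar\<close> obeys a transformation law
  (\<open>polar_modular\<close>). Its values at the division points \<open>1/3\<close> and \<open>\<tau>/3\<close> give \<open>E_chi3(\<tau>)\<close> and \<open>E_chi3(\<tau>/3)\<close>,
  and the linear term of its Laurent expansion at 0 gives \<open>E2\<close>, from which \<open>E22\<close> is built. This yields the invariance of \<open>E\<close> and of \<open>E(\<tau>/p)\<close> under
  \<open>Gamma p\<close> as well as the relation between them given by \<open>\<tau> \<mapsto> -1/\<tau>\<close>. The logarithmic derivative of
  \<open>eta\<close> is also a multiple of \<open>E2\<close>, which yields \<open>|eta (-1/\<tau>)|^2 = |\<tau>| |eta \<tau>|^2\<close>.

  Why \<open>t\<close> and \<open>b\<close> are eta quotients. The \<open>p + 1\<close> functions \<open>t(\<tau>)\<close> and \<open>b(\<tau> + j)\<close> are permuted, up to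
  constants and the weight factor, by \<open>\<tau> \<mapsto> \<tau> + 1\<close> and \<open>\<tau> \<mapsto> -1/\<tau>\<close>, and so are, with factors of the same
  modulus, the corresponding eta quotients, which have no zeros. Hence the moduli of the \<open>p + 1\<close>
  ratios are permuted by \<open>SL2Z\<close>. All ratios are holomorphic at infinity, so one of them attains the
  maximum of all the moduli in a fundamental domain and is constant (\<open>max_principle_family\<close>). It
  follows that all are constant, and the constant is 1 by comparison at infinity
  (\<open>Rtop_Rbot_eq_1\<close>).

  Why there are no other forms. Knowing \<open>t\<close> as an eta quotient we know that it has no zeros in the
  upper half plane, that its zero at infinity is simple and that it does not vanish at the other
  cusps of \<open>Gamma p\<close>. If \<open>f\<close> is a form of weight \<open>w (m + 1)\<close> with value \<open>c\<close> at infinity, then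
  \<open>(f - c b^(m+1)) / t\<close> is thus a form of weight \<open>w m\<close> (\<open>divide_by_t\<close>), and induction on \<open>m\<close> shows that \<open>f\<close>
  is a polynomial in \<open>b\<close> and \<open>t\<close>. The induction starts with forms of weight 0, which are constant by
  the same maximum principle. For \<open>p = 2\<close> there are no forms of odd weight, since \<open>-1\<close> lies in
  \<open>Gamma 2\<close>.
\<close>

no_notation fps_nth (infixl "$" 75)

section \<open>Lambert series\<close>

lemma q_pow_mult_nat: "q_pow (real n * r) \<tau> = q_pow r \<tau> ^ n"
  by (simp add: q_pow_def exp_of_nat_mult [symmetric] mult_ac)

lemma q_pow_Suc: "q_pow (real (Suc n)) \<tau> = q_pow 1 \<tau> ^ Suc n"
  using q_pow_mult_nat[of "Suc n" 1 \<tau>] by simp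

lemma q_pow_of_nat_mult: "q_pow r (of_nat n * \<tau>) = q_pow r \<tau> ^ n"
  by (simp add: q_pow_def exp_of_nat_mult [symmetric] mult_ac)

lemma q_pow_nonzero [simp]: "q_pow r \<tau> \<noteq> 0"
  by (simp add: q_pow_def)

lemma norm_q_pow: "norm (q_pow r \<tau>) = exp (- (2 * pi * r * Im \<tau>))"
  by (simp add: q_pow_def)

lemma norm_q_pow_less_1: "r > 0 \<Longrightarrow> \<tau> \<in> uhp \<Longrightarrow> norm (q_pow r \<tau>) < 1"
  by (simp add: norm_q_pow uhp_def)

lemma open_uhp: "open uhp"
  unfolding uhp_def by (rule open_halfspace_Im_gt)

lemma convex_uhp: "convex uhp"
  unfolding uhp_def by (rule convex_halfspace_Im_gt)

lemma holomorphic_q_pow: "q_pow r holomorphic_on A"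
  unfolding q_pow_def by (intro holomorphic_intros)

definition lambert :: "(nat \<Rightarrow> complex) \<Rightarrow> complex \<Rightarrow> complex" where
  "lambert a x = (\<Sum>n. (\<Sum>d | d dvd Suc n. a d) * x ^ Suc n)"

lemma has_sum_from_1_iff:
  fixes f :: "nat \<Rightarrow> 'a :: {comm_monoid_add, topological_space}"
  shows "(f has_sum S) {1..} \<longleftrightarrow> ((\<lambda>n. f (Suc n)) has_sum S) UNIV"
  by (rule has_sum_reindex_bij_witness[of _ Suc "\<lambda>n. n - 1"]) auto

text \<open>Rearranging the double series over \<open>d\<close> and \<open>m\<close> in three ways (by \<open>d\<close>, by \<open>m\<close>, by the product \<open>d m\<close>)
  gives all the identities between Lambert series needed below; this is the absolute convergence
  that permits it.\<close>
lemma lambert_summable_pairs: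
  fixes x :: complex
  assumes a: "\<And>d. norm (a d) \<le> real d" and x: "norm x < 1"
  shows "(\<lambda>(d, m). norm (a d * x ^ (d * m))) summable_on ({1..} \<times> {1..})"
proof -
  define r where "r = norm x"
  have r: "0 \<le> r" "r < 1" using x by (auto simp: r_def)
  have rd: "r ^ d \<le> r" "0 \<le> r ^ d" if "d \<ge> 1" for d
    using that r power_decreasing[of 1 d r] by auto
  have inner: "((\<lambda>m. real d * r ^ (d * m)) has_sum (real d * (r ^ d / (1 - r ^ d)))) {1..}"
    if "d \<ge> 1" for d
  proof -
    have "(\<lambda>m. (r ^ d) * (r ^ d) ^ m) sums (r ^ d * (1 / (1 - r ^ d)))"
      using rd[OF that] r by (intro sums_mult geometric_sums) auto
    then have "((\<lambda>m. (r ^ d) * (r ^ d) ^ m) has_sum (r ^ d * (1 / (1 - r ^ d)))) UNIV"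
      using rd[OF that] by (intro sums_nonneg_imp_has_sum) auto
    then have "((\<lambda>m. real d * ((r ^ d) * (r ^ d) ^ m)) has_sum (real d * (r ^ d * (1 / (1 - r ^ d))))) UNIV"
      by (rule has_sum_cmult_right)
    then show ?thesis
      unfolding has_sum_from_1_iff by (simp only: power_mult power_Suc times_divide_eq_right mult_1_right)
  qed
  have "(\<lambda>n. r / (1 - r) * (real (Suc n) * r ^ n)) sums (r / (1 - r) * (1 / (1 - r)^2))"
    using r by (intro sums_mult geometric_deriv_sums) auto
  then have "((\<lambda>n. r / (1 - r) * (real (Suc n) * r ^ n)) has_sum (r / (1 - r) * (1 / (1 - r)^2))) UNIV"
    using r by (intro sums_nonneg_imp_has_sum) auto
  then have "((\<lambda>d. real d * r ^ d / (1 - r)) has_sum (r / (1 - r) * (1 / (1 - r)^2))) {1..}"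
    unfolding has_sum_from_1_iff by (simp add: mult_ac)
  then have outer: "(\<lambda>d. real d * (r ^ d / (1 - r ^ d))) summable_on {1..}"
  proof (rule summable_on_comparison_test[OF has_sum_imp_summable])
    fix d :: nat assume "d \<in> {1..}"
    then have d: "d \<ge> 1" by simp
    show "real d * (r ^ d / (1 - r ^ d)) \<le> real d * r ^ d / (1 - r)"
      using rd[OF d] r by (simp add: frac_le mult_left_mono)
    show "0 \<le> real d * (r ^ d / (1 - r ^ d))"
      using rd[OF d] r by simp
  qed
  have "(\<lambda>(d, m). real d * r ^ (d * m)) summable_on ({1..} \<times> {1..})"
    using r inner outer by (intro summable_on_SigmaI[where g = "\<lambda>d. real d * (r ^ d / (1 - r ^ d))"]) auto
  then show ?thesis
    by (rule summable_on_comparison_test)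
       (use a in \<open>auto simp: norm_mult norm_power r_def intro!: mult_right_mono\<close>)
qed

lemma lambert_pairs:
  assumes a: "\<And>d. norm (a d) \<le> real d" and x: "norm x < 1"
  shows "((\<lambda>(d, m). a d * x ^ (d * m)) has_sum lambert a x) ({1..} \<times> {1..})"
    and "(\<lambda>n. (\<Sum>d | d dvd Suc n. a d) * x ^ Suc n) sums lambert a x"
proof -
  let ?f = "\<lambda>(d, m). a d * x ^ (d * m)"
  have "(\<lambda>z. norm (?f z)) summable_on ({1..} \<times> {1..})"
    using lambert_summable_pairs[OF assms] by (simp add: case_prod_unfold)
  then have "?f summable_on ({1..} \<times> {1..})"
    by (rule abs_summable_summable)
  then obtain S where S: "(?f has_sum S) ({1..} \<times> {1..})"
    by (auto simp: summable_on_def)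
  also have "(?f has_sum S) ({1..} \<times> {1..}) \<longleftrightarrow>
      ((\<lambda>(n, d). a d * x ^ n) has_sum S) (Sigma {1..} (\<lambda>n. {d. d dvd n}))"
    by (rule has_sum_reindex_bij_witness[of _ "\<lambda>(n, d). (d, n div d)" "\<lambda>(d, m). (d * m, d)"])
       (auto simp: dvd_def)
  finally have "((\<lambda>n. (\<Sum>d | d dvd n. a d) * x ^ n) has_sum S) {1..}"
  proof (rule has_sum_SigmaD)
    fix n :: nat assume "n \<in> {1..}"
    then have "finite {d. d dvd n}" by simp
    then show "((\<lambda>d. case (n, d) of (n, d) \<Rightarrow> a d * x ^ n) has_sum (\<Sum>d | d dvd n. a d) * x ^ n) {d. d dvd n}"
      by (auto simp: sum_distrib_right intro!: has_sum_finiteI)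
  qed
  then have *: "(\<lambda>n. (\<Sum>d | d dvd Suc n. a d) * x ^ Suc n) sums S"
    unfolding has_sum_from_1_iff by (rule has_sum_imp_sums)
  then have "S = lambert a x"
    unfolding lambert_def by (rule sums_unique)
  with * S show "(?f has_sum lambert a x) ({1..} \<times> {1..})"
    "(\<lambda>n. (\<Sum>d | d dvd Suc n. a d) * x ^ Suc n) sums lambert a x" by simp_all
qed

lemma geometric_sums_from_1:
  fixes y :: complex
  assumes "norm y < 1"
  shows "(\<lambda>m. y ^ Suc m) sums (y / (1 - y))"
  using sums_mult[OF geometric_sums[OF assms], of y] by simp

lemma lambert_sums:
  assumes a: "\<And>d. norm (a d) \<le> real d" and x: "norm x < 1"
  shows "(\<lambda>d. a (Suc d) * (x ^ Suc d / (1 - x ^ Suc d))) sums lambert a x"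
proof -
  have "((\<lambda>d. a d * (x ^ d / (1 - x ^ d))) has_sum lambert a x) {1..}"
  proof (rule has_sum_SigmaD[OF lambert_pairs(1)[OF assms]])
    fix d :: nat assume "d \<in> {1..}"
    then have d: "norm (x ^ d) < 1"
      using x by (auto simp: norm_power power_less_one_iff)
    have "summable (\<lambda>m. norm ((x ^ d) ^ Suc m))"
      using sums_summable[OF sums_mult[OF geometric_sums[of "norm (x ^ d)"], of "norm (x^d)"]] d
      by (simp add: norm_mult norm_power)
    from norm_summable_imp_has_sum[OF this geometric_sums_from_1[OF d]]
    have "((\<lambda>m. (x ^ d) ^ m) has_sum (x ^ d / (1 - x ^ d))) {1..}"
      unfolding has_sum_from_1_iff .
    then show "((\<lambda>m. case (d, m) of (d, m) \<Rightarrow> a d * x ^ (d * m)) has_sum a d * (x ^ d / (1 - x ^ d))) {1..}"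
      using has_sum_cmult_right[of "\<lambda>m. (x ^ d) ^ m" "{1..}" _ "a d"] by (simp only: power_mult case_prod_conv)
  qed
  then show ?thesis
    unfolding has_sum_from_1_iff by (rule has_sum_imp_sums)
qed

lemma lambert_sums_swapped:
  assumes a: "\<And>d. norm (a d) \<le> real d" and x: "norm x < 1"
    and g: "\<And>y. norm y < 1 \<Longrightarrow> (\<lambda>d. a (Suc d) * y ^ Suc d) sums g y"
  shows "(\<lambda>m. g (x ^ Suc m)) sums lambert a x"
proof -
  have summ: "(\<lambda>(m, d). a d * x ^ (d * m)) summable_on ({1..} \<times> {1..})"
    and hs: "((\<lambda>(m, d). a d * x ^ (d * m)) has_sum lambert a x) ({1..} \<times> {1..})"
  proof -
    show *: "((\<lambda>(m, d). a d * x ^ (d * m)) has_sum lambert a x) ({1..} \<times> {1..})"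
      using lambert_pairs(1)[of a x, OF a x] by (subst has_sum_swap) simp
    then show "(\<lambda>(m, d). a d * x ^ (d * m)) summable_on ({1..} \<times> {1..})"
      by (rule has_sum_imp_summable)
  qed
  have "((\<lambda>m. g (x ^ m)) has_sum lambert a x) {1..}"
  proof (rule has_sum_SigmaD[OF hs])
    fix m :: nat assume m: "m \<in> {1..}"
    then have xm: "norm (x ^ m) < 1"
      using x by (auto simp: norm_power power_less_one_iff)
    have "(\<lambda>d. a d * x ^ (d * m)) summable_on {1..}"
      using summable_on_SigmaD1[OF summ m] by simp
    then obtain S where S: "((\<lambda>d. a d * x ^ (d * m)) has_sum S) {1..}"
      by (auto simp: summable_on_def)
    then have "(\<lambda>d. a (Suc d) * (x ^ m) ^ (Suc d)) sums S"
      unfolding has_sum_from_1_iff by - (drule has_sum_imp_sums, simp only: power_mult [symmetric] mult.commute[of m])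
    with g[OF xm] have "S = g (x ^ m)"
      by (rule sums_unique2[symmetric])
    with S show "((\<lambda>d. case (m, d) of (m, d) \<Rightarrow> a d * x ^ (d * m)) has_sum g (x ^ m)) {1..}"
      by simp
  qed
  then show ?thesis
    unfolding has_sum_from_1_iff by (rule has_sum_imp_sums)
qed

lemma holomorphic_lambert:
  assumes a: "\<And>d. norm (a d) \<le> real d"
  shows "lambert a holomorphic_on ball 0 1"
proof (rule power_series_holomorphic)
  fix w :: complex assume w: "w \<in> ball 0 1"
  define f where "f = (\<lambda>n. (if n = 0 then 0 else (\<Sum>d | d dvd n. a d)) * w ^ n)"
  from w have "(\<lambda>n. (\<Sum>d | d dvd Suc n. a d) * w ^ Suc n) sums lambert a w"
    by (intro lambert_pairs(2) a) auto
  then have "(\<lambda>n. f (Suc n)) sums lambert a w"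
    by (simp add: f_def)
  then have "f sums lambert a w"
    using sums_Suc_iff[of f "lambert a w"] by (simp add: f_def)
  then show "(\<lambda>n. (if n = 0 then 0 else (\<Sum>d | d dvd n. a d)) * (w - 0) ^ n) sums lambert a w"
    by (simp add: f_def)
qed

lemma lambert_0 [simp]: "lambert a 0 = 0"
  by (simp add: lambert_def)

text \<open>The sum over \<open>m\<close> of \<open>q^m / (1 - q^m)^2\<close> is what the quasi-elliptic function produces, the sum over \<open>d\<close>
  of \<open>d q^d / (1 - q^d)\<close> is what the eta product produces. They agree because both are the series
  with the divisor sums as coefficients.\<close>
lemma lambert_id_sums_squares:
  assumes "norm x < 1"
  shows "(\<lambda>m. x ^ Suc m / (1 - x ^ Suc m) ^ 2) sums lambert of_nat x"
proof (rule lambert_sums_swapped[OF _ assms])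
  fix y :: complex assume y: "norm y < 1"
  show "(\<lambda>d. of_nat (Suc d) * y ^ Suc d) sums (y / (1 - y) ^ 2)"
    using sums_mult[OF geometric_deriv_sums[OF y], of y] by (simp add: mult_ac)
qed simp

text \<open>The divisors that have to be removed are the even ones \<open>2 d\<close>, which contribute twice the
  full series in \<open>x^2\<close>.\<close>
lemma lambert_odd_conv_id:
  assumes x: "norm x < 1"
  shows "lambert (\<lambda>d. if odd d then of_nat d else 0) x = lambert of_nat x - 2 * lambert of_nat (x ^ 2)"
proof -
  have x2: "norm (x ^ 2) < 1"
    using x by (simp add: norm_power power_less_one_iff)
  let ?L = "\<lambda>d. x ^ d / (1 - x ^ d)"
  have 1: "(\<lambda>d. of_nat (Suc d) * ?L (Suc d)) sums lambert of_nat x"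
    by (rule lambert_sums[OF _ x]) simp
  have "(\<lambda>d. of_nat (Suc d) * ((x^2) ^ Suc d / (1 - (x^2) ^ Suc d))) sums lambert of_nat (x^2)"
    by (rule lambert_sums[OF _ x2]) simp
  from sums_mult[OF this, of 2]
  have "(\<lambda>d. of_nat (2 * d + 2) * ?L (2 * d + 2)) sums (2 * lambert of_nat (x^2))"
    by (simp add: power_mult [symmetric] algebra_simps flip: power_Suc power_add)
  then have "(\<lambda>d. (if even (Suc d) then of_nat (Suc d) * ?L (Suc d) else 0)) sums (2 * lambert of_nat (x^2))"
    by (subst sums_mono_reindex[of "\<lambda>d. 2 * d + 1", symmetric])
       (auto simp: strict_mono_def elim!: oddE)
  from sums_diff[OF 1 this] have "(\<lambda>d. (if odd (Suc d) then of_nat (Suc d) else 0) * ?L (Suc d)) sums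
      (lambert of_nat x - 2 * lambert of_nat (x ^ 2))"
    by (rule sums_cong[THEN iffD1, rotated]) auto
  moreover have "(\<lambda>d. (if odd (Suc d) then of_nat (Suc d) else 0) * ?L (Suc d)) sums
     lambert (\<lambda>d. if odd d then of_nat d else 0) x"
    by (rule lambert_sums[OF _ x]) simp
  ultimately show ?thesis
    by (rule sums_unique2[symmetric])
qed

section \<open>An odd quasi-elliptic function with poles on a lattice\<close>

lemma has_field_derivative_series_M:
  fixes f f' :: "nat \<Rightarrow> complex \<Rightarrow> complex"
  assumes S: "open S" and f: "\<And>n x. x \<in> S \<Longrightarrow> (f n has_field_derivative f' n x) (at x)"
    and M: "\<And>n x. x \<in> S \<Longrightarrow> norm (f n x) \<le> M n" "summable M" and x: "x \<in> S"
  shows "((\<lambda>x. \<Sum>n. f n x) has_field_derivative (\<Sum>n. f' n x)) (at x)"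
    and "summable (\<lambda>n. f' n x)"
proof -
  have ul: "uniform_limit S (\<lambda>n x. \<Sum>i<n. f i x) (\<lambda>x. \<Sum>n. f n x) sequentially"
    using M by (rule Weierstrass_m_test)
  have "\<exists>g'. \<forall>x\<in>S. ((\<lambda>x. \<Sum>n. f n x) has_field_derivative g' x) (at x) \<and>
          (\<lambda>n. \<Sum>i<n. f' i x) \<longlonglongrightarrow> g' x"
  proof (rule has_complex_derivative_uniform_sequence[OF S])
    show "((\<lambda>x. \<Sum>i<n. f i x) has_field_derivative (\<Sum>i<n. f' i x)) (at x)" if "x \<in> S" for n x
      using f[OF that] by (rule DERIV_sum)
    show "\<exists>d>0. cball x d \<subseteq> S \<and> uniform_limit (cball x d) (\<lambda>n x. \<Sum>i<n. f i x) (\<lambda>x. \<Sum>n. f n x) sequentially"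
      if "x \<in> S" for x
      using S that ul by (meson open_contains_cball uniform_limit_on_subset)
  qed
  then obtain g' where g': "\<And>x. x \<in> S \<Longrightarrow> ((\<lambda>x. \<Sum>n. f n x) has_field_derivative g' x) (at x)"
      "\<And>x. x \<in> S \<Longrightarrow> (\<lambda>n. f' n x) sums g' x"
    unfolding sums_def by blast
  show "((\<lambda>x. \<Sum>n. f n x) has_field_derivative (\<Sum>n. f' n x)) (at x)"
    using g'[OF x] sums_unique by metis
  show "summable (\<lambda>n. f' n x)"
    using g'(2)[OF x] by (rule sums_summable)
qed

text \<open>Half of the lattice sum for \<open>polar\<close> below: the poles in \<open>x = exp(2 \<pi> i z)\<close> are the powers \<open>q^(-n)\<close> with
  \<open>n > 0\<close>, that is, the translates of \<open>z = 0\<close> by the lattice points in the lower half plane.\<close>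
definition polar_sum :: "complex \<Rightarrow> complex \<Rightarrow> complex" where
  "polar_sum q x = (\<Sum>n. x * q ^ Suc n / (1 - x * q ^ Suc n))"

lemma polar_term_bound:
  fixes y :: complex assumes "norm y \<le> 1/2"
  shows "norm (y / (1 - y)) \<le> 2 * norm y" "y \<noteq> 1"
proof -
  show "y \<noteq> 1" using assms by auto
  have "1/2 \<le> norm (1 - y)"
    using norm_triangle_ineq2[of 1 y] assms by simp
  then have "norm y / norm (1 - y) \<le> norm y / (1/2)"
    by (intro divide_left_mono) auto
  then show "norm (y / (1 - y)) \<le> 2 * norm y"
    by (simp add: norm_divide)
qed

lemma eventually_small_powers:
  assumes "norm (q::complex) < 1" "R > 0"
  obtains M where "\<And>n x. norm (x::complex) \<le> R \<Longrightarrow> norm (x * q ^ Suc (n + M)) \<le> 1/2"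
    "\<And>n x. norm (x::complex) \<le> R \<Longrightarrow> norm (x * q ^ Suc (n + M)) \<le> R * norm q ^ n"
proof -
  have "(\<lambda>n. R * norm q ^ n) \<longlonglongrightarrow> R * 0"
    using assms by (intro tendsto_intros LIMSEQ_power_zero) auto
  then have "eventually (\<lambda>n. R * norm q ^ n < 1/2) sequentially"
    by (rule order_tendstoD) simp
  then obtain M where M: "R * norm q ^ M < 1/2"
    by (auto simp: eventually_sequentially)
  have 1: "norm (x * q ^ Suc (n + M)) \<le> R * norm q ^ k" if "norm x \<le> R" "k \<le> Suc (n + M)" for n x k
    using assms that by (auto simp: norm_mult norm_power simp del: power_Suc intro!: mult_mono power_decreasing)
  show ?thesis
  proof (rule that)
    fix n :: nat and x :: complex assume x: "norm x \<le> R"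
    show "norm (x * q ^ Suc (n + M)) \<le> 1/2"
      using 1[OF x, of M n] M by linarith
    show "norm (x * q ^ Suc (n + M)) \<le> R * norm q ^ n"
      using 1[OF x, of n n] by simp
  qed
qed

lemma summable_polar_sum:
  fixes q x :: complex
  assumes q: "norm q < 1"
  shows "summable (\<lambda>n. x * q ^ Suc n / (1 - x * q ^ Suc n))"
proof -
  obtain M where M: "\<And>n y. norm (y::complex) \<le> norm x + 1 \<Longrightarrow> norm (y * q ^ Suc (n + M)) \<le> 1/2"
    "\<And>n y. norm (y::complex) \<le> norm x + 1 \<Longrightarrow> norm (y * q ^ Suc (n + M)) \<le> (norm x + 1) * norm q ^ n"
    using eventually_small_powers[OF q, of "norm x + 1"] by (metis add_nonneg_pos norm_ge_zero zero_less_one)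
  have "summable (\<lambda>n. x * q ^ Suc (n + M) / (1 - x * q ^ Suc (n + M)))"
  proof (rule summable_comparison_test)
    show "summable (\<lambda>n. 2 * ((norm x + 1) * norm q ^ n))"
      using q by (intro summable_mult summable_geometric) auto
    show "\<exists>N. \<forall>n\<ge>N. norm (x * q ^ Suc (n + M) / (1 - x * q ^ Suc (n + M))) \<le> 2 * ((norm x + 1) * norm q ^ n)"
    proof (intro exI[of _ 0] allI impI)
      fix n
      show "norm (x * q ^ Suc (n + M) / (1 - x * q ^ Suc (n + M))) \<le> 2 * ((norm x + 1) * norm q ^ n)"
        using polar_term_bound(1)[OF M(1)[of x n]] M(2)[of x n] by linarith
    qed
  qed
  then show ?thesis
    by (subst (asm) summable_iff_shift[where f = "\<lambda>n. x * q ^ Suc n / (1 - x * q ^ Suc n)"])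
qed

text \<open>Only finitely many terms have a pole near a given point; the remaining ones are dominated by a
  geometric series on a whole disc, so that the series may be differentiated termwise.\<close>
lemma has_field_derivative_polar_sum:
  assumes q: "norm q < 1" and x: "\<And>n. x * q ^ Suc n \<noteq> 1"
  shows "(polar_sum q has_field_derivative (\<Sum>n. q ^ Suc n / (1 - x * q ^ Suc n) ^ 2)) (at x)"
proof -
  let ?t = "\<lambda>n x. x * q ^ Suc n / (1 - x * q ^ Suc n)" and ?t' = "\<lambda>n x. q ^ Suc n / (1 - x * q ^ Suc n) ^ 2"
  define R where "R = norm x + 1"
  have R: "R > 0" by (simp add: R_def add_nonneg_pos)
  obtain M where M: "\<And>n y. norm (y::complex) \<le> R \<Longrightarrow> norm (y * q ^ Suc (n + M)) \<le> 1/2"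
    "\<And>n y. norm (y::complex) \<le> R \<Longrightarrow> norm (y * q ^ Suc (n + M)) \<le> R * norm q ^ n"
    using eventually_small_powers[OF q R] by metis
  have d: "(?t n has_field_derivative ?t' n y) (at y)" if "y * q ^ Suc n \<noteq> 1" for n y
    by (rule derivative_eq_intros refl | use that in \<open>simp; fail\<close>)+
       (use that in \<open>simp add: divide_simps power2_eq_square; simp add: algebra_simps\<close>)
  have xR: "x \<in> ball 0 R" by (simp add: R_def)
  have b: "norm (?t (n + M) y) \<le> 2 * (R * norm q ^ n)" if "y \<in> ball 0 R" for n y
    using polar_term_bound(1)[OF M(1)[of y n]] M(2)[of y n] that by (simp del: power_Suc) 
  have sm: "summable (\<lambda>n. 2 * (R * norm q ^ n))"
    using q by (intro summable_mult summable_geometric) auto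
  have d2: "(?t (n + M) has_field_derivative ?t' (n + M) y) (at y)" if "y \<in> ball 0 R" for n y
    using that polar_term_bound(2)[OF M(1)[of y n]] by (intro d) auto
  have tail1: "((\<lambda>y. \<Sum>n. ?t (n + M) y) has_field_derivative (\<Sum>n. ?t' (n + M) x)) (at x)"
    by (rule has_field_derivative_series_M(1)[OF open_ball d2 b sm xR])
  have tail2: "summable (\<lambda>n. ?t' (n + M) x)"
    by (rule has_field_derivative_series_M(2)[OF open_ball d2 b sm xR])
  have eq: "polar_sum q y = (\<Sum>n. ?t (n + M) y) + (\<Sum>n<M. ?t n y)" for y
    unfolding polar_sum_def by (rule suminf_split_initial_segment[OF summable_polar_sum[OF q]])
  have eq': "(\<Sum>n. ?t' n x) = (\<Sum>n. ?t' (n + M) x) + (\<Sum>n<M. ?t' n x)"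
    using tail2 by (subst (asm) summable_iff_shift[where f = "\<lambda>n. ?t' n x"])
      (rule suminf_split_initial_segment)
  show ?thesis
    unfolding eq eq' using tail1 d[OF x] by (intro DERIV_add DERIV_sum) auto
qed

lemma polar_sum_shift:
  assumes q: "norm q < 1"
  shows "polar_sum q (x * q) = polar_sum q x - x * q / (1 - x * q)"
  using suminf_split_head[OF summable_polar_sum[OF q, of x]]
  by (simp add: polar_sum_def mult_ac)

definition period_lattice :: "complex \<Rightarrow> complex set" where
  "period_lattice \<tau> = {of_int m + of_int n * \<tau> |m n. True}"

definition exp2pi :: "complex \<Rightarrow> complex" where
  "exp2pi z = exp (2 * of_real pi * \<i> * z)"

lemma exp2pi_add: "exp2pi (x + y) = exp2pi x * exp2pi y"
  by (simp add: exp2pi_def exp_add [symmetric] algebra_simps)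

lemma exp2pi_nonzero [simp]: "exp2pi z \<noteq> 0"
  by (simp add: exp2pi_def)

lemma exp2pi_minus: "exp2pi (- z) = 1 / exp2pi z"
  by (simp add: exp2pi_def exp_minus divide_simps)

lemma exp2pi_eq_1_iff: "exp2pi z = 1 \<longleftrightarrow> z \<in> \<int>"
proof -
  have "exp2pi z = 1 \<longleftrightarrow> (\<exists>n::int. z = of_int n)"
    unfolding exp2pi_def exp_eq_1
    by (auto simp: complex_eq_iff mult_ac)
  then show ?thesis by (auto simp: Ints_def)
qed

lemma exp2pi_of_int [simp]: "exp2pi (of_int n) = 1"
  by (simp add: exp2pi_eq_1_iff)

lemma q_pow_conv_exp2pi: "q_pow r \<tau> = exp2pi (of_real r * \<tau>)"
  by (simp add: q_pow_def exp2pi_def mult_ac)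

text \<open>Up to the factor \<open>2 \<pi> i\<close> this is the logarithmic derivative in \<open>z\<close> of the Jacobi theta function with
  zeros on the lattice \<open>\<int> + \<int>\<tau>\<close>, written as the sum over \<open>n\<close> of \<open>cot (\<pi> (z + n \<tau>)) / (2 i)\<close>.\<close>
definition polar :: "complex \<Rightarrow> complex \<Rightarrow> complex" where
  "polar z \<tau> = (exp2pi z + 1) / (exp2pi z - 1) / 2 -
     (polar_sum (q_pow 1 \<tau>) (exp2pi z) - polar_sum (q_pow 1 \<tau>) (exp2pi (- z)))"

lemma polar_minus: "polar (- z) \<tau> = - polar z \<tau>"
proof -
  have "(exp2pi (- z) + 1) / (exp2pi (- z) - 1) = - ((exp2pi z + 1) / (exp2pi z - 1))"
    unfolding exp2pi_minus by (cases "exp2pi z = 1") (auto simp: divide_simps, (simp add: algebra_simps)?)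
  then show ?thesis by (simp add: polar_def)
qed

lemma polar_add_1: "polar (z + 1) \<tau> = polar z \<tau>"
proof -
  have "exp2pi (z + 1) = exp2pi z" "exp2pi (- (z + 1)) = exp2pi (- z)"
    using exp2pi_add[of z 1] exp2pi_add[of "-z" "-1"] exp2pi_of_int[of 1] exp2pi_of_int[of "-1"]
    by simp_all
  then show ?thesis by (simp add: polar_def)
qed

lemma exp2pi_notin_lattice:
  assumes "z \<notin> period_lattice \<tau>"
  shows "exp2pi (z + of_int n * \<tau>) \<noteq> 1"
proof
  assume "exp2pi (z + of_int n * \<tau>) = 1"
  then obtain m where "z + of_int n * \<tau> = of_int m"
    by (auto simp: exp2pi_eq_1_iff Ints_def)
  then have "z = of_int m + of_int (- n) * \<tau>" by (simp add: algebra_simps)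
  with assms show False unfolding period_lattice_def by blast
qed

lemma q_pow_power_exp2pi: "q_pow 1 \<tau> ^ n = exp2pi (of_nat n * \<tau>)"
  using q_pow_mult_nat[of n 1 \<tau>] by (simp add: q_pow_conv_exp2pi)

text \<open>Passing from \<open>z\<close> to \<open>z + \<tau>\<close> shifts the summation index by one; the jump comes from the different
  limits of the cotangent at the two ends.\<close>
lemma polar_add_tau:
  assumes \<tau>: "\<tau> \<in> uhp" and z: "z \<notin> period_lattice \<tau>"
  shows "polar (z + \<tau>) \<tau> = polar z \<tau> - 1"
proof -
  define w q where "w = exp2pi z" and "q = q_pow 1 \<tau>"
  have q: "norm q < 1" using norm_q_pow_less_1[OF _ \<tau>, of 1] by (simp add: q_def)
  have q': "q = exp2pi \<tau>" by (simp add: q_def q_pow_conv_exp2pi)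
  have [simp]: "q \<noteq> 0" "w \<noteq> 0" by (auto simp: q_def w_def)
  have w1: "w \<noteq> 1" "w * q \<noteq> 1"
    using exp2pi_notin_lattice[OF z, of 0] exp2pi_notin_lattice[OF z, of 1]
    by (auto simp: w_def q' exp2pi_add)
  have ws: "exp2pi (z + \<tau>) = w * q" "exp2pi (- (z + \<tau>)) = 1 / (w * q)" "exp2pi (- z) = 1 / w"
    unfolding exp2pi_minus by (simp_all add: w_def q' exp2pi_add exp2pi_minus)
  have 1: "polar_sum q (w * q) = polar_sum q w - w * q / (1 - w * q)"
    by (rule polar_sum_shift[OF q])
  have 2: "polar_sum q (1 / w) = polar_sum q (1 / (w * q)) - (1 / w) / (1 - 1 / w)"
    using polar_sum_shift[OF q, of "1 / (w * q)"] by simp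
  have 3: "(1 / w) / (1 - 1 / w) = 1 / (w - 1)"
    using w1 by (simp add: divide_simps)
  have 4: "(w * q + 1) / (w * q - 1) = 1 + 2 / (w * q - 1)" "w * q / (1 - w * q) = - 1 - 1 / (w * q - 1)"
     "(w + 1) / (w - 1) = 1 + 2 / (w - 1)"
    using w1 by (auto simp: divide_simps) (simp add: algebra_simps)?
  have 5: "(1 + 2 / a) / 2 = 1 / 2 + 1 / a" for a :: complex
    by (simp add: add_divide_distrib)
  show ?thesis
    unfolding polar_def ws q_def[symmetric] w_def[symmetric] 1 2 3 4 5 by simp
qed

lemma period_lattice_shift:
  "z + of_int m + of_int n * \<tau> \<in> period_lattice \<tau> \<longleftrightarrow> z \<in> period_lattice \<tau>"
proof -
  have *: "z + of_int m + of_int n * \<tau> \<in> period_lattice \<tau>" if "z \<in> period_lattice \<tau>" for z m n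
  proof -
    from that obtain k l where "z = of_int k + of_int l * \<tau>" by (auto simp: period_lattice_def)
    then have "z + of_int m + of_int n * \<tau> = of_int (k + m) + of_int (l + n) * \<tau>"
      by (simp add: algebra_simps)
    then show ?thesis unfolding period_lattice_def by blast
  qed
  show ?thesis
    using *[of z m n] *[of "z + of_int m + of_int n * \<tau>" "-m" "-n"] by (auto simp: algebra_simps)
qed

lemma polar_quasiperiodic:
  assumes \<tau>: "\<tau> \<in> uhp" and z: "z \<notin> period_lattice \<tau>"
  shows "polar (z + of_int m + of_int n * \<tau>) \<tau> = polar z \<tau> - of_int n"
proof -
  have 1: "polar (z + of_nat m) \<tau> = polar z \<tau>" for z m
  proof (induction m)
    case (Suc m)
    then show ?case using polar_add_1[of "z + of_nat m"] by (simp add: algebra_simps)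
  qed simp
  have 1: "polar (z + of_int m) \<tau> = polar z \<tau>" for z m
  proof (cases "m \<ge> 0")
    case True
    then show ?thesis using 1[of z "nat m"] by simp
  next
    case False
    then show ?thesis using 1[of "z + of_int m" "nat (-m)"] by simp
  qed
  have 2: "polar (z + of_nat n * \<tau>) \<tau> = polar z \<tau> - of_nat n" if "z \<notin> period_lattice \<tau>" for z n
  proof (induction n)
    case (Suc n)
    have "z + of_nat n * \<tau> \<notin> period_lattice \<tau>"
      using period_lattice_shift[of z 0 "int n" \<tau>] that by simp
    from polar_add_tau[OF \<tau> this]
    have "polar (z + of_nat (Suc n) * \<tau>) \<tau> = polar (z + of_nat n * \<tau>) \<tau> - 1"
      by (simp add: algebra_simps)
    then show ?case unfolding Suc.IH by simp
  qed simp
  have 2: "polar (z + of_int n * \<tau>) \<tau> = polar z \<tau> - of_int n" if z: "z \<notin> period_lattice \<tau>" for z n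
  proof (cases "n \<ge> 0")
    case True
    then show ?thesis using 2[OF z, of "nat n"] by simp
  next
    case False
    have "z + of_int n * \<tau> \<notin> period_lattice \<tau>"
      using period_lattice_shift[of z 0 n \<tau>] z by simp
    from 2[OF this, of "nat (-n)"] False show ?thesis by simp
  qed
  have "z + of_int m \<notin> period_lattice \<tau>"
    using period_lattice_shift[of z m 0 \<tau>] z by simp
  from 2[OF this] 1 show ?thesis by simp
qed

lemma holomorphic_polar:
  assumes \<tau>: "\<tau> \<in> uhp"
  shows "(\<lambda>z. polar z \<tau>) holomorphic_on (- period_lattice \<tau>)"
proof -
  define q where "q = q_pow 1 \<tau>"
  have q: "norm q < 1" using norm_q_pow_less_1[OF _ \<tau>, of 1] by (simp add: q_def)
  define U where "U = {x. \<forall>n. x * q ^ Suc n \<noteq> 1}"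
  have hol: "polar_sum q holomorphic_on U"
    unfolding holomorphic_on_def field_differentiable_def U_def
    using has_field_derivative_polar_sum[OF q] by (blast intro: DERIV_subset)
  have qn: "q ^ n = exp2pi (of_int (int n) * \<tau>)" for n
    by (simp add: q_def q_pow_power_exp2pi)
  have m: "- z \<notin> period_lattice \<tau>" if "z \<notin> period_lattice \<tau>" for z
  proof
    assume "- z \<in> period_lattice \<tau>"
    then obtain k l where "- z = of_int k + of_int l * \<tau>" by (auto simp: period_lattice_def)
    then have "z = - (of_int k + of_int l * \<tau>)" by (metis minus_minus)
    then have "z = of_int (-k) + of_int (-l) * \<tau>" by simp
    with that show False unfolding period_lattice_def by blast
  qed
  have U': "exp2pi z \<in> U" if "z \<notin> period_lattice \<tau>" for z
    unfolding U_def
  proof safe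
    fix n assume "exp2pi z * q ^ Suc n = 1"
    then have "exp2pi (z + of_int (int (Suc n)) * \<tau>) = 1" by (simp only: qn exp2pi_add)
    with exp2pi_notin_lattice[OF that] show False by blast
  qed
  have U: "exp2pi z \<in> U" "exp2pi (- z) \<in> U" if "z \<notin> period_lattice \<tau>" for z
    using U' m that by blast+
  have e: "exp2pi holomorphic_on A" "(\<lambda>z. exp2pi (- z)) holomorphic_on A" for A
    unfolding exp2pi_def by (intro holomorphic_intros)+
  have 1: "(\<lambda>z. polar_sum q (exp2pi z)) holomorphic_on (- period_lattice \<tau>)"
    using holomorphic_on_compose_gen[OF e(1) hol, of "- period_lattice \<tau>"] U by (auto simp: o_def)
  have 2: "(\<lambda>z. polar_sum q (exp2pi (- z))) holomorphic_on (- period_lattice \<tau>)"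
    using holomorphic_on_compose_gen[OF e(2) hol, of "- period_lattice \<tau>"] U by (auto simp: o_def)
  show ?thesis
    unfolding polar_def q_def[symmetric]
    by (intro holomorphic_intros 1 2 e) (use exp2pi_notin_lattice[of _ \<tau> 0] in auto)
qed

lemma period_lattice_0: "0 \<in> period_lattice \<tau>"
  unfolding period_lattice_def by (rule CollectI, rule exI[of _ 0], rule exI[of _ 0]) simp

text \<open>Real coordinates with respect to the basis \<open>1, \<tau>\<close>. They show that the lattice is closed and
  discrete and that each coset has a representative in a bounded parallelogram.\<close>
lemma period_lattice_coords:
  assumes "\<tau> \<in> uhp"
  shows "z \<in> period_lattice \<tau> \<longleftrightarrow> Im z / Im \<tau> \<in> \<int> \<and> Re z - Im z / Im \<tau> * Re \<tau> \<in> \<int>"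
proof
  assume "z \<in> period_lattice \<tau>"
  then show "Im z / Im \<tau> \<in> \<int> \<and> Re z - Im z / Im \<tau> * Re \<tau> \<in> \<int>"
    using assms by (auto simp: period_lattice_def uhp_def)
next
  assume "Im z / Im \<tau> \<in> \<int> \<and> Re z - Im z / Im \<tau> * Re \<tau> \<in> \<int>"
  then obtain m n where mn: "Im z / Im \<tau> = of_int n" "Re z - Im z / Im \<tau> * Re \<tau> = of_int m"
    by (metis Ints_cases)
  then have "z = of_int m + of_int n * \<tau>"
    using assms by (auto simp: complex_eq_iff uhp_def field_simps)
  then show "z \<in> period_lattice \<tau>" unfolding period_lattice_def by blast
qed

lemma closed_period_lattice:
  assumes "\<tau> \<in> uhp"
  shows "closed (period_lattice \<tau>)"
proof -
  have "period_lattice \<tau> = (\<lambda>z. Im z / Im \<tau>) -` \<int> \<inter> (\<lambda>z. Re z - Im z / Im \<tau> * Re \<tau>) -` \<int>"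
    using period_lattice_coords[OF assms] by auto
  also have "closed \<dots>"
    using assms by (intro closed_Int closed_vimage closed_Ints continuous_intros) (auto simp: uhp_def)
  finally show ?thesis .
qed

lemma open_lattice_complement:
  assumes "\<tau> \<in> uhp"
  shows "open (- (period_lattice \<tau> - {0}))"
proof -
  let ?V = "{z. \<bar>Im z / Im \<tau>\<bar> < 1} \<inter> {z. \<bar>Re z - Im z / Im \<tau> * Re \<tau>\<bar> < 1}"
  have "z \<in> period_lattice \<tau> \<longleftrightarrow> z = 0" if "z \<in> ?V" for z
  proof
    assume "z \<in> period_lattice \<tau>"
    then have *: "Im z / Im \<tau> \<in> \<int>" "Re z - Im z / Im \<tau> * Re \<tau> \<in> \<int>"
      using period_lattice_coords[OF assms] by auto
    then have "Im z / Im \<tau> = 0" using that Ints_nonzero_abs_less1[of "Im z / Im \<tau>"] by blast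
    moreover have "Re z - Im z / Im \<tau> * Re \<tau> = 0"
      using * that Ints_nonzero_abs_less1[of "Re z - Im z / Im \<tau> * Re \<tau>"] by blast
    ultimately show "z = 0" using assms by (auto simp: complex_eq_iff uhp_def)
  qed (simp add: period_lattice_0)
  then have "- (period_lattice \<tau> - {0}) = - period_lattice \<tau> \<union> ?V"
    by (auto simp: period_lattice_0)
  also have "open \<dots>"
    using assms closed_period_lattice[OF assms]
    by (intro open_Un open_Compl open_Int open_Collect_less continuous_intros) (auto simp: uhp_def)
  finally show ?thesis .
qed

lemma lattice_representative:
  assumes "\<tau> \<in> uhp"
  obtains m n where "\<bar>Im (z + of_int m + of_int n * \<tau>) / Im \<tau>\<bar> \<le> 1"
    "\<bar>Re (z + of_int m + of_int n * \<tau>) - Im (z + of_int m + of_int n * \<tau>) / Im \<tau> * Re \<tau>\<bar> \<le> 1"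
proof -
  define b a where "b = Im z / Im \<tau>" and "a = Re z - b * Re \<tau>"
  have [simp]: "Im \<tau> \<noteq> 0" using assms by (auto simp: uhp_def)
  have 1: "Im (z + of_int m + of_int n * \<tau>) / Im \<tau> = b + of_int n" for m n
    by (simp add: b_def add_divide_distrib)
  have 2: "Re (z + of_int m + of_int n * \<tau>) - (b + of_int n) * Re \<tau> = a + of_int m" for m n
    by (simp add: a_def algebra_simps)
  show ?thesis
  proof (rule that[of "- \<lfloor>a\<rfloor>" "- \<lfloor>b\<rfloor>"])
    show "\<bar>Im (z + of_int (- \<lfloor>a\<rfloor>) + of_int (- \<lfloor>b\<rfloor>) * \<tau>) / Im \<tau>\<bar> \<le> 1"
      unfolding 1 using frac_ge_0[of b] frac_lt_1[of b] by (simp add: frac_def)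
    show "\<bar>Re (z + of_int (- \<lfloor>a\<rfloor>) + of_int (- \<lfloor>b\<rfloor>) * \<tau>) -
        Im (z + of_int (- \<lfloor>a\<rfloor>) + of_int (- \<lfloor>b\<rfloor>) * \<tau>) / Im \<tau> * Re \<tau>\<bar> \<le> 1"
      unfolding 1 2 using frac_ge_0[of a] frac_lt_1[of a] by (simp add: frac_def)
  qed
qed

text \<open>By periodicity all singularities look like the one at 0, which is removable by the hypothesis on
  the limit. The extended function is bounded since it is determined by its values on a compact
  parallelogram. So it is constant by Liouville, and zero because it is odd.\<close>
lemma odd_elliptic_zero:
  assumes \<tau>: "\<tau> \<in> uhp" and hol: "D holomorphic_on - period_lattice \<tau>"
    and per: "\<And>z m n. z \<notin> period_lattice \<tau> \<Longrightarrow> D (z + of_int m + of_int n * \<tau>) = D z"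
    and odd: "\<And>z. z \<notin> period_lattice \<tau> \<Longrightarrow> D (- z) = - D z"
    and lim: "((\<lambda>z. z * D z) \<longlongrightarrow> 0) (at 0)"
    and z: "z \<notin> period_lattice \<tau>"
  shows "D z = 0"
proof -
  let ?L = "period_lattice \<tau>"
  have D0: "D holomorphic_on (- (?L - {0})) - {0}"
    by (rule holomorphic_on_subset[OF hol]) (use period_lattice_0 in auto)
  have op: "open (- (?L - {0}))" by (rule open_lattice_complement[OF \<tau>])
  then have "\<exists>g. g holomorphic_on (- (?L - {0})) \<and> (\<forall>z\<in>(- (?L - {0})) - {0}. g z = D z)"
    by (subst holomorphic_on_extend_lim[OF D0]) (use lim in \<open>auto simp: interior_open\<close>)
  then obtain g where g: "g holomorphic_on (- (?L - {0}))" "\<And>z. z \<notin> ?L \<Longrightarrow> g z = D z"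
    using period_lattice_0[of \<tau>] by blast
  \<comment> \<open>Every lattice point receives the value that removes the singularity at 0.\<close>
  define G where "G = (\<lambda>z. if z \<in> ?L then g 0 else D z)"
  have Gg: "G z = g z" if "z \<in> - (?L - {0})" for z
    using that g(2) by (auto simp: G_def)
  have G1: "G holomorphic_on (- (?L - {0}))"
    using holomorphic_transform[OF g(1)] Gg by metis
  have Gper: "G (z + of_int m + of_int n * \<tau>) = G z" for z m n
    using per[of z m n] period_lattice_shift[of z m n \<tau>] by (auto simp: G_def)
  have "G field_differentiable at z" for z
  proof (cases "z \<in> ?L")
    case False
    then show ?thesis using G1 op by (auto simp: holomorphic_on_open field_differentiable_def)
  next
    case True
    then obtain m n where mn: "z = of_int m + of_int n * \<tau>" by (auto simp: period_lattice_def)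
    have "G field_differentiable at 0"
      using G1 op by (auto simp: holomorphic_on_open field_differentiable_def)
    then obtain c where "(G has_field_derivative c) (at (z - (of_int m + of_int n * \<tau>)))"
      by (auto simp: field_differentiable_def mn)
    then have "((\<lambda>y. G (y - (of_int m + of_int n * \<tau>))) has_field_derivative c * 1) (at z)"
      by (rule DERIV_chain2) (auto intro!: derivative_eq_intros)
    moreover have "G (y - (of_int m + of_int n * \<tau>)) = G y" for y
      using Gper[of y "-m" "-n"] by (simp add: algebra_simps)
    ultimately show ?thesis by (auto simp: field_differentiable_def)
  qed
  then have G: "G holomorphic_on UNIV"
    by (simp add: holomorphic_on_def)
  define K where "K = {z. \<bar>Im z / Im \<tau>\<bar> \<le> 1} \<inter> {z. \<bar>Re z - Im z / Im \<tau> * Re \<tau>\<bar> \<le> 1}"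
  have Im\<tau>: "Im \<tau> > 0" using \<tau> by (simp add: uhp_def)
  have "bounded K"
  proof (rule boundedI)
    fix z assume "z \<in> K"
    then have 1: "\<bar>Im z / Im \<tau>\<bar> \<le> 1" and 2: "\<bar>Re z - Im z / Im \<tau> * Re \<tau>\<bar> \<le> 1" by (auto simp: K_def)
    from 1 have "\<bar>Im z / Im \<tau> * Re \<tau>\<bar> \<le> \<bar>Re \<tau>\<bar>"
      unfolding abs_mult using mult_right_mono[of "\<bar>Im z / Im \<tau>\<bar>" 1 "\<bar>Re \<tau>\<bar>"] by simp
    moreover from 1 have "\<bar>Im z\<bar> \<le> Im \<tau>" using Im\<tau> by (simp add: abs_le_iff field_simps)
    ultimately show "norm z \<le> 1 + \<bar>Re \<tau>\<bar> + Im \<tau>"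
      using 2 cmod_le[of z] by linarith
  qed
  moreover have "closed K"
    unfolding K_def using Im\<tau> by (intro closed_Int closed_Collect_le continuous_intros) auto
  ultimately have "compact K" by (simp add: compact_eq_bounded_closed)
  then have "bounded (G ` K)"
    by (intro compact_imp_bounded compact_continuous_image holomorphic_on_imp_continuous_on
        holomorphic_on_subset[OF G]) auto
  moreover have "range G \<subseteq> G ` K"
  proof safe
    fix z
    obtain m n where "z + of_int m + of_int n * \<tau> \<in> K"
      using lattice_representative[OF \<tau>, of z] unfolding K_def by blast
    then show "G z \<in> G ` K" using Gper[of z m n] by (metis image_eqI)
  qed
  ultimately have "bounded (range G)" by (rule bounded_subset)
  with G have "G constant_on UNIV" by (rule Liouville_theorem)
  then obtain c where c: "\<And>z. G z = c" by (auto simp: constant_on_def)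
  have "D w = c" if "w \<notin> ?L" for w
    using c[of w] that by (simp add: G_def)
  moreover have "- z \<notin> ?L"
  proof
    assume "- z \<in> ?L"
    then have "z \<in> ?L"
      using period_lattice_coords[OF \<tau>, of "-z"] period_lattice_coords[OF \<tau>, of z]
        Ints_minus[of "- Im z / Im \<tau>"] Ints_minus[of "Re (- z) - Im (- z) / Im \<tau> * Re \<tau>"] by simp
    with z show False by simp
  qed
  ultimately have "c = - c" using odd[OF z] z by metis
  then show ?thesis using c[of z] z by (simp add: G_def)
qed

lemma has_field_derivative_exp2pi:
  "(exp2pi has_field_derivative 2 * of_real pi * \<i> * exp2pi z) (at z)"
  unfolding exp2pi_def by (rule derivative_eq_intros refl | simp)+

lemma one_mult_power_Suc_neq_1:
  assumes q: "norm (q :: complex) < 1"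
  shows "1 * q ^ Suc n \<noteq> 1"
proof
  assume "1 * q ^ Suc n = 1"
  then have "norm q ^ Suc n = 1" by (metis mult_1 norm_one norm_power)
  moreover have "norm q ^ Suc n < 1" using q by (subst power_less_one_iff) auto
  ultimately show False by simp
qed

definition E2 :: "complex \<Rightarrow> complex" where
  "E2 \<tau> = 1 - 24 * lambert of_nat (q_pow 1 \<tau>)"

text \<open>The leading Taylor coefficient of \<open>u cot u - 1\<close> at 0 in disguise; it is responsible for the constant
  term of \<open>E2\<close>.\<close>
lemma cot_limit:
  "((\<lambda>u::complex. (u * cos u - sin u) / u ^ 3) \<longlongrightarrow> - 1 / 3) (at 0)"
proof -
  have sc: "sin_coeff 0 = 0" "sin_coeff 1 = 1" "sin_coeff 2 = 0" "sin_coeff 3 = - (1 / 6)"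
    "cos_coeff 0 = 1" "cos_coeff 1 = 0" "cos_coeff 2 = - (1 / 2)"
    by (simp_all add: sin_coeff_def cos_coeff_def fact_numeral)
  note sc = sc sc(2)[unfolded One_nat_def] sc(6)[unfolded One_nat_def]
  have idx: "{..3::nat} = {0, 1, 2, 3}" "{..2::nat} = {0, 1, 2}" by auto
  have b: "norm ((u * cos u - sin u) / u ^ 3 - (- 1 / 3)) \<le> 2 * exp 1 * norm u"
    if u: "norm u < 1" "u \<noteq> 0" for u :: complex
  proof -
    have e: "exp \<bar>Im u\<bar> \<le> exp (1::real)" using u abs_Im_le_cmod[of u] by simp
    have s: "norm (sin u - (u - u ^ 3 / 6)) \<le> exp 1 * norm u ^ 4"
    proof -
      have "norm (sin u - (u - u ^ 3 / 6)) \<le> exp \<bar>Im u\<bar> * norm u ^ 4 / fact 3"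
        using Taylor_sin[of u 3] unfolding idx by (simp add: sc)
      also have "\<dots> \<le> exp \<bar>Im u\<bar> * norm u ^ 4 / 1"
        by (intro divide_left_mono) auto
      also have "\<dots> \<le> exp 1 * norm u ^ 4"
        using mult_mono[OF e order.refl, of "norm u ^ 4"] by simp
      finally show ?thesis .
    qed
    have c: "norm (cos u - (1 - u ^ 2 / 2)) \<le> exp 1 * norm u ^ 3"
    proof -
      have "norm (cos u - (1 - u ^ 2 / 2)) \<le> exp \<bar>Im u\<bar> * norm u ^ 3 / fact 2"
        using Taylor_cos[of u 2] unfolding idx by (simp add: sc)
      also have "\<dots> \<le> exp \<bar>Im u\<bar> * norm u ^ 3 / 1"
        by (intro divide_left_mono) auto
      also have "\<dots> \<le> exp 1 * norm u ^ 3"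
        using mult_mono[OF e order.refl, of "norm u ^ 3"] by simp
      finally show ?thesis .
    qed
    have eq: "(u * cos u - sin u) / u ^ 3 - (- 1 / 3) =
        (u * (cos u - (1 - u ^ 2 / 2)) - (sin u - (u - u ^ 3 / 6))) / u ^ 3"
      using u by (simp add: field_simps power3_eq_cube power2_eq_square)
    have "norm (u * (cos u - (1 - u ^ 2 / 2)) - (sin u - (u - u ^ 3 / 6))) \<le>
        norm u * (exp 1 * norm u ^ 3) + exp 1 * norm u ^ 4"
      using norm_triangle_ineq4[of "u * (cos u - (1 - u ^ 2 / 2))" "sin u - (u - u ^ 3 / 6)"] s
        mult_left_mono[OF c, of "norm u"] by (simp add: norm_mult)
    also have "\<dots> = 2 * exp 1 * norm u * norm u ^ 3"
      by (simp add: eval_nat_numeral)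
    finally show ?thesis
      unfolding eq norm_divide norm_power using u by (simp add: divide_le_eq)
  qed
  have "((\<lambda>u::complex. (u * cos u - sin u) / u ^ 3 - (- 1 / 3)) \<longlongrightarrow> 0) (at 0)"
  proof (rule Lim_null_comparison)
    show "((\<lambda>u::complex. 2 * exp 1 * norm u) \<longlongrightarrow> 0) (at 0)"
      by (rule tendsto_eq_intros refl | simp)+
    show "\<forall>\<^sub>F u::complex in at 0. norm ((u * cos u - sin u) / u ^ 3 - (- 1 / 3)) \<le> 2 * exp 1 * norm u"
      using b by (auto simp: eventually_at dist_norm intro!: exI[of _ 1])
  qed
  then show ?thesis by (rule LIM_zero_cancel)
qed

text \<open>The term for \<open>n = 0\<close> is a cotangent and contributes the constant term of \<open>E2\<close>; the derivative at
  \<open>z = 0\<close> of the rest is the series of \<open>lambert_id_sums_squares\<close>.\<close>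
lemma polar_expansion:
  assumes \<tau>: "\<tau> \<in> uhp"
  shows "((\<lambda>z. (2 * of_real pi * \<i> * polar z \<tau> - 1 / z) / z) \<longlongrightarrow> - (of_real pi ^ 2 / 3) * E2 \<tau>) (at 0)"
proof -
  define q where "q = q_pow 1 \<tau>"
  have q: "norm q < 1" using norm_q_pow_less_1[OF _ \<tau>, of 1] by (simp add: q_def)
  let ?p = "of_real pi :: complex"
  define F where "F = (\<lambda>z. polar_sum q (exp2pi z) - polar_sum q (exp2pi (- z)))"
  define S where "S = lambert of_nat q"
  have S: "S = (\<Sum>n. q ^ Suc n / (1 - 1 * q ^ Suc n) ^ 2)"
    using lambert_id_sums_squares[OF q] by (simp add: S_def sums_iff)
  have e0: "exp2pi 0 = 1" by (simp add: exp2pi_def)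
  have d1: "(polar_sum q has_field_derivative S) (at (exp2pi 0))"
    unfolding S e0 by (rule has_field_derivative_polar_sum[OF q one_mult_power_Suc_neq_1[OF q]])
  have d2: "((\<lambda>z. polar_sum q (exp2pi z)) has_field_derivative S * (2 * ?p * \<i> * exp2pi 0)) (at 0)"
    by (rule DERIV_chain2[OF d1 has_field_derivative_exp2pi])
  have "((\<lambda>z. exp2pi (- z)) has_field_derivative (2 * ?p * \<i> * exp2pi (- 0)) * (- 1)) (at 0)"
    by (rule DERIV_chain2[OF has_field_derivative_exp2pi]) (auto intro!: derivative_eq_intros)
  then have d3: "((\<lambda>z. polar_sum q (exp2pi (- z))) has_field_derivative S * ((2 * ?p * \<i> * exp2pi (- 0)) * (- 1))) (at 0)"
    by (intro DERIV_chain2[where f = "polar_sum q"]) (use d1 in auto)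
  have "(F has_field_derivative S * (2 * ?p * \<i> * exp2pi 0) - S * ((2 * ?p * \<i> * exp2pi (- 0)) * (- 1))) (at 0)"
    unfolding F_def by (rule DERIV_diff[OF d2 d3])
  then have "(F has_field_derivative 4 * ?p * \<i> * S) (at 0)"
    by (simp add: e0 algebra_simps)
  moreover have "F 0 = 0" by (simp add: F_def)
  ultimately have F: "((\<lambda>z. F z / z) \<longlongrightarrow> 4 * ?p * \<i> * S) (at 0)"
    by (simp add: has_field_derivative_iff)
  have "filterlim (\<lambda>z::complex. ?p * z) (at 0) (at 0)"
    by (rule filterlim_atI) (auto simp: eventually_at intro!: exI[of _ 1] tendsto_eq_intros)
  from filterlim_compose[OF cot_limit this]
  have c: "((\<lambda>z. ((?p * z) * cos (?p * z) - sin (?p * z)) / (?p * z) ^ 3) \<longlongrightarrow> - 1 / 3) (at 0)" .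
  have s: "((\<lambda>z. sin (?p * z) / z) \<longlongrightarrow> ?p) (at 0)"
  proof -
    have "((\<lambda>z. sin (?p * z)) has_field_derivative ?p) (at 0)"
      by (auto intro!: derivative_eq_intros)
    then show ?thesis by (simp add: has_field_derivative_iff)
  qed
  have "((\<lambda>z. ?p ^ 3 * (((?p * z) * cos (?p * z) - sin (?p * z)) / (?p * z) ^ 3) / (sin (?p * z) / z)) \<longlongrightarrow> ?p ^ 3 * (- 1 / 3) / ?p) (at 0)"
    by (intro tendsto_intros c s) auto
  then have C: "((\<lambda>z. ?p ^ 3 * (((?p * z) * cos (?p * z) - sin (?p * z)) / (?p * z) ^ 3) / (sin (?p * z) / z)) \<longlongrightarrow> - (?p ^ 2 / 3)) (at 0)"
    by (simp add: power3_eq_cube power2_eq_square)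
  have "((\<lambda>z. ?p ^ 3 * (((?p * z) * cos (?p * z) - sin (?p * z)) / (?p * z) ^ 3) / (sin (?p * z) / z) - 2 * ?p * \<i> * (F z / z)) \<longlongrightarrow> - (?p ^ 2 / 3) - 2 * ?p * \<i> * (4 * ?p * \<i> * S)) (at 0)"
    by (intro tendsto_intros C F)
  also have "- (?p ^ 2 / 3) - 2 * ?p * \<i> * (4 * ?p * \<i> * S) = - (?p ^ 2 / 3) * E2 \<tau>"
    by (simp add: E2_def S_def q_def algebra_simps power2_eq_square)
  finally show ?thesis
  proof (rule Lim_transform_eventually)
    have "eventually (\<lambda>z::complex. z \<in> ball 0 1 - {0}) (at 0)"
      by (auto simp: eventually_at dist_norm intro!: exI[of _ 1])
    then show "\<forall>\<^sub>F z in at 0. ?p ^ 3 * (((?p * z) * cos (?p * z) - sin (?p * z)) / (?p * z) ^ 3) / (sin (?p * z) / z) - 2 * ?p * \<i> * (F z / z) =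
        (2 * ?p * \<i> * polar z \<tau> - 1 / z) / z"
    proof eventually_elim
      case (elim z)
      then have z: "z \<noteq> 0" "norm z < 1" by auto
      have "z \<notin> \<int>"
      proof
        assume "z \<in> \<int>"
        then obtain n where "z = of_int n" by (auto elim: Ints_cases)
        with z show False by (simp add: norm_of_int)
      qed
      then have w1: "exp2pi z \<noteq> 1" by (simp add: exp2pi_eq_1_iff)
      define a where "a = exp (\<i> * (?p * z))"
      have a: "a \<noteq> 0" "exp2pi z = a ^ 2" "exp (- (\<i> * (?p * z))) = 1 / a"
        by (simp_all add: a_def exp2pi_def exp_minus divide_simps exp_double[symmetric] mult_ac)
      have cs: "cos (?p * z) = (a + 1 / a) / 2" "sin (?p * z) = (a - 1 / a) / (2 * \<i>)"
        unfolding cos_exp_eq sin_exp_eq a(3) a_def[symmetric] by simp_all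
      have sn: "sin (?p * z) \<noteq> 0"
      proof
        assume "sin (?p * z) = 0"
        then have "a = 1 / a" by (simp add: cs(2))
        then have "a ^ 2 = 1" using a(1) by (simp add: field_simps power2_eq_square)
        with w1 a(2) show False by simp
      qed
      have "?p * \<i> * ((exp2pi z + 1) / (exp2pi z - 1)) = ?p * (cos (?p * z) / sin (?p * z))"
        using w1 a(1) unfolding cs a(2) by (simp add: divide_simps power2_eq_square) (simp add: algebra_simps)
      moreover have "?p ^ 3 * (((?p * z) * cos (?p * z) - sin (?p * z)) / (?p * z) ^ 3) / (sin (?p * z) / z) =
         (?p * (cos (?p * z) / sin (?p * z)) - 1 / z) / z"
        using z sn by (simp add: divide_simps power3_eq_cube)
      moreover have "2 * ?p * \<i> * polar z \<tau> = ?p * \<i> * ((exp2pi z + 1) / (exp2pi z - 1)) - 2 * ?p * \<i> * F z"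
      proof -
        have "2 * ?p * \<i> * (c / 2 - f) = ?p * \<i> * c - 2 * ?p * \<i> * f" for c f
          by (simp add: algebra_simps)
        then show ?thesis unfolding polar_def F_def q_def .
      qed
      ultimately show ?case by (simp add: diff_divide_distrib)
    qed
  qed
qed

lemma polar_residue:
  assumes \<tau>: "\<tau> \<in> uhp"
  shows "((\<lambda>z. z * (2 * of_real pi * \<i> * polar z \<tau>)) \<longlongrightarrow> 1) (at 0)"
proof -
  let ?f = "\<lambda>z. (2 * of_real pi * \<i> * polar z \<tau> - 1 / z) / z"
  have "((\<lambda>z. z ^ 2 * ?f z + 1) \<longlongrightarrow> 0 ^ 2 * (- (of_real pi ^ 2 / 3) * E2 \<tau>) + 1) (at 0)"
    by (intro tendsto_intros polar_expansion[OF \<tau>])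
  then have "((\<lambda>z. z ^ 2 * ?f z + 1) \<longlongrightarrow> 1) (at 0)" by simp
  then show ?thesis
  proof (rule Lim_transform_eventually)
    have "eventually (\<lambda>z::complex. z \<in> ball 0 1 - {0}) (at 0)"
      by (auto simp: eventually_at dist_norm intro!: exI[of _ 1])
    then show "\<forall>\<^sub>F z in at 0. z ^ 2 * ?f z + 1 = z * (2 * of_real pi * \<i> * polar z \<tau>)"
      by eventually_elim (simp add: field_simps power2_eq_square)
  qed
qed

section \<open>Modular transformation of the quasi-elliptic function and of \<open>E2\<close>\<close>

lemma det_SL2Z: "A \<in> SL2Z \<longleftrightarrow> A$1$1 * A$2$2 - A$1$2 * A$2$1 = 1"
  by (simp add: SL2Z_def det_2)

lemma autom_factor_nonzero:
  assumes A: "A \<in> SL2Z" and \<tau>: "\<tau> \<in> uhp"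
  shows "autom_factor A \<tau> \<noteq> 0"
proof
  assume 0: "autom_factor A \<tau> = 0"
  then have "Im (autom_factor A \<tau>) = 0" by simp
  then have c: "A$2$1 = 0" using \<tau> by (simp add: autom_factor_def uhp_def)
  with 0 have "A$2$2 = 0" by (simp add: autom_factor_def)
  with c A show False by (simp add: det_SL2Z)
qed

lemma Im_moebius_act:
  assumes A: "A \<in> SL2Z"
  shows "Im (moebius_act A \<tau>) = Im \<tau> / norm (autom_factor A \<tau>) ^ 2"
proof -
  let ?a = "A$1$1" and ?b = "A$1$2" and ?c = "A$2$1" and ?d = "A$2$2"
  have "real_of_int ?a * real_of_int ?d - real_of_int ?b * real_of_int ?c = real_of_int (?a * ?d - ?b * ?c)"
    by simp
  also have "\<dots> = 1" using A unfolding det_SL2Z by simp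
  finally have det: "real_of_int ?a * real_of_int ?d = 1 + real_of_int ?b * real_of_int ?c" by simp
  have "real_of_int ?a * Im \<tau> * (real_of_int ?c * Re \<tau> + real_of_int ?d) -
      (real_of_int ?a * Re \<tau> + real_of_int ?b) * (real_of_int ?c * Im \<tau>) =
     Im \<tau> * (real_of_int ?a * real_of_int ?d - real_of_int ?b * real_of_int ?c)"
    by (simp add: algebra_simps)
  also have "\<dots> = Im \<tau>" by (simp add: det)
  finally show ?thesis
    unfolding moebius_act_def Im_divide cmod_power2 by (simp add: autom_factor_def)
qed

lemma moebius_act_uhp:
  assumes A: "A \<in> SL2Z" and \<tau>: "\<tau> \<in> uhp"
  shows "moebius_act A \<tau> \<in> uhp"
  using Im_moebius_act[OF A, of \<tau>] autom_factor_nonzero[OF A \<tau>] \<tau> by (simp add: uhp_def)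

lemma lattice_moebius:
  assumes A: "A \<in> SL2Z" and \<tau>: "\<tau> \<in> uhp"
  shows "1 / autom_factor A \<tau> = of_int (A$1$1) + of_int (- A$2$1) * moebius_act A \<tau>"
    "\<tau> / autom_factor A \<tau> = of_int (- A$1$2) + of_int (A$2$2) * moebius_act A \<tau>"
proof -
  note nz = autom_factor_nonzero[OF A \<tau>]
  let ?a = "of_int (A$1$1) :: complex" and ?b = "of_int (A$1$2) :: complex"
  let ?c = "of_int (A$2$1) :: complex" and ?d = "of_int (A$2$2) :: complex"
  have "of_int (A$1$1 * A$2$2 - A$1$2 * A$2$1) = (1 :: complex)"
    using A unfolding det_SL2Z by simp
  then have det: "?a * ?d - ?b * ?c = 1" by simp
  have "?a * autom_factor A \<tau> - ?c * (?a * \<tau> + ?b) = ?a * ?d - ?b * ?c"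
    by (simp add: autom_factor_def algebra_simps)
  then have *: "?a * autom_factor A \<tau> - ?c * (?a * \<tau> + ?b) = 1" by (simp only: det)
  show "1 / autom_factor A \<tau> = of_int (A$1$1) + of_int (- A$2$1) * moebius_act A \<tau>"
    unfolding moebius_act_def *[symmetric] using nz by (simp add: field_simps)
  have "- ?b * autom_factor A \<tau> + ?d * (?a * \<tau> + ?b) = (?a * ?d - ?b * ?c) * \<tau>"
    by (simp add: autom_factor_def algebra_simps)
  then have *: "- ?b * autom_factor A \<tau> + ?d * (?a * \<tau> + ?b) = \<tau>" by (simp only: det mult_1_left)
  have "\<tau> / autom_factor A \<tau> = (- ?b * autom_factor A \<tau> + ?d * (?a * \<tau> + ?b)) / autom_factor A \<tau>"
    by (simp only: *)
  also have "\<dots> = of_int (- A$1$2) + of_int (A$2$2) * moebius_act A \<tau>"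
    using nz by (simp add: moebius_act_def field_simps)
  finally show "\<tau> / autom_factor A \<tau> = of_int (- A$1$2) + of_int (A$2$2) * moebius_act A \<tau>" .
qed

text \<open>Division by the automorphy factor maps the lattice \<open>\<int> + \<int>\<tau>\<close> onto the lattice of \<open>moebius_act A \<tau>\<close>.\<close>
lemma period_lattice_moebius:
  assumes A: "A \<in> SL2Z" and \<tau>: "\<tau> \<in> uhp" and z: "z \<notin> period_lattice \<tau>"
  shows "z / autom_factor A \<tau> \<notin> period_lattice (moebius_act A \<tau>)"
proof
  note nz = autom_factor_nonzero[OF A \<tau>]
  assume "z / autom_factor A \<tau> \<in> period_lattice (moebius_act A \<tau>)"
  then obtain m n where "z / autom_factor A \<tau> = of_int m + of_int n * moebius_act A \<tau>"
    by (auto simp: period_lattice_def)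
  then have "z = of_int m * autom_factor A \<tau> + of_int n * (of_int (A$1$1) * \<tau> + of_int (A$1$2))"
    using nz by (simp add: moebius_act_def field_simps)
  then have "z = of_int (m * A$2$2 + n * A$1$2) + of_int (m * A$2$1 + n * A$1$1) * \<tau>"
    by (simp add: autom_factor_def algebra_simps)
  with z show False unfolding period_lattice_def by blast
qed

text \<open>After division by \<open>autom_factor A \<tau>\<close> both sides have the same lattice of simple poles with the same
  residues, and the linear term makes the quasi-periods equal. Their difference satisfies the
  hypotheses of \<open>odd_elliptic_zero\<close>.\<close>
theorem polar_modular:
  assumes A: "A \<in> SL2Z" and \<tau>: "\<tau> \<in> uhp" and z: "z \<notin> period_lattice \<tau>"
  shows "polar (z / autom_factor A \<tau>) (moebius_act A \<tau>) =
    autom_factor A \<tau> * polar z \<tau> + of_int (A$2$1) * z"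
proof -
  define j where "j = autom_factor A \<tau>"
  define c where "c = (of_int (A$2$1) :: complex)"
  define \<tau>' where "\<tau>' = moebius_act A \<tau>"
  have j: "j \<noteq> 0" unfolding j_def by (rule autom_factor_nonzero[OF A \<tau>])
  have \<tau>': "\<tau>' \<in> uhp" unfolding \<tau>'_def by (rule moebius_act_uhp[OF A \<tau>])
  have lat: "y / j \<notin> period_lattice \<tau>'" if "y \<notin> period_lattice \<tau>" for y
    unfolding j_def \<tau>'_def by (rule period_lattice_moebius[OF A \<tau> that])
  define D where "D = (\<lambda>y. polar (y / j) \<tau>' / j - polar y \<tau> - c * y / j)"
  have "D z = 0"
  proof (rule odd_elliptic_zero[OF \<tau> _ _ _ _ z])
    have "(\<lambda>y. polar (y / j) \<tau>') holomorphic_on - period_lattice \<tau>"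
      using holomorphic_on_compose_gen[of "\<lambda>y. y / j" "- period_lattice \<tau>", OF _ holomorphic_polar[OF \<tau>']] lat j
      by (fastforce simp: o_def intro!: holomorphic_intros)
    then show "D holomorphic_on - period_lattice \<tau>"
      unfolding D_def using j by (intro holomorphic_intros holomorphic_polar[OF \<tau>])
  next
    fix y m n assume y: "y \<notin> period_lattice \<tau>"
    define a b d where "a = A$1$1" and "b = A$1$2" and "d = A$2$2"
    have l: "1 / j = of_int a + of_int (- A$2$1) * \<tau>'" "\<tau> / j = of_int (- b) + of_int d * \<tau>'"
      using lattice_moebius[OF A \<tau>] by (simp_all add: j_def \<tau>'_def a_def b_def d_def)
    have "(y + of_int m + of_int n * \<tau>) / j = y / j + of_int m * (1 / j) + of_int n * (\<tau> / j)"
      by (simp add: add_divide_distrib)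
    also have "\<dots> = y / j + of_int (m * a - n * b) + of_int (n * d - m * A$2$1) * \<tau>'"
      unfolding l by (simp add: algebra_simps)
    finally have e: "polar ((y + of_int m + of_int n * \<tau>) / j) \<tau>' = polar (y / j) \<tau>' - of_int (n * d - m * A$2$1)"
      by (simp only: polar_quasiperiodic[OF \<tau>' lat[OF y]])
    have jd: "j = c * \<tau> + of_int d" by (simp add: j_def autom_factor_def c_def d_def)
    have "D (y + of_int m + of_int n * \<tau>) =
      D y - (of_int (n * d - m * A$2$1) - of_int n * j + c * (of_int m + of_int n * \<tau>)) / j"
      unfolding D_def e polar_quasiperiodic[OF \<tau> y] using j by (simp add: field_simps)
    also have "of_int (n * d - m * A$2$1) - of_int n * j + c * (of_int m + of_int n * \<tau>) = 0"
      by (simp add: jd c_def algebra_simps)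
    finally show "D (y + of_int m + of_int n * \<tau>) = D y" by simp
  next
    fix y show "D (- y) = - D y"
      by (simp add: D_def polar_minus)
  next
    have "filterlim (\<lambda>y. y / j) (at 0) (at 0)"
      by (rule filterlim_atI) (use j in \<open>auto simp: eventually_at intro!: exI[of _ 1] tendsto_eq_intros\<close>)
    from filterlim_compose[OF polar_residue[OF \<tau>'] this]
    have 1: "((\<lambda>y. y / j * (2 * of_real pi * \<i> * polar (y / j) \<tau>')) \<longlongrightarrow> 1) (at 0)" .
    have "((\<lambda>y. (y / j * (2 * of_real pi * \<i> * polar (y / j) \<tau>') - y * (2 * of_real pi * \<i> * polar y \<tau>)) /
        (2 * of_real pi * \<i>) - y * (c * y / j)) \<longlongrightarrow> (1 - 1) / (2 * of_real pi * \<i>) - 0 * (c * 0 / j)) (at 0)"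
      by (intro tendsto_intros 1 polar_residue[OF \<tau>]) (use j in auto)
    then show "((\<lambda>y. y * D y) \<longlongrightarrow> 0) (at 0)"
      by (simp add: D_def diff_divide_distrib algebra_simps)
  qed
  then have "polar (z / j) \<tau>' = j * polar z \<tau> + c * z"
  proof -
    assume "D z = 0"
    then have "polar (z / j) \<tau>' / j = polar z \<tau> + c * z / j"
      unfolding D_def by (metis diff_diff_eq eq_iff_diff_eq_0)
    then have "j * (polar (z / j) \<tau>' / j) = j * (polar z \<tau> + c * z / j)" by simp
    then show ?thesis using j by (simp add: distrib_left)
  qed
  then show ?thesis by (simp add: j_def c_def \<tau>'_def)
qed

text \<open>Comparison of the linear Taylor coefficients at \<open>z = 0\<close> in \<open>polar_modular\<close>.\<close>
theorem E2_modular: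
  assumes A: "A \<in> SL2Z" and \<tau>: "\<tau> \<in> uhp"
  shows "E2 (moebius_act A \<tau>) = autom_factor A \<tau> ^ 2 * E2 \<tau> +
    6 / (of_real pi * \<i>) * of_int (A$2$1) * autom_factor A \<tau>"
proof -
  define j where "j = autom_factor A \<tau>"
  define c where "c = (of_int (A$2$1) :: complex)"
  define \<tau>' where "\<tau>' = moebius_act A \<tau>"
  let ?p = "of_real pi :: complex"
  have j: "j \<noteq> 0" unfolding j_def by (rule autom_factor_nonzero[OF A \<tau>])
  have \<tau>': "\<tau>' \<in> uhp" unfolding \<tau>'_def by (rule moebius_act_uhp[OF A \<tau>])
  have "filterlim (\<lambda>y. y / j) (at 0) (at 0)"
    by (rule filterlim_atI) (use j in \<open>auto simp: eventually_at intro!: exI[of _ 1] tendsto_eq_intros\<close>)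
  from filterlim_compose[OF polar_expansion[OF \<tau>'] this]
  have 1: "((\<lambda>y. (2 * ?p * \<i> * polar (y / j) \<tau>' - 1 / (y / j)) / (y / j)) \<longlongrightarrow> - (?p ^ 2 / 3) * E2 \<tau>') (at 0)" .
  have "((\<lambda>y. j ^ 2 * ((2 * ?p * \<i> * polar y \<tau> - 1 / y) / y) + 2 * ?p * \<i> * c * j) \<longlongrightarrow>
      j ^ 2 * (- (?p ^ 2 / 3) * E2 \<tau>) + 2 * ?p * \<i> * c * j) (at 0)"
    by (intro tendsto_intros polar_expansion[OF \<tau>])
  then have 2: "((\<lambda>y. (2 * ?p * \<i> * polar (y / j) \<tau>' - 1 / (y / j)) / (y / j)) \<longlongrightarrow>
      j ^ 2 * (- (?p ^ 2 / 3) * E2 \<tau>) + 2 * ?p * \<i> * c * j) (at 0)"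
  proof (rule Lim_transform_eventually)
    have "open (- (period_lattice \<tau> - {0}))" "0 \<in> - (period_lattice \<tau> - {0})"
      using open_lattice_complement[OF \<tau>] by auto
    then have "eventually (\<lambda>y. y \<in> - (period_lattice \<tau> - {0}) - {0}) (at 0)"
      by (rule eventually_at_in_open)
    then show "\<forall>\<^sub>F y in at 0. j ^ 2 * ((2 * ?p * \<i> * polar y \<tau> - 1 / y) / y) + 2 * ?p * \<i> * c * j =
        (2 * ?p * \<i> * polar (y / j) \<tau>' - 1 / (y / j)) / (y / j)"
    proof eventually_elim
      case (elim y)
      then have y: "y \<noteq> 0" "y \<notin> period_lattice \<tau>" by auto
      have "polar (y / j) \<tau>' = j * polar y \<tau> + c * y"
        using polar_modular[OF A \<tau> y(2)] by (simp add: j_def c_def \<tau>'_def)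
      then show ?case using j y(1) by (simp add: field_simps power2_eq_square)
    qed
  qed
  have "- (?p ^ 2 / 3) * E2 \<tau>' = j ^ 2 * (- (?p ^ 2 / 3) * E2 \<tau>) + 2 * ?p * \<i> * c * j"
    by (rule tendsto_unique[OF _ 1 2]) simp
  then have "E2 \<tau>' = j ^ 2 * E2 \<tau> + 6 / (?p * \<i>) * c * j"
  proof -
    assume e: "- (?p ^ 2 / 3) * E2 \<tau>' = j ^ 2 * (- (?p ^ 2 / 3) * E2 \<tau>) + 2 * ?p * \<i> * c * j"
    have "E2 \<tau>' = (- (?p ^ 2 / 3) * E2 \<tau>') / (- (?p ^ 2 / 3))" by simp
    also have "\<dots> = j ^ 2 * E2 \<tau> - 6 * \<i> / ?p * c * j"
      unfolding e by (simp add: field_simps power2_eq_square)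
    also have "6 * \<i> / ?p = - (6 / (?p * \<i>))"
      by (simp add: divide_simps)
    finally show ?thesis by simp
  qed
  then show ?thesis by (simp add: j_def c_def \<tau>'_def)
qed

section \<open>The Dedekind eta function\<close>

definition euler_phi :: "complex \<Rightarrow> complex" where
  "euler_phi x = (\<Prod>n. 1 - x ^ Suc n)"

lemma summable_norm_power_Suc: "norm (x::complex) < 1 \<Longrightarrow> summable (\<lambda>n. norm (x ^ Suc n))"
  using summable_mult[OF summable_geometric[of "norm x"], of "norm x"] by (simp add: norm_mult norm_power)

lemma power_Suc_neq_1: "norm (x::complex) < 1 \<Longrightarrow> x ^ Suc n \<noteq> 1"
  using one_mult_power_Suc_neq_1[of x n] by simp

lemma convergent_prod_euler_phi:
  assumes "norm (x::complex) < 1"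
  shows "convergent_prod (\<lambda>n. 1 - x ^ Suc n)"
proof -
  have "convergent_prod (\<lambda>n. 1 + (- (x ^ Suc n)))"
    using summable_norm_power_Suc[OF assms] power_Suc_neq_1[OF assms]
    by (intro summable_imp_convergent_prod_complex) auto
  then show ?thesis by simp
qed

lemma euler_phi_nonzero: "norm x < 1 \<Longrightarrow> euler_phi x \<noteq> 0"
  unfolding euler_phi_def
  by (rule prodinf_nonzero[OF convergent_prod_euler_phi]) (use power_Suc_neq_1[of x] in auto)

lemma euler_phi_0 [simp]: "euler_phi 0 = 1"
  by (simp add: euler_phi_def)

lemma uniform_limit_euler_phi:
  assumes "0 \<le> r" "r < 1"
  shows "uniform_limit (cball 0 r) (\<lambda>N x. \<Prod>n<N. 1 - x ^ Suc n) euler_phi sequentially"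
proof -
  have "uniformly_convergent_on (cball 0 r) (\<lambda>N x. \<Prod>n<N. 1 + (- (x ^ Suc n)) :: complex)"
  proof (rule uniformly_convergent_on_prod)
    show "uniformly_convergent_on (cball 0 r) (\<lambda>N x. \<Sum>n<N. norm (- ((x::complex) ^ Suc n)))"
    proof (rule Weierstrass_m_test'[of _ _ "\<lambda>n. r ^ Suc n"])
      fix n and x :: complex assume "x \<in> cball 0 r"
      then have "norm x ^ Suc n \<le> r ^ Suc n" by (intro power_mono) auto
      then show "norm (norm (- (x ^ Suc n))) \<le> r ^ Suc n"
        by (simp add: norm_mult norm_power)
    next
      show "summable (\<lambda>n. r ^ Suc n)"
        using assms summable_mult[OF summable_geometric[of r], of r] by simp
    qed
  qed (auto intro!: continuous_intros)
  then obtain g where g: "uniform_limit (cball 0 r) (\<lambda>N x. \<Prod>n<N. 1 - x ^ Suc n :: complex) g sequentially"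
    by (auto simp: uniformly_convergent_on_def)
  have "g x = euler_phi x" if x: "x \<in> cball 0 r" for x
  proof -
    have "(\<lambda>N. \<Prod>n<N. 1 - x ^ Suc n) \<longlonglongrightarrow> g x"
      by (rule tendsto_uniform_limitI[OF g x])
    moreover have "(\<lambda>N. \<Prod>n<N. 1 - x ^ Suc n) \<longlonglongrightarrow> euler_phi x"
      unfolding euler_phi_def
      by (subst LIMSEQ_lessThan_iff_atMost, rule convergent_prod_LIMSEQ[OF convergent_prod_euler_phi])
         (use x assms in auto)
    ultimately show ?thesis by (rule LIMSEQ_unique)
  qed
  then show ?thesis
    using uniform_limit_cong'[of "cball 0 r" _ _ g euler_phi sequentially] g by auto
qed

lemma holomorphic_euler_phi: "euler_phi holomorphic_on ball 0 1"
proof (rule holomorphic_uniform_sequence[where f = "\<lambda>N x. \<Prod>n<N. 1 - x ^ Suc n"])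
  fix x :: complex assume x: "x \<in> ball 0 1"
  define d where "d = (1 - norm x) / 2"
  have d: "d > 0" using x by (simp add: d_def)
  have "cball x d \<subseteq> cball 0 (norm x + d)"
    by (auto simp: dist_norm) (metis add.commute norm_minus_commute norm_triangle_le_diff norm_triangle_sub add_left_mono order_trans)
  moreover have "norm x + d < 1" using x by (simp add: d_def field_simps)
  moreover from this have "cball 0 (norm x + d) \<subseteq> ball (0::complex) 1" by (auto simp: subset_iff)
  moreover have "uniform_limit (cball 0 (norm x + d)) (\<lambda>N x. \<Prod>n<N. 1 - x ^ Suc n) euler_phi sequentially"
    using d \<open>norm x + d < 1\<close> by (intro uniform_limit_euler_phi) auto
  ultimately show "\<exists>d>0. cball x d \<subseteq> ball 0 1 \<and>
      uniform_limit (cball x d) (\<lambda>N x. \<Prod>n<N. 1 - x ^ Suc n) euler_phi sequentially"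
    using d by (blast intro: uniform_limit_on_subset)
qed (auto intro!: holomorphic_intros)

text \<open>The logarithmic derivative may be taken factor by factor.\<close>
lemma logderiv_euler_phi:
  assumes x: "norm x < 1"
  shows "x * deriv euler_phi x = - lambert of_nat x * euler_phi x"
proof -
  define r where "r = (1 + norm x) / 2"
  have r: "norm x < r" "r < 1" "0 \<le> r" using x by (auto simp: r_def)
  have "(\<lambda>k. deriv (\<lambda>y. 1 - y ^ Suc k) x / (1 - x ^ Suc k)) sums (deriv euler_phi x / euler_phi x)"
    by (rule logderiv_prodinf_complex_uniform_limit[OF uniform_limit_on_subset[OF uniform_limit_euler_phi[OF r(3,2)] ball_subset_cball]])
       (use euler_phi_nonzero[OF x] r in \<open>auto intro!: holomorphic_intros\<close>)
  moreover have "deriv (\<lambda>y. 1 - y ^ Suc k) x = - of_nat (Suc k) * x ^ k" for k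
    by (rule DERIV_imp_deriv, (rule derivative_eq_intros refl)+) (simp del: power_Suc of_nat_Suc)
  ultimately have "(\<lambda>k. - of_nat (Suc k) * x ^ k / (1 - x ^ Suc k)) sums (deriv euler_phi x / euler_phi x)"
    by (simp del: power_Suc of_nat_Suc)
  moreover have "- x * (- of_nat (Suc k) * x ^ k / (1 - x ^ Suc k)) = of_nat (Suc k) * (x ^ Suc k / (1 - x ^ Suc k))" for k
    by (simp del: of_nat_Suc)
  ultimately have "(\<lambda>k. of_nat (Suc k) * (x ^ Suc k / (1 - x ^ Suc k))) sums (- x * (deriv euler_phi x / euler_phi x))"
    using sums_mult[of "\<lambda>k. - of_nat (Suc k) * x ^ k / (1 - x ^ Suc k)" _ "- x"] by (simp only:)
  moreover have "(\<lambda>k. of_nat (Suc k) * (x ^ Suc k / (1 - x ^ Suc k))) sums lambert of_nat x"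
    by (rule lambert_sums[OF _ x]) simp
  ultimately have "- x * (deriv euler_phi x / euler_phi x) = lambert of_nat x"
    by (rule sums_unique2)
  moreover have "x * deriv euler_phi x = - (- x * (deriv euler_phi x / euler_phi x)) * euler_phi x"
    using euler_phi_nonzero[OF x] by simp
  ultimately show ?thesis by (simp only:)
qed

lemma eta_conv_euler_phi: "eta \<tau> = q_pow (1 / 24) \<tau> * euler_phi (q_pow 1 \<tau>)"
  by (simp only: eta_def euler_phi_def q_pow_Suc)

lemma eta_nonzero: "\<tau> \<in> uhp \<Longrightarrow> eta \<tau> \<noteq> 0"
  unfolding eta_conv_euler_phi using euler_phi_nonzero norm_q_pow_less_1[of 1 \<tau>] by simp

lemma has_field_derivative_q_pow:
  "(q_pow r has_field_derivative 2 * of_real pi * \<i> * of_real r * q_pow r \<tau>) (at \<tau>)"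
  unfolding q_pow_def by (rule derivative_eq_intros refl | simp)+

lemma has_field_derivative_eta:
  assumes \<tau>: "\<tau> \<in> uhp"
  shows "(eta has_field_derivative (of_real pi * \<i> / 12 * E2 \<tau> * eta \<tau>)) (at \<tau>)"
proof -
  define q where "q = q_pow 1 \<tau>"
  have q: "norm q < 1" using norm_q_pow_less_1[OF _ \<tau>, of 1] by (simp add: q_def)
  have "(euler_phi has_field_derivative deriv euler_phi q) (at q)"
    using holomorphic_derivI[OF holomorphic_euler_phi, of q] q by simp
  from DERIV_chain2[OF this[unfolded q_def] has_field_derivative_q_pow]
  have "((\<lambda>x. euler_phi (q_pow 1 x)) has_field_derivative (deriv euler_phi q * (2 * of_real pi * \<i> * q))) (at \<tau>)"
    by (simp add: q_def)
  also have "deriv euler_phi q * (2 * of_real pi * \<i> * q) = 2 * of_real pi * \<i> * (- lambert of_nat q * euler_phi q)"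
  proof -
    have "deriv euler_phi q * (2 * of_real pi * \<i> * q) = 2 * of_real pi * \<i> * (q * deriv euler_phi q)"
      by (simp only: mult_ac)
    then show ?thesis by (simp only: logderiv_euler_phi[OF q])
  qed
  finally have "((\<lambda>x. q_pow (1/24) x * euler_phi (q_pow 1 x)) has_field_derivative
     (2 * of_real pi * \<i> * of_real (1/24) * q_pow (1/24) \<tau>) * euler_phi q +
     (2 * of_real pi * \<i> * (- lambert of_nat q * euler_phi q)) * q_pow (1/24) \<tau>) (at \<tau>)"
    unfolding q_def by (rule DERIV_mult[OF has_field_derivative_q_pow])
  also have "(2 * of_real pi * \<i> * of_real (1/24) * q_pow (1/24) \<tau>) * euler_phi q +
     (2 * of_real pi * \<i> * (- lambert of_nat q * euler_phi q)) * q_pow (1/24) \<tau> =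
     of_real pi * \<i> / 12 * E2 \<tau> * eta \<tau>"
    by (simp add: E2_def eta_conv_euler_phi q_def[symmetric]) (simp add: field_simps)
  finally show ?thesis by (simp add: eta_conv_euler_phi[abs_def])
qed

definition S_mat :: "int ^ 2 ^ 2" where "S_mat = vector [vector [0, -1], vector [1, 0]]"

lemma S_mat_entries: "S_mat$1$1 = 0" "S_mat$1$2 = -1" "S_mat$2$1 = 1" "S_mat$2$2 = 0"
  by (simp_all add: S_mat_def)

lemma S_mat_SL2Z: "S_mat \<in> SL2Z"
  by (simp add: det_SL2Z S_mat_entries)

lemma act_S_mat: "moebius_act S_mat \<tau> = - 1 / \<tau>" "autom_factor S_mat \<tau> = \<tau>"
  by (simp_all add: moebius_act_def autom_factor_def S_mat_entries)

lemma uhp_nonzero: "\<tau> \<in> uhp \<Longrightarrow> \<tau> \<noteq> 0"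
  by (auto simp: uhp_def)

lemma minus_inverse_uhp: "\<tau> \<in> uhp \<Longrightarrow> - 1 / \<tau> \<in> uhp"
  using moebius_act_uhp[OF S_mat_SL2Z] by (simp add: act_S_mat)

text \<open>By the transformation law of \<open>E2\<close> the function \<open>eta (-1/\<tau>)^2 / (\<tau> eta(\<tau>)^2)\<close> has derivative 0. Its constant
  value is found at the fixed point \<open>\<i>\<close> of the inversion. Only the modulus is kept, because this is
  all the maximum principle asks for; it avoids the multiplier system of \<open>eta\<close>.\<close>
lemma eta_inversion:
  assumes \<tau>: "\<tau> \<in> uhp"
  shows "norm (eta (- 1 / \<tau>)) ^ 2 = norm \<tau> * norm (eta \<tau>) ^ 2"
proof -
  define R where "R = (\<lambda>\<tau>. eta (- 1 / \<tau>) ^ 2 / (\<tau> * eta \<tau> ^ 2))"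
  have "(R has_field_derivative 0) (at \<tau>)" if \<tau>: "\<tau> \<in> uhp" for \<tau>
  proof -
    note nz = uhp_nonzero[OF \<tau>] eta_nonzero[OF \<tau>]
    have E: "E2 (- 1 / \<tau>) = \<tau> ^ 2 * E2 \<tau> + 6 / (of_real pi * \<i>) * \<tau>"
      using E2_modular[OF S_mat_SL2Z \<tau>] by (simp add: act_S_mat S_mat_entries)
    have i: "((\<lambda>x. - 1 / x) has_field_derivative 1 / \<tau> ^ 2) (at \<tau>)"
      using nz by (auto intro!: derivative_eq_intros simp: power2_eq_square)
    define e where "e = eta (- 1 / \<tau>)"
    have e': "eta (- (1 / \<tau>)) = e" by (simp add: e_def)
    have d: "((\<lambda>x. eta (- 1 / x)) has_field_derivative (of_real pi * \<i> / 12 * E2 (- 1 / \<tau>) * e) * (1 / \<tau> ^ 2)) (at \<tau>)"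
      unfolding e_def by (rule DERIV_chain2[OF has_field_derivative_eta[OF minus_inverse_uhp[OF \<tau>]] i])
    have E': "(of_real pi * \<i> / 12 * E2 (- 1 / \<tau>) * e) * (1 / \<tau> ^ 2) =
         (of_real pi * \<i> / 12 * E2 \<tau> + 1 / (2 * \<tau>)) * e"
      unfolding E using nz by (simp add: field_simps power2_eq_square)
    show ?thesis
      unfolding R_def
      by (rule derivative_eq_intros d[unfolded E'] has_field_derivative_eta[OF \<tau>] refl | use nz in \<open>simp; fail\<close>)+
         (use nz e' in \<open>simp add: e_def[symmetric] field_simps power2_eq_square\<close>)
  qed
  then have "R constant_on uhp"
    by (intro has_field_derivative_0_imp_constant_on open_uhp convex_connected convex_uhp)
  moreover have "\<i> \<in> uhp" by (simp add: uhp_def)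
  ultimately have "R \<tau> = R \<i>" using \<tau> by (auto simp: constant_on_def)
  also have "R \<i> = 1 / \<i>" using eta_nonzero[OF \<open>\<i> \<in> uhp\<close>] by (simp add: R_def)
  finally have "norm (R \<tau>) = 1" by (simp add: norm_divide)
  then show ?thesis
    using uhp_nonzero[OF \<tau>] eta_nonzero[OF \<tau>] by (simp add: R_def norm_divide norm_mult norm_power field_simps)
qed

lemma norm_eta_add_int: "norm (eta (\<tau> + of_int n)) = norm (eta \<tau>)"
proof -
  have "q_pow 1 (\<tau> + of_int n) = q_pow 1 \<tau>"
    by (simp add: q_pow_conv_exp2pi exp2pi_add)
  then show ?thesis by (simp add: eta_conv_euler_phi norm_mult norm_q_pow)
qed

text \<open>The matrix \<open>(1, 0; m, 1)\<close> is the conjugate of a translation by the inversion.\<close>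
lemma eta_lower_unipotent:
  fixes m :: int
  assumes u: "u \<in> uhp"
  shows "norm (eta (u / (of_int m * u + 1))) ^ 2 = norm (of_int m * u + 1) * norm (eta u) ^ 2"
proof -
  define v where "v = - 1 / u + of_int (- m)"
  have v: "v \<in> uhp" using minus_inverse_uhp[OF u] by (simp add: v_def uhp_def)
  have u0: "u \<noteq> 0" by (rule uhp_nonzero[OF u])
  have v': "v = - (of_int m * u + 1) / u" using u0 by (simp add: v_def field_simps)
  have "- 1 / (- a / u) = u / a" for a by simp
  then have "- 1 / v = u / (of_int m * u + 1)"
    unfolding v' .
  then have "norm (eta (u / (of_int m * u + 1))) ^ 2 = norm v * norm (eta v) ^ 2"
    using eta_inversion[OF v] by simp
  also have "norm (eta v) = norm (eta (- 1 / u))"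
    unfolding v_def by (rule norm_eta_add_int)
  also have nv: "norm v = norm (of_int m * u + 1) / norm u"
    unfolding v' norm_divide norm_minus_cancel ..
  also have "norm (of_int m * u + 1) / norm u * norm (eta (- 1 / u)) ^ 2 = norm (of_int m * u + 1) * norm (eta u) ^ 2"
    unfolding eta_inversion[OF u] using u0 by simp
  finally show ?thesis .
qed

section \<open>A maximum principle for families of functions on the upper half plane\<close>

lemma q_pow_onto_punctured_disc:
  assumes "x \<in> ball 0 1" "x \<noteq> 0" "N > 0"
  obtains \<tau> where "\<tau> \<in> uhp" "q_pow (1 / real N) \<tau> = x"
proof
  define \<tau> where "\<tau> = of_nat N * Ln x / (2 * of_real pi * \<i>)"
  have neg: "Re (Ln x) < 0" using assms by (simp add: Re_Ln)
  then have "real N * Re (Ln x) < 0" using assms(3) neg by (meson mult_pos_neg of_nat_0_less_iff)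
  then have "pi * (real N * Re (Ln x)) < 0" by (rule mult_pos_neg[OF pi_gt_zero])
  moreover have "Im \<tau> = - (pi * (real N * Re (Ln x)) / (2 * pi ^ 2))"
    by (simp add: \<tau>_def Im_divide power2_eq_square)
  ultimately show "\<tau> \<in> uhp"
    by (simp add: uhp_def zero_less_mult_iff divide_neg_pos)
  show "q_pow (1 / real N) \<tau> = x"
    using assms by (simp add: \<tau>_def q_pow_def)
qed

lemma shift_to_strip:
  obtains n :: int where "\<bar>Re (\<tau> + of_int n)\<bar> \<le> 1 / 2"
proof
  show "\<bar>Re (\<tau> + of_int (- round (Re \<tau>)))\<bar> \<le> 1 / 2"
    using of_int_round_abs_le[of "Re \<tau>"] by (simp add: abs_minus_commute)
qed

text \<open>Because the moduli of the members of the family are permuted by the modular group, the supremum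
  of all the moduli is a supremum over the half plane \<open>Im \<tau> \<ge> 1/2\<close>: a point below it is first moved to the
  strip \<open>|Re \<tau>| \<le> 1/2\<close>, where \<open>|\<tau>|^2 \<le> 1/2\<close>, so that the inversion at least doubles its imaginary part.
  In the variable \<open>q^(1/N)\<close> this half plane is a compact disc, which includes the point at infinity. So
  the supremum is attained by some member inside the unit disc, and this member is constant by the
  maximum modulus principle.\<close>
lemma max_principle_family:
  fixes F :: "(complex \<Rightarrow> complex) set"
  assumes N: "N > 0" and fin: "finite F" and ne: "F \<noteq> {}"
    and holo: "\<And>f. f \<in> F \<Longrightarrow> holo_at_infinity N f"
    and T: "\<And>f n. f \<in> F \<Longrightarrow> \<exists>g\<in>F. \<forall>\<tau>\<in>uhp. norm (f (\<tau> + of_int n)) = norm (g \<tau>)"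
    and S: "\<And>f. f \<in> F \<Longrightarrow> \<exists>g\<in>F. \<forall>\<tau>\<in>uhp. norm (f (- 1 / \<tau>)) = norm (g \<tau>)"
  shows "\<exists>f\<in>F. f constant_on uhp"
proof -
  obtain G where G: "\<And>f. f \<in> F \<Longrightarrow> G f holomorphic_on ball 0 1"
      "\<And>f \<tau>. f \<in> F \<Longrightarrow> \<tau> \<in> uhp \<Longrightarrow> f \<tau> = G f (q_pow (1 / real N) \<tau>)"
    using holo unfolding holo_at_infinity_def by metis
  \<comment> \<open>The modulus of \<open>q^(1/N)\<close> on the line \<open>Im \<tau> = 1/2\<close>.\<close>
  define r where "r = exp (- (pi / real N))"
  have r: "0 < r" "r < 1" using N by (auto simp: r_def)
  have cb: "cball 0 r \<subseteq> ball (0::complex) 1" using r by (auto simp: subset_iff)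
  have cont: "continuous_on (cball 0 r) (\<lambda>x. norm (G f x))" if "f \<in> F" for f
    using holomorphic_on_imp_continuous_on[OF holomorphic_on_subset[OF G(1)[OF that] cb]]
    by (rule continuous_on_norm)
  have "\<exists>x\<in>cball 0 r. \<forall>y\<in>cball 0 r. norm (G f y) \<le> norm (G f x)" if "f \<in> F" for f
    using continuous_attains_sup[OF compact_cball _ cont[OF that]] r by auto
  then obtain X where X: "\<And>f. f \<in> F \<Longrightarrow> X f \<in> cball 0 r"
      "\<And>f y. f \<in> F \<Longrightarrow> y \<in> cball 0 r \<Longrightarrow> norm (G f y) \<le> norm (G f (X f))"
    by metis
  define B where "B = Max ((\<lambda>f. norm (G f (X f))) ` F)"
  have "B \<in> (\<lambda>f. norm (G f (X f))) ` F"
    unfolding B_def using fin ne by (intro Max_in) auto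
  then obtain f0 where f0: "f0 \<in> F" "norm (G f0 (X f0)) = B" by auto
  have B: "norm (G f y) \<le> B" if "f \<in> F" "y \<in> cball 0 r" for f y
  proof -
    have "norm (G f y) \<le> norm (G f (X f))" using X that by auto
    also have "\<dots> \<le> B" unfolding B_def using fin that by (intro Max_ge) auto
    finally show ?thesis .
  qed
  have high: "norm (f \<tau>) \<le> B" if f: "f \<in> F" and \<tau>: "Im \<tau> \<ge> 1 / 2" for f \<tau>
  proof -
    have "\<tau> \<in> uhp" using \<tau> by (simp add: uhp_def)
    moreover have "q_pow (1 / real N) \<tau> \<in> cball 0 r"
      using \<tau> N by (simp add: norm_q_pow r_def field_simps)
    ultimately show ?thesis using B[OF f] G(2)[OF f] by simp
  qed
  have low: "norm (f \<tau>) \<le> B" if "f \<in> F" "\<tau> \<in> uhp" "Im \<tau> * 2 ^ n \<ge> 1 / 2" for n f \<tau>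
    using that
  proof (induction n arbitrary: f \<tau>)
    case 0
    then show ?case using high by simp
  next
    case (Suc n)
    show ?case
    proof (cases "Im \<tau> \<ge> 1 / 2")
      case True
      then show ?thesis using high Suc.prems by simp
    next
      case False
      obtain m where m: "\<bar>Re (\<tau> + of_int m)\<bar> \<le> 1 / 2" by (rule shift_to_strip)
      define \<sigma> where "\<sigma> = \<tau> + of_int m"
      have \<sigma>: "\<sigma> \<in> uhp" "Im \<sigma> = Im \<tau>" using Suc.prems by (auto simp: \<sigma>_def uhp_def)
      have "\<bar>Re \<sigma>\<bar>\<^sup>2 \<le> (1 / 2)\<^sup>2" using m by (intro power_mono) (auto simp: \<sigma>_def)
      moreover have "\<bar>Im \<sigma>\<bar>\<^sup>2 \<le> (1 / 2)\<^sup>2"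
        using False \<sigma> by (intro power_mono) (auto simp: uhp_def)
      ultimately have le: "norm \<sigma> ^ 2 \<le> 1 / 2"
        unfolding power2_abs cmod_power2 by (simp add: power_divide)
      have pos: "norm \<sigma> ^ 2 > 0" using uhp_nonzero[OF \<sigma>(1)] by simp
      obtain g where g: "g \<in> F" "\<And>\<tau>. \<tau> \<in> uhp \<Longrightarrow> norm (f (\<tau> + of_int (- m))) = norm (g \<tau>)"
        using T[OF Suc.prems(1), of "-m"] by auto
      obtain h where h: "h \<in> F" "\<And>\<tau>. \<tau> \<in> uhp \<Longrightarrow> norm (g (- 1 / \<tau>)) = norm (h \<tau>)"
        using S[OF g(1)] by auto
      have "norm (f \<tau>) = norm (g \<sigma>)" using g(2)[OF \<sigma>(1)] by (simp add: \<sigma>_def)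
      also have "\<dots> = norm (h (- 1 / \<sigma>))"
        using h(2)[OF minus_inverse_uhp[OF \<sigma>(1)]] by simp
      also have "\<dots> \<le> B"
      proof (rule Suc.IH[OF h(1) minus_inverse_uhp[OF \<sigma>(1)]])
        have "Im (- 1 / \<sigma>) = Im \<sigma> / norm \<sigma> ^ 2"
          using Im_moebius_act[OF S_mat_SL2Z, of \<sigma>] by (simp add: act_S_mat)
        also have "\<dots> \<ge> Im \<sigma> / (1 / 2)"
          using le pos \<sigma>(1) by (intro divide_left_mono) (auto simp: uhp_def)
        finally have "Im (- 1 / \<sigma>) \<ge> 2 * Im \<tau>" by (simp add: \<sigma>(2))
        then have "Im (- 1 / \<sigma>) * 2 ^ n \<ge> 2 * Im \<tau> * 2 ^ n" by (intro mult_right_mono) auto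
        then show "1 / 2 \<le> Im (- 1 / \<sigma>) * 2 ^ n" using Suc.prems(3) by (simp add: mult_ac)
      qed
      finally show ?thesis .
    qed
  qed
  have all: "norm (f0 \<tau>) \<le> B" if "\<tau> \<in> uhp" for \<tau>
  proof -
    have "Im \<tau> > 0" using that by (simp add: uhp_def)
    obtain n where "1 / 2 / Im \<tau> < 2 ^ n" using real_arch_pow[of 2 "1 / 2 / Im \<tau>"] by auto
    with \<open>Im \<tau> > 0\<close> have "Im \<tau> * 2 ^ n \<ge> 1 / 2" by (simp add: field_simps)
    with low[OF f0(1) that] show ?thesis .
  qed
  have disc: "norm (G f0 x) \<le> norm (G f0 (X f0))" if x: "x \<in> ball 0 1" for x
  proof (cases "x = 0")
    case True
    then show ?thesis using B[OF f0(1), of 0] r f0(2) by simp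
  next
    case False
    obtain \<tau> where "\<tau> \<in> uhp" "q_pow (1 / real N) \<tau> = x" by (rule q_pow_onto_punctured_disc[OF x False N])
    with all[of \<tau>] G(2)[OF f0(1), of \<tau>] f0(2) show ?thesis by simp
  qed
  have "G f0 constant_on ball 0 1"
    by (rule maximum_modulus_principle[OF G(1)[OF f0(1)], of "ball 0 1" "X f0"])
       (use disc X(1)[OF f0(1)] cb in auto)
  then obtain c where "\<And>x. x \<in> ball 0 1 \<Longrightarrow> G f0 x = c" by (auto simp: constant_on_def)
  then have "f0 \<tau> = c" if "\<tau> \<in> uhp" for \<tau>
    using G(2)[OF f0(1) that] norm_q_pow_less_1[OF _ that, of "1 / real N"] N by simp
  with f0(1) show ?thesis unfolding constant_on_def by blast
qed

section \<open>The Eisenstein series of levels 2 and 3\<close>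

lemma E22_conv_lambert:
  "E22 \<tau> = 1 + 24 * lambert (\<lambda>d. if odd d then of_nat d else 0) (q_pow 1 \<tau>)"
proof -
  have "of_nat (\<Sum>d | d dvd Suc n \<and> \<not> 2 dvd d. d) = (\<Sum>d | d dvd Suc n. if odd d then of_nat d else (0::complex))" for n
    by (simp add: sum.If_cases Int_def)
  then show ?thesis
    by (simp only: E22_def lambert_def q_pow_Suc)
qed

lemma E22_conv_E2:
  assumes \<tau>: "\<tau> \<in> uhp"
  shows "E22 \<tau> = 2 * E2 (2 * \<tau>) - E2 \<tau>"
proof -
  have "q_pow 1 (2 * \<tau>) = q_pow 1 \<tau> ^ 2"
    using q_pow_of_nat_mult[of 1 2 \<tau>] by simp
  moreover have "norm (q_pow 1 \<tau>) < 1" using norm_q_pow_less_1[OF _ \<tau>, of 1] by simp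
  ultimately show ?thesis
    by (simp add: E22_conv_lambert E2_def lambert_odd_conv_id)
qed

text \<open>Multiplication by \<open>p\<close> turns the action of a matrix whose lower left entry is divisible by \<open>p\<close> into
  the action of another integral matrix, with the same automorphy factor.\<close>
lemma moebius_scale:
  assumes A: "A \<in> SL2Z" and c: "int p dvd A$2$1" and p: "p > 0"
  defines "B \<equiv> (vector [vector [A$1$1, int p * A$1$2], vector [A$2$1 div int p, A$2$2]] :: int ^ 2 ^ 2)"
  shows "B \<in> SL2Z" "moebius_act B (of_nat p * \<tau>) = of_nat p * moebius_act A \<tau>"
    "autom_factor B (of_nat p * \<tau>) = autom_factor A \<tau>"
proof -
  have B: "B$1$1 = A$1$1" "B$1$2 = int p * A$1$2" "B$2$1 = A$2$1 div int p" "B$2$2 = A$2$2"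
    by (simp_all add: B_def)
  from c obtain k where k: "A$2$1 = int p * k" by (auto simp: dvd_def)
  have kk: "A$2$1 div int p = k" using p by (simp add: k)
  show "B \<in> SL2Z" using A p by (simp add: det_SL2Z B kk k mult_ac)
  show *: "autom_factor B (of_nat p * \<tau>) = autom_factor A \<tau>"
    by (simp add: autom_factor_def B kk k mult_ac)
  show "moebius_act B (of_nat p * \<tau>) = of_nat p * moebius_act A \<tau>"
    unfolding moebius_act_def * by (simp add: B algebra_simps)
qed

lemma scale_uhp: "\<tau> \<in> uhp \<Longrightarrow> p > 0 \<Longrightarrow> of_nat p * \<tau> \<in> uhp" "\<tau> \<in> uhp \<Longrightarrow> p > 0 \<Longrightarrow> \<tau> / of_nat p \<in> uhp"
  by (auto simp: uhp_def)

text \<open>The inhomogeneous terms in the transformation laws of \<open>2 E2(2 \<tau>)\<close> and \<open>E2(\<tau>)\<close> cancel.\<close>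
lemma E22_modular:
  assumes A: "A \<in> SL2Z" and c: "2 dvd A$2$1" and \<tau>: "\<tau> \<in> uhp"
  shows "E22 (moebius_act A \<tau>) = autom_factor A \<tau> ^ 2 * E22 \<tau>"
proof -
  \<comment> \<open>The matrix that acts on \<open>2 \<tau>\<close> as \<open>A\<close> acts on \<open>\<tau>\<close>.\<close>
  define B where "B = (vector [vector [A$1$1, int 2 * A$1$2], vector [A$2$1 div int 2, A$2$2]] :: int ^ 2 ^ 2)"
  have B: "B \<in> SL2Z" "moebius_act B (2 * \<tau>) = 2 * moebius_act A \<tau>" "autom_factor B (2 * \<tau>) = autom_factor A \<tau>"
    using moebius_scale(1)[OF A, of 2] moebius_scale(2,3)[OF A, of 2 \<tau>] c by (simp_all add: B_def)
  have B21: "A$2$1 = 2 * B$2$1" using c by (simp add: B_def)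
  have t2: "2 * \<tau> \<in> uhp" using \<tau> by (simp add: uhp_def)
  show ?thesis
    unfolding E22_conv_E2[OF \<tau>] E22_conv_E2[OF moebius_act_uhp[OF A \<tau>]] B(2)[symmetric]
      E2_modular[OF B(1) t2] E2_modular[OF A \<tau>] B(3) B21
    by (simp add: algebra_simps)
qed

lemma E22_inversion:
  assumes \<tau>: "\<tau> \<in> uhp"
  shows "E22 (- 1 / \<tau>) = - (1 / 2) * \<tau> ^ 2 * E22 (\<tau> / 2)"
proof -
  have S: "E2 (- 1 / \<tau>) = \<tau> ^ 2 * E2 \<tau> + 6 / (of_real pi * \<i>) * \<tau>" if "\<tau> \<in> uhp" for \<tau>
    using E2_modular[OF S_mat_SL2Z that] by (simp add: act_S_mat S_mat_entries)
  have h: "\<tau> / 2 \<in> uhp" using \<tau> by (simp add: uhp_def)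
  have e: "2 * (- 1 / \<tau>) = - 1 / (\<tau> / 2)" by simp
  show ?thesis
    unfolding E22_conv_E2[OF minus_inverse_uhp[OF \<tau>]] E22_conv_E2[OF h] e S[OF \<tau>] S[OF h]
    by (simp add: algebra_simps power_divide)
qed

text \<open>The character with complex values, as the coefficients of a Lambert series require.\<close>
definition chi3c :: "nat \<Rightarrow> complex" where "chi3c d = of_int (chi3 d)"

lemma chi3_mod: "chi3 d = (if d mod 3 = 1 then 1 else if d mod 3 = 2 then -1 else 0)"
  by (simp add: chi3_def cong_def)

lemma E_chi3_conv_lambert: "E_chi3 \<tau> = 1 + 6 * lambert chi3c (q_pow 1 \<tau>)"
  by (simp only: E_chi3_def lambert_def q_pow_Suc chi3c_def of_int_sum)

lemma norm_chi3c: "norm (chi3c d) \<le> real d"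
  by (cases d) (auto simp: chi3c_def chi3_mod)

definition omega :: complex where "omega = exp2pi (1 / 3)"

lemma omega_eq: "omega = - 1 / 2 + \<i> * of_real (sqrt 3) / 2"
proof -
  have "omega = cis (2 * pi / 3)"
    by (simp add: omega_def exp2pi_def cis_conv_exp mult_ac)
  then show ?thesis by (simp add: complex_eq_iff cos_120 sin_120)
qed

lemma sqrt_3_square: "complex_of_real (sqrt 3) * complex_of_real (sqrt 3) = 3"
  by (simp flip: of_real_mult)

lemma omega_relations: "omega ^ 3 = 1" "1 / omega = omega ^ 2" "omega ^ 2 = - 1 - omega"
proof -
  have 1: "omega ^ 2 = - 1 - omega"
    by (simp add: omega_eq complex_eq_iff power2_eq_square)
  show "omega ^ 2 = - 1 - omega" by (fact 1)
  have "omega ^ 3 = omega * omega ^ 2" by (simp add: power3_eq_cube power2_eq_square)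
  also have "\<dots> = - omega - omega * omega" unfolding 1 by (simp add: algebra_simps)
  also have "\<dots> = 1" using 1 unfolding power2_eq_square by simp
  finally show 3: "omega ^ 3 = 1" .
  then have "omega ^ 2 * omega = 1" by (simp add: power3_eq_cube power2_eq_square)
  moreover have "omega \<noteq> 0" by (simp add: omega_def)
  ultimately show "1 / omega = omega ^ 2" by (simp add: field_simps)
qed

text \<open>The Gauss sum of the character modulo 3.\<close>
lemma omega_power_diff: "omega ^ d - (1 / omega) ^ d = \<i> * of_real (sqrt 3) * chi3c d"
proof -
  have m: "omega ^ n = omega ^ (n mod 3)" for n
  proof -
    have "omega ^ n = omega ^ (3 * (n div 3) + n mod 3)" by simp
    also have "\<dots> = omega ^ (n mod 3)" by (simp only: power_add power_mult omega_relations(1) power_one mult_1_left)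
    finally show ?thesis .
  qed
  have "omega ^ d - (1 / omega) ^ d = omega ^ (d mod 3) - omega ^ ((2 * d) mod 3)"
    unfolding omega_relations(2) power_mult[symmetric] using m by metis
  also have "(2 * d) mod 3 = (2 * (d mod 3)) mod 3" by (simp add: mod_mult_right_eq)
  also have "omega ^ (d mod 3) - omega ^ ((2 * (d mod 3)) mod 3) = \<i> * of_real (sqrt 3) * chi3c d"
  proof -
    have "d mod 3 = 0 \<or> d mod 3 = 1 \<or> d mod 3 = 2" by linarith
    then show ?thesis
      by (elim disjE) (simp_all add: chi3c_def chi3_mod omega_relations(3), simp_all add: omega_eq)
  qed
  finally show ?thesis .
qed

text \<open>At the division point \<open>1/3\<close> the terms of the double series for \<open>polar\<close> are differences of powers of
  cube roots of unity, hence values of the character.\<close>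
lemma polar_third:
  assumes \<tau>: "\<tau> \<in> uhp"
  shows "polar (1 / 3) \<tau> = - (\<i> / (2 * of_real (sqrt 3))) * E_chi3 \<tau>"
proof -
  define q where "q = q_pow 1 \<tau>"
  have q: "norm q < 1" using norm_q_pow_less_1[OF _ \<tau>, of 1] by (simp add: q_def)
  let ?s = "of_real (sqrt 3) :: complex"
  define g where "g = (\<lambda>y. (omega * y / (1 - omega * y) - (1 / omega) * y / (1 - (1 / omega) * y)) / (\<i> * ?s))"
  have n1: "norm omega = 1" "norm (1 / omega) = 1"
    by (simp_all add: omega_def exp2pi_def norm_divide)
  have "(\<lambda>m. g (q ^ Suc m)) sums lambert chi3c q"
  proof (rule lambert_sums_swapped[OF norm_chi3c q])
    fix y :: complex assume y: "norm y < 1"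
    have "(\<lambda>d. (omega * y) ^ Suc d - ((1 / omega) * y) ^ Suc d) sums (omega * y / (1 - omega * y) - (1 / omega) * y / (1 - (1 / omega) * y))"
      by (intro sums_diff geometric_sums_from_1) (use y n1 in \<open>simp_all only: norm_mult mult_1_left\<close>)
    from sums_divide[OF this, of "\<i> * ?s"]
    have "(\<lambda>d. ((omega * y) ^ Suc d - ((1 / omega) * y) ^ Suc d) / (\<i> * ?s)) sums g y"
      by (simp only: g_def)
    also have "(\<lambda>d. ((omega * y) ^ Suc d - ((1 / omega) * y) ^ Suc d) / (\<i> * ?s)) = (\<lambda>d. chi3c (Suc d) * y ^ Suc d)"
      by (simp only: power_mult_distrib left_diff_distrib[symmetric] omega_power_diff) (simp add: field_simps)
    finally show "(\<lambda>d. chi3c (Suc d) * y ^ Suc d) sums g y" .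
  qed
  from sums_mult[OF this, of "\<i> * ?s"]
  have 1: "(\<lambda>m. omega * q ^ Suc m / (1 - omega * q ^ Suc m) - (1 / omega) * q ^ Suc m / (1 - (1 / omega) * q ^ Suc m))
     sums (\<i> * ?s * lambert chi3c q)"
    by (simp add: g_def del: power_Suc)
  have "(\<lambda>m. omega * q ^ Suc m / (1 - omega * q ^ Suc m) - (1 / omega) * q ^ Suc m / (1 - (1 / omega) * q ^ Suc m))
     sums (polar_sum q omega - polar_sum q (1 / omega))"
    unfolding polar_sum_def by (intro sums_diff summable_sums summable_polar_sum q)
  from sums_unique2[OF this 1] have 2: "polar_sum q omega - polar_sum q (1 / omega) = \<i> * ?s * lambert chi3c q" .
  have s0: "?s \<noteq> 0" by simp
  have 3: "(omega + 1) / (omega - 1) / 2 = - (\<i> / (2 * ?s))"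
  proof -
    have "omega - 1 \<noteq> 0" by (simp add: omega_eq complex_eq_iff)
    moreover have "(omega + 1) * (2 * ?s) = - \<i> * (2 * (omega - 1))"
      using sqrt_3_square by (simp add: omega_eq algebra_simps)
    ultimately show ?thesis using s0 by (simp add: field_simps)
  qed
  have "polar (1 / 3) \<tau> = - (\<i> / (2 * ?s)) - \<i> * ?s * lambert chi3c q"
    unfolding polar_def q_def[symmetric] exp2pi_minus omega_def[symmetric] 2 3 ..
  also have "\<i> * ?s = \<i> / (2 * ?s) * 6"
    using s0 sqrt_3_square by (simp add: field_simps)
  finally show ?thesis
    by (simp add: E_chi3_conv_lambert q_def algebra_simps)
qed

text \<open>At the division point \<open>\<tau>/3\<close>, with \<open>x = q^(1/3)\<close>, the two halves of \<open>polar\<close> collect the terms of the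
  Lambert series in \<open>x\<close> with index congruent to 1 and to 2 modulo 3.\<close>
lemma polar_tau_third:
  assumes \<tau>: "\<tau> \<in> uhp"
  shows "polar (\<tau> / 3) \<tau> + 1 / 3 = - (1 / 6) * E_chi3 (\<tau> / 3)"
proof -
  define x where "x = q_pow 1 (\<tau> / 3)"
  have "\<tau> / 3 \<in> uhp" using \<tau> by (simp add: uhp_def)
  then have x: "norm x < 1" using norm_q_pow_less_1[of 1 "\<tau> / 3"] by (simp add: x_def)
  have x0: "x \<noteq> 0" by (simp add: x_def)
  have q: "q_pow 1 \<tau> = x ^ 3" using q_pow_of_nat_mult[of 1 3 "\<tau> / 3"] by (simp add: x_def)
  have w: "exp2pi (\<tau> / 3) = x" by (simp add: x_def q_pow_conv_exp2pi)
  have qn: "norm (x ^ 3) < 1" using x by (simp add: norm_power power_less_one_iff)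
  define L where "L = (\<lambda>d. x ^ d / (1 - x ^ d))"
  have "(\<lambda>d. chi3c (Suc d) * L (Suc d)) sums lambert chi3c x"
    unfolding L_def by (rule lambert_sums[OF norm_chi3c x])
  then have "(\<lambda>n. \<Sum>d\<in>{n * 3..<n * 3 + 3}. chi3c (Suc d) * L (Suc d)) sums lambert chi3c x"
    by (rule sums_group) simp
  moreover have "(\<Sum>d\<in>{n * 3..<n * 3 + 3}. chi3c (Suc d) * L (Suc d)) = L (3 * n + 1) - L (3 * n + 2)" for n
  proof -
    have "{n * 3..<n * 3 + 3} = {3 * n, 3 * n + 1, 3 * n + 2}" by auto
    moreover have "chi3c (Suc (3 * n)) = 1" "chi3c (Suc (3 * n + 1)) = - 1" "chi3c (Suc (3 * n + 2)) = 0"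
    proof -
      have "Suc (3 * n) mod 3 = 1" "Suc (3 * n + 1) mod 3 = 2" "Suc (3 * n + 2) mod 3 = 0"
        by presburger+
      then show "chi3c (Suc (3 * n)) = 1" "chi3c (Suc (3 * n + 1)) = - 1" "chi3c (Suc (3 * n + 2)) = 0"
        unfolding chi3c_def chi3_mod by simp_all
    qed
    ultimately show ?thesis by simp
  qed
  ultimately have 1: "(\<lambda>n. L (3 * n + 1) - L (3 * n + 2)) sums lambert chi3c x" by simp
  have pw: "x * (x ^ 3) ^ Suc n = x ^ (3 * Suc n + 1)" "1 / x * (x ^ 3) ^ Suc n = x ^ (3 * n + 2)" for n
  proof -
    show "x * (x ^ 3) ^ Suc n = x ^ (3 * Suc n + 1)"
      by (simp only: power_mult[symmetric] power_Suc[symmetric] Suc_eq_plus1)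
    have "(x ^ 3) ^ Suc n = x * x ^ (3 * n + 2)"
      unfolding power_mult[symmetric] power_Suc[symmetric] by (rule arg_cong[of _ _ "(^) x"]) simp
    then show "1 / x * (x ^ 3) ^ Suc n = x ^ (3 * n + 2)" using x0 by simp
  qed
  have "(\<lambda>n. L (3 * Suc n + 1)) sums polar_sum (x ^ 3) x"
    using summable_sums[OF summable_polar_sum[OF qn, of x]] unfolding polar_sum_def pw L_def .
  then have "(\<lambda>n. L (3 * n + 1)) sums (polar_sum (x ^ 3) x + L (3 * 0 + 1))"
    by (subst (asm) sums_Suc_iff[where f = "\<lambda>n. L (3 * n + 1)"]) simp
  moreover have "(\<lambda>n. L (3 * n + 2)) sums polar_sum (x ^ 3) (1 / x)"
    using summable_sums[OF summable_polar_sum[OF qn, of "1 / x"]] unfolding polar_sum_def pw L_def .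
  ultimately have "(\<lambda>n. L (3 * n + 1) - L (3 * n + 2)) sums (polar_sum (x ^ 3) x + L (3 * 0 + 1) - polar_sum (x ^ 3) (1 / x))"
    by (rule sums_diff)
  from sums_unique2[OF this 1] have 2: "polar_sum (x ^ 3) x + x / (1 - x) - polar_sum (x ^ 3) (1 / x) = lambert chi3c x"
    by (simp add: L_def)
  have x1: "x \<noteq> 1" using x by auto
  have 3: "(x + 1) / (x - 1) / 2 = - 1 / 2 - x / (1 - x)"
    using x1 by (simp add: divide_simps) (simp add: algebra_simps)?
  have "polar (\<tau> / 3) \<tau> = - 1 / 2 - (polar_sum (x ^ 3) x + x / (1 - x) - polar_sum (x ^ 3) (1 / x))"
    unfolding polar_def q w exp2pi_minus 3 by simp
  then show ?thesis
    unfolding 2 by (simp add: E_chi3_conv_lambert x_def algebra_simps)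
qed

lemma third_notin_lattice:
  assumes \<tau>: "\<tau> \<in> uhp"
  shows "1 / 3 \<notin> period_lattice \<tau>" "\<tau> / 3 \<notin> period_lattice \<tau>"
proof -
  have "(1 / 3 :: real) \<notin> \<int>"
    using Ints_nonzero_abs_less1[of "1 / 3 :: real"] by auto
  then show "1 / 3 \<notin> period_lattice \<tau>" "\<tau> / 3 \<notin> period_lattice \<tau>"
    using \<tau> by (auto simp: period_lattice_coords[OF \<tau>] uhp_def)
qed

lemma E_chi3_inversion:
  assumes \<tau>: "\<tau> \<in> uhp"
  shows "E_chi3 (- 1 / \<tau>) = - (\<i> / of_real (sqrt 3)) * \<tau> * E_chi3 (\<tau> / 3)"
proof -
  let ?s = "of_real (sqrt 3) :: complex"
  have s0: "?s \<noteq> 0" by simp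
  have "polar (\<tau> / 3 / \<tau>) (- 1 / \<tau>) = \<tau> * polar (\<tau> / 3) \<tau> + \<tau> / 3"
    using polar_modular[OF S_mat_SL2Z \<tau> third_notin_lattice(2)[OF \<tau>]]
    by (simp add: act_S_mat S_mat_entries)
  also have "\<tau> / 3 / \<tau> = 1 / 3" using uhp_nonzero[OF \<tau>] by simp
  also have "\<tau> * polar (\<tau> / 3) \<tau> + \<tau> / 3 = \<tau> * (polar (\<tau> / 3) \<tau> + 1 / 3)" by (simp add: algebra_simps)
  finally have eq: "- (\<i> / (2 * ?s)) * E_chi3 (- 1 / \<tau>) = \<tau> * (- (1 / 6) * E_chi3 (\<tau> / 3))"
    unfolding polar_tau_third[OF \<tau>] polar_third[OF minus_inverse_uhp[OF \<tau>]] .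
  have "E_chi3 (- 1 / \<tau>) = (2 * ?s * \<i>) * (- (\<i> / (2 * ?s)) * E_chi3 (- 1 / \<tau>))"
    using s0 by simp
  also have "\<dots> = - (?s * \<i> / 3) * \<tau> * E_chi3 (\<tau> / 3)"
    unfolding eq by simp
  also have "?s * \<i> / 3 = \<i> / ?s"
    using s0 sqrt_3_square by (simp add: field_simps)
  finally show ?thesis .
qed

text \<open>The hypotheses on \<open>A\<close> say that it fixes the division point \<open>1/3\<close> modulo the lattice. The resulting
  jump of \<open>polar\<close> cancels the linear term in its transformation law.\<close>
lemma E_chi3_modular:
  assumes A: "A \<in> SL2Z" and c: "3 dvd A$2$1" and d: "3 dvd A$2$2 - 1" and \<tau>: "\<tau> \<in> uhp"
  shows "E_chi3 (moebius_act A \<tau>) = autom_factor A \<tau> * E_chi3 \<tau>"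
proof -
  define j where "j = autom_factor A \<tau>"
  have j: "j \<noteq> 0" unfolding j_def by (rule autom_factor_nonzero[OF A \<tau>])
  from c d obtain k l where kl: "A$2$1 = 3 * k" "A$2$2 = 3 * l + 1"
    by (metis add.commute diff_add_cancel dvdE)
  have jz: "j / 3 = 1 / 3 + of_int l + of_int k * \<tau>"
    by (simp add: j_def autom_factor_def kl field_simps)
  have notin: "j / 3 \<notin> period_lattice \<tau>"
    unfolding jz period_lattice_shift by (rule third_notin_lattice(1)[OF \<tau>])
  have "polar (j / 3 / j) (moebius_act A \<tau>) = j * polar (j / 3) \<tau> + of_int (A$2$1) * (j / 3)"
    using polar_modular[OF A \<tau> notin] by (simp add: j_def)
  also have "j / 3 / j = 1 / 3" using j by simp
  also have "polar (j / 3) \<tau> = polar (1 / 3) \<tau> - of_int k"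
    unfolding jz by (rule polar_quasiperiodic[OF \<tau> third_notin_lattice(1)[OF \<tau>]])
  also have "j * (polar (1 / 3) \<tau> - of_int k) + of_int (A$2$1) * (j / 3) = j * polar (1 / 3) \<tau>"
    by (simp add: kl algebra_simps)
  finally show ?thesis
    unfolding polar_third[OF \<tau>] polar_third[OF moebius_act_uhp[OF A \<tau>]] j_def by simp
qed

lemma divisor_sum_odd:
  "n > 0 \<Longrightarrow> (\<Sum>d | d dvd 2 * n. if odd d then of_nat d else (0::complex)) = (\<Sum>d | d dvd n. if odd d then of_nat d else 0)"
  by (rule sum.mono_neutral_right) (auto simp: coprime_dvd_mult_right_iff)

lemma divisor_sum_chi3:
  assumes "n > 0"
  shows "(\<Sum>d | d dvd 3 * n. chi3c d) = (\<Sum>d | d dvd n. chi3c d)"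
proof (rule sum.mono_neutral_right)
  show "\<forall>i\<in>{d. d dvd 3 * n} - {d. d dvd n}. chi3c i = 0"
  proof (rule ballI)
    fix d assume "d \<in> {d. d dvd 3 * n} - {d. d dvd n}"
    then have d: "d dvd 3 * n" "\<not> d dvd n" by auto
    have "3 dvd d"
    proof (rule ccontr)
      assume "\<not> 3 dvd d"
      then have "coprime 3 d" by (intro prime_imp_coprime) auto
      with d show False by (simp add: coprime_dvd_mult_right_iff coprime_commute)
    qed
    then show "chi3c d = 0" by (simp add: chi3c_def chi3_mod)
  qed
qed (use assms in auto)

text \<open>If \<open>n\<close> is congruent to 2 modulo 3, then the character takes opposite values at complementary divisors.\<close>
lemma divisor_sum_chi3_eq_0:
  assumes "n mod 3 = 2"
  shows "(\<Sum>d | d dvd n. chi3c d) = 0"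
proof -
  have n: "n > 0" using assms by (cases n) auto
  have "(\<Sum>d | d dvd n. chi3c d) = (\<Sum>d | d dvd n. - chi3c d)"
  proof (rule sum.reindex_bij_witness[of _ "\<lambda>d. n div d" "\<lambda>d. n div d"])
    fix d assume "d \<in> {d. d dvd n}"
    then obtain m where m: "n = d * m" by auto
    with n have d0: "d > 0" "m > 0" by auto
    show "n div d \<in> {d. d dvd n}" "n div (n div d) = d" using d0 by (auto simp: m)
    have "(d mod 3) * (m mod 3) mod 3 = 2" using assms by (simp add: m mod_mult_eq)
    moreover have "d mod 3 = 0 \<or> d mod 3 = 1 \<or> d mod 3 = 2" "m mod 3 = 0 \<or> m mod 3 = 1 \<or> m mod 3 = 2"
      by linarith+
    ultimately have "chi3 m = - chi3 d" by (auto simp: chi3_mod)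
    then show "- chi3c (n div d) = chi3c d" using d0 by (simp add: m chi3c_def)
  qed (use n in \<open>auto elim!: dvdE\<close>)
  then show ?thesis by (simp add: sum_negf)
qed

section \<open>Expansions at infinity\<close>

lemma holo_at_infinity_shift:
  assumes "holo_at_infinity N f" "N > 0"
  shows "holo_at_infinity N (\<lambda>\<tau>. f (\<tau> + of_int n))"
proof -
  from assms obtain g where g: "g holomorphic_on ball 0 1" "\<And>\<tau>. \<tau> \<in> uhp \<Longrightarrow> f \<tau> = g (q_pow (1 / real N) \<tau>)"
    by (auto simp: holo_at_infinity_def)
  define z where "z = q_pow (1 / real N) (of_int n)"
  have z: "norm z = 1" by (simp add: z_def norm_q_pow)
  have im: "(\<lambda>x. z * x) ` ball 0 1 \<subseteq> ball 0 1" using z by (auto simp: norm_mult)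
  have "(\<lambda>x. g (z * x)) holomorphic_on ball 0 1"
    using holomorphic_on_compose_gen[of "\<lambda>x. z * x" "ball 0 1" g "ball 0 1"] g(1) im
    by (auto simp: o_def intro!: holomorphic_intros)
  moreover have "f (\<tau> + of_int n) = g (z * q_pow (1 / real N) \<tau>)" if "\<tau> \<in> uhp" for \<tau>
    using g(2)[of "\<tau> + of_int n"] that
    by (simp add: uhp_def z_def q_pow_conv_exp2pi add_divide_distrib exp2pi_add mult.commute)
  ultimately show ?thesis unfolding holo_at_infinity_def
    by (intro exI[of _ "\<lambda>x. g (z * x)"]) auto
qed

lemma holo_at_infinity_cong:
  "(\<And>\<tau>. \<tau> \<in> uhp \<Longrightarrow> f \<tau> = g \<tau>) \<Longrightarrow> holo_at_infinity N f \<longleftrightarrow> holo_at_infinity N g"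
  by (simp add: holo_at_infinity_def)

lemma holo_at_infinity_const: "holo_at_infinity N (\<lambda>_. c)"
  unfolding holo_at_infinity_def by (intro exI[of _ "\<lambda>_. c"]) auto

lemma holo_at_infinity_add:
  assumes "holo_at_infinity N f" "holo_at_infinity N g"
  shows "holo_at_infinity N (\<lambda>\<tau>. f \<tau> + g \<tau>)"
proof -
  from assms obtain F G where "F holomorphic_on ball 0 1" "\<And>\<tau>. \<tau> \<in> uhp \<Longrightarrow> f \<tau> = F (q_pow (1 / real N) \<tau>)"
    "G holomorphic_on ball 0 1" "\<And>\<tau>. \<tau> \<in> uhp \<Longrightarrow> g \<tau> = G (q_pow (1 / real N) \<tau>)"
    unfolding holo_at_infinity_def by blast
  then show ?thesis unfolding holo_at_infinity_def
    by (intro exI[of _ "\<lambda>x. F x + G x"]) (auto intro!: holomorphic_intros)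
qed

lemma holo_at_infinity_mult:
  assumes "holo_at_infinity N f" "holo_at_infinity N g"
  shows "holo_at_infinity N (\<lambda>\<tau>. f \<tau> * g \<tau>)"
proof -
  from assms obtain F G where "F holomorphic_on ball 0 1" "\<And>\<tau>. \<tau> \<in> uhp \<Longrightarrow> f \<tau> = F (q_pow (1 / real N) \<tau>)"
    "G holomorphic_on ball 0 1" "\<And>\<tau>. \<tau> \<in> uhp \<Longrightarrow> g \<tau> = G (q_pow (1 / real N) \<tau>)"
    unfolding holo_at_infinity_def by blast
  then show ?thesis unfolding holo_at_infinity_def
    by (intro exI[of _ "\<lambda>x. F x * G x"]) (auto intro!: holomorphic_intros)
qed

lemma holo_at_infinity_imp_holomorphic:
  assumes "holo_at_infinity N f" "N > 0"
  shows "f holomorphic_on uhp"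
proof -
  from assms obtain g where g: "g holomorphic_on ball 0 1" "\<And>\<tau>. \<tau> \<in> uhp \<Longrightarrow> f \<tau> = g (q_pow (1 / real N) \<tau>)"
    by (auto simp: holo_at_infinity_def)
  have "q_pow (1 / real N) ` uhp \<subseteq> ball 0 1"
    using norm_q_pow_less_1[of "1 / real N"] assms(2) by auto
  then have "(\<lambda>\<tau>. g (q_pow (1 / real N) \<tau>)) holomorphic_on uhp"
    using holomorphic_on_compose_gen[OF holomorphic_q_pow g(1), of "1 / real N" uhp]
    by (simp add: o_def)
  then show ?thesis by (rule holomorphic_transform) (simp add: g(2))
qed

lemma constant_at_infinity:
  assumes g: "g holomorphic_on ball 0 1" and N: "N > 0"
    and c: "\<And>\<tau>. \<tau> \<in> uhp \<Longrightarrow> g (q_pow (1 / real N) \<tau>) = c"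
  shows "g 0 = c"
proof -
  have "isCont g 0"
    using holomorphic_on_imp_continuous_on[OF g] by (simp add: continuous_on_eq_continuous_at)
  then have 1: "(g \<longlongrightarrow> g 0) (at 0)" by (simp add: isCont_def)
  have "eventually (\<lambda>x::complex. x \<in> ball 0 1 - {0}) (at 0)"
    by (auto simp: eventually_at dist_norm intro!: exI[of _ 1])
  then have "eventually (\<lambda>x. g x = c) (at 0)"
  proof eventually_elim
    case (elim x)
    then obtain \<tau> where "\<tau> \<in> uhp" "q_pow (1 / real N) \<tau> = x"
      using q_pow_onto_punctured_disc[of x N] N by auto
    with c show ?case by blast
  qed
  then have "(g \<longlongrightarrow> c) (at 0)" by (rule tendsto_eventually)
  from tendsto_unique[OF _ 1 this] show ?thesis by simp
qed

lemma holomorphic_divide_identity: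
  assumes g: "g holomorphic_on ball 0 1" and "g 0 = 0"
  obtains h where "h holomorphic_on ball 0 1" "\<And>x. g x = x * h x" "h 0 = deriv g 0"
proof (rule that)
  let ?h = "\<lambda>z. if z = 0 then deriv g 0 else (g z - g 0) / (z - 0)"
  show "?h holomorphic_on ball 0 1"
    by (rule pole_lemma[OF g]) (auto simp: interior_open)
  show "g x = x * ?h x" for x using assms(2) by simp
qed simp

lemma constant_norm_imp_constant:
  assumes "f holomorphic_on uhp" and "\<And>\<tau>. \<tau> \<in> uhp \<Longrightarrow> norm (f \<tau>) = c"
  obtains k where "\<And>\<tau>. \<tau> \<in> uhp \<Longrightarrow> f \<tau> = k"
proof -
  have "f constant_on uhp"
    by (rule maximum_modulus_principle[OF assms(1) open_uhp _ open_uhp order.refl, of \<i>])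
       (use assms(2) convex_uhp in \<open>auto simp: convex_connected uhp_def\<close>)
  with that show ?thesis by (auto simp: constant_on_def)
qed

text \<open>The value of the cofactor at 0 is what makes the zero of \<open>t\<close> at infinity simple and normalises \<open>t\<close>
  in the comparison with an eta quotient.\<close>
lemma lambert_factor:
  assumes a: "\<And>d. norm (a d) \<le> real d"
  obtains h where "h holomorphic_on ball 0 1" "\<And>x. lambert a x = x * h x" "h 0 = a 1"
proof -
  obtain h where h: "h holomorphic_on ball 0 1" "\<And>x. lambert a x = x * h x"
    using holomorphic_divide_identity[OF holomorphic_lambert[OF a] lambert_0] by blast
  have "(h \<longlongrightarrow> (\<Sum>d | d dvd Suc 0. a d)) (at 0)"
  proof (rule powser_limit_0_strong)
    fix x :: complex assume x: "x \<noteq> 0" "norm x < 1"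
    have "(\<lambda>n. (\<Sum>d | d dvd Suc n. a d) * x ^ Suc n) sums (x * h x)"
      using lambert_pairs(2)[OF a x(2)] h(2) by simp
    from sums_mult[OF this, of "1 / x"]
    show "(\<lambda>n. (\<Sum>d | d dvd Suc n. a d) * x ^ n) sums h x"
      using x(1) by (simp add: mult_ac)
  qed simp
  moreover have "isCont h 0"
    using holomorphic_on_imp_continuous_on[OF h(1)] by (simp add: continuous_on_eq_continuous_at)
  then have "(h \<longlongrightarrow> h 0) (at 0)" by (simp add: isCont_def)
  ultimately have "h 0 = (\<Sum>d | d dvd Suc 0. a d)"
    using tendsto_unique[of "at (0::complex)"] by auto
  with h that show ?thesis by simp
qed

section \<open>The Eisenstein series as eta quotients\<close>

text \<open>The two cases of the theorem. The level is \<open>p\<close>, the series \<open>E\<close> has weight \<open>w\<close>, the eta quotients to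
  be found are \<open>eta(p \<tau>)^(p e) / eta(\<tau>)^e\<close> and \<open>eta(\<tau>/p)^(p e) / eta(\<tau>)^e\<close>, and \<open>lam\<close> is the
  constant in the formula by which the inversion takes \<open>E(\<tau>)\<close> to \<open>E(\<tau>/p)\<close>. The number \<open>s\<close> satisfies \<open>r = s (p^w - 1)\<close>. The conditions on the
  coefficients say that \<open>E(\<tau>/p) - E(\<tau>)\<close> only involves powers \<open>q^(n/p)\<close> with \<open>n\<close> congruent to 1 modulo \<open>p\<close>.\<close>
locale level =
  fixes p w e :: nat and a :: "nat \<Rightarrow> complex" and r s lam :: complex and E :: "complex \<Rightarrow> complex"
  assumes params: "p = 2 \<and> w = 2 \<and> e = 4 \<and> r = 24 \<and> s = 8 \<or> p = 3 \<and> w = 1 \<and> e = 1 \<and> r = 6 \<and> s = 3"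
    and norm_lam: "norm lam ^ 2 = 1 / real p ^ w"
    and E_eq: "\<And>\<tau>. E \<tau> = 1 + r * lambert a (q_pow 1 \<tau>)"
    and a_bound: "\<And>d. norm (a d) \<le> real d"
    and a_1: "a 1 = 1"
    and coeff_p: "\<And>n. n > 0 \<Longrightarrow> (\<Sum>d | d dvd p * n. a d) = (\<Sum>d | d dvd n. a d)"
    and coeff_0: "\<And>n. n mod p \<noteq> 0 \<Longrightarrow> n mod p \<noteq> 1 \<Longrightarrow> (\<Sum>d | d dvd n. a d) = 0"
    and E_modular: "\<And>A \<tau>. A \<in> SL2Z \<Longrightarrow> int p dvd A$2$1 \<Longrightarrow> int p dvd A$2$2 - 1 \<Longrightarrow> \<tau> \<in> uhp \<Longrightarrow>
        E (moebius_act A \<tau>) = autom_factor A \<tau> ^ w * E \<tau>"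
    and E_inversion: "\<And>\<tau>. \<tau> \<in> uhp \<Longrightarrow> E (- 1 / \<tau>) = lam * \<tau> ^ w * E (\<tau> / of_nat p)"
begin

lemma p_pos: "p > 0" "real p > 0" "of_nat p \<noteq> (0 :: complex)" "s \<noteq> 0" "r \<noteq> 0"
  using params by auto

definition nome :: "complex \<Rightarrow> complex" where "nome = q_pow (1 / real p)"

definition zeta :: "int \<Rightarrow> complex" where "zeta n = exp2pi (of_int n / of_nat p)"

lemma norm_nome: "\<tau> \<in> uhp \<Longrightarrow> norm (nome \<tau>) < 1"
  using norm_q_pow_less_1[of "1 / real p" \<tau>] p_pos by (simp add: nome_def)

lemma nome_power_p: "nome \<tau> ^ p = q_pow 1 \<tau>"
  using q_pow_mult_nat[of p "1 / real p" \<tau>] p_pos by (simp add: nome_def)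

lemma q_pow_div_p: "q_pow 1 (\<tau> / of_nat p) = nome \<tau>"
  by (simp add: nome_def q_pow_def)

lemma nome_shift: "nome (\<tau> + of_int n) = zeta n * nome \<tau>"
  by (simp add: nome_def zeta_def q_pow_conv_exp2pi add_divide_distrib exp2pi_add)

lemma zeta_add: "zeta (m + n) = zeta m * zeta n"
  by (simp add: zeta_def add_divide_distrib exp2pi_add)

lemma zeta_nonzero [simp]: "zeta n \<noteq> 0"
  by (simp add: zeta_def)

lemma zeta_0 [simp]: "zeta 0 = 1"
  by (simp add: zeta_def exp2pi_def)

lemma zeta_minus: "zeta (- n) = 1 / zeta n"
  by (simp add: zeta_def exp2pi_minus)

lemma zeta_eq_1_iff: "zeta n = 1 \<longleftrightarrow> int p dvd n"
proof -
  have "zeta n = 1 \<longleftrightarrow> (\<exists>k. of_int n / of_nat p = (of_int k :: complex))"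
    by (auto simp: zeta_def exp2pi_eq_1_iff Ints_def)
  also have "\<dots> \<longleftrightarrow> (\<exists>k. of_int n = (of_int (int p * k) :: complex))"
    using p_pos by (simp add: field_simps)
  also have "\<dots> \<longleftrightarrow> int p dvd n" by (auto simp only: of_int_eq_iff dvd_def)
  finally show ?thesis .
qed

lemma norm_zeta [simp]: "norm (zeta n) = 1"
  by (simp add: zeta_def exp2pi_def Im_divide_of_nat)

lemma zeta_power_p: "zeta n ^ p = 1"
proof -
  have "zeta n ^ p = exp2pi (of_int n)"
    using p_pos by (simp add: zeta_def exp2pi_def exp_of_nat_mult [symmetric])
  then show ?thesis by simp
qed

definition t_disc :: "complex \<Rightarrow> complex" where "t_disc y = lambert a y - lambert a (y ^ p)"

definition t :: "complex \<Rightarrow> complex" where "t \<tau> = t_disc (nome \<tau>)"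

text \<open>This is \<open>b 0\<close> at \<open>\<tau> + j\<close>, see \<open>b_shift\<close>. The explicit formula depends on \<open>j\<close> only through a root of unity.\<close>
definition b :: "int \<Rightarrow> complex \<Rightarrow> complex" where "b j \<tau> = E \<tau> - s * zeta j * t \<tau>"

lemma t_disc_sums:
  assumes y: "norm y < 1"
  shows "(\<lambda>n. (if p dvd Suc n then 0 else (\<Sum>d | d dvd Suc n. a d)) * y ^ Suc n) sums t_disc y"
proof -
  let ?c = "\<lambda>n. \<Sum>d | d dvd n. a d"
  have yp: "norm (y ^ p) < 1" using y p_pos by (simp add: norm_power power_less_one_iff)
  have 1: "(\<lambda>n. ?c (Suc n) * y ^ Suc n) sums lambert a y"
    by (rule lambert_pairs(2)[OF a_bound y])
  have "(\<lambda>n. ?c (Suc n) * (y ^ p) ^ Suc n) sums lambert a (y ^ p)"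
    by (rule lambert_pairs(2)[OF a_bound yp])
  moreover have "?c (Suc n) * (y ^ p) ^ Suc n = ?c (p * Suc n) * y ^ (p * Suc n)" for n
    by (simp only: coeff_p zero_less_Suc power_mult)
  ultimately have "(\<lambda>n. ?c (p * Suc n) * y ^ (p * Suc n)) sums lambert a (y ^ p)" by simp
  also have "(\<lambda>n. ?c (p * Suc n) * y ^ (p * Suc n)) =
      (\<lambda>n. (\<lambda>n. if p dvd Suc n then ?c (Suc n) * y ^ Suc n else 0) (p * n + (p - 1)))"
  proof
    fix n
    \<comment> \<open>The series is indexed from exponent 1, so the exponent \<open>p (n + 1)\<close> sits at index \<open>p n + (p - 1)\<close>.\<close>
    have "Suc (p * n + (p - 1)) = p * Suc n" using p_pos by simp
    then show "?c (p * Suc n) * y ^ (p * Suc n) =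
      (\<lambda>n. if p dvd Suc n then ?c (Suc n) * y ^ Suc n else 0) (p * n + (p - 1))"
      by (simp only: dvd_triv_left if_True)
  qed
  finally have 2: "(\<lambda>n. (\<lambda>n. if p dvd Suc n then ?c (Suc n) * y ^ Suc n else 0) (p * n + (p - 1))) sums lambert a (y ^ p)" .
  have 2: "(\<lambda>n. if p dvd Suc n then ?c (Suc n) * y ^ Suc n else 0) sums lambert a (y ^ p)"
  proof (rule sums_mono_reindex[of "\<lambda>n. p * n + (p - 1)" "\<lambda>n. if p dvd Suc n then ?c (Suc n) * y ^ Suc n else 0", THEN iffD1, OF _ _ 2])
    show "strict_mono (\<lambda>n. p * n + (p - 1))"
    proof (rule strict_monoI)
      fix m n :: nat assume "m < n"
      then have "p * m < p * n" using p_pos by simp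
      then show "p * m + (p - 1) < p * n + (p - 1)" by linarith
    qed
    fix n assume n: "n \<notin> range (\<lambda>n. p * n + (p - 1))"
    show "(if p dvd Suc n then ?c (Suc n) * y ^ Suc n else 0) = 0"
    proof (rule ccontr)
      assume "(if p dvd Suc n then ?c (Suc n) * y ^ Suc n else 0) \<noteq> 0"
      then have "p dvd Suc n" by (auto split: if_splits)
      then obtain k where k: "Suc n = p * k" by (auto simp: dvd_def)
      then obtain l where "k = Suc l" by (cases k) auto
      with k have "n = p * l + (p - 1)" using p_pos by simp
      with n show False by auto
    qed
  qed
  from sums_diff[OF 1 2] show ?thesis
    unfolding t_disc_def by (rule sums_cong[THEN iffD1, rotated]) auto
qed

text \<open>All exponents with a nonzero coefficient are congruent to 1 modulo \<open>p\<close>.\<close>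
lemma t_disc_rotate:
  assumes y: "norm y < 1"
  shows "t_disc (zeta n * y) = zeta n * t_disc y"
proof -
  let ?c = "\<lambda>n. (if p dvd Suc n then 0 else (\<Sum>d | d dvd Suc n. a d))"
  have "(\<lambda>m. ?c m * (zeta n * y) ^ Suc m) sums t_disc (zeta n * y)"
    by (rule t_disc_sums) (use y in \<open>simp add: norm_mult\<close>)
  moreover have "?c m * (zeta n * y) ^ Suc m = zeta n * (?c m * y ^ Suc m)" for m
  proof (cases "?c m = 0")
    case False
    then have "Suc m mod p \<noteq> 0" using coeff_0[of "Suc m"] by (auto simp: dvd_eq_mod_eq_0 split: if_splits)
    moreover have "Suc m mod p = 0 \<or> Suc m mod p = 1" using False coeff_0[of "Suc m"] by (auto split: if_splits)
    ultimately have m1: "Suc m mod p = 1" by simp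
    have "zeta n ^ Suc m = zeta n ^ (p * (Suc m div p) + Suc m mod p)" by simp
    also have "\<dots> = zeta n"
      unfolding m1 power_add power_mult zeta_power_p by simp
    finally show ?thesis by (simp only: power_mult_distrib mult_ac)
  qed (simp del: power_Suc)
  ultimately have "(\<lambda>m. zeta n * (?c m * y ^ Suc m)) sums t_disc (zeta n * y)" by (simp only:)
  moreover have "(\<lambda>m. zeta n * (?c m * y ^ Suc m)) sums (zeta n * t_disc y)"
    by (intro sums_mult t_disc_sums y)
  ultimately show ?thesis by (rule sums_unique2)
qed

lemma t_shift: "\<tau> \<in> uhp \<Longrightarrow> t (\<tau> + of_int n) = zeta n * t \<tau>"
  unfolding t_def nome_shift by (rule t_disc_rotate[OF norm_nome])

lemma E_shift: "E (\<tau> + of_int n) = E \<tau>"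
proof -
  have "q_pow 1 (\<tau> + of_int n) = q_pow 1 \<tau>"
    by (simp add: q_pow_conv_exp2pi exp2pi_add)
  then show ?thesis by (simp add: E_eq)
qed

lemma b_shift: "\<tau> \<in> uhp \<Longrightarrow> b j (\<tau> + of_int n) = b (j + n) \<tau>"
  by (simp add: b_def E_shift t_shift zeta_add mult_ac)

lemma E_div_p: "E (\<tau> / of_nat p) = E \<tau> + r * t \<tau>"
  by (simp add: E_eq q_pow_div_p t_def t_disc_def nome_power_p algebra_simps)

lemma r_conv_s: "r = s * (of_nat p ^ w - 1)"
  using params by auto

text \<open>Inversion exchanges \<open>E(\<tau>)\<close> and \<open>E(\<tau>/p)\<close> up to factors. The number \<open>s\<close> in the definition of \<open>b\<close> was chosen
  to make \<open>b 0\<close> the image of \<open>t\<close>.\<close>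
lemma t_inversion:
  assumes \<tau>: "\<tau> \<in> uhp"
  shows "t (- 1 / \<tau>) = lam / s * \<tau> ^ w * b 0 \<tau>"
proof -
  have p\<tau>: "of_nat p * \<tau> \<in> uhp" using scale_uhp(1)[OF \<tau>] p_pos by simp
  have "E (- 1 / \<tau>) + r * t (- 1 / \<tau>) = E ((- 1 / \<tau>) / of_nat p)"
    by (rule E_div_p[symmetric])
  also have "(- 1 / \<tau>) / of_nat p = - 1 / (of_nat p * \<tau>)" by simp
  also have "E \<dots> = lam * (of_nat p * \<tau>) ^ w * E \<tau>"
    using E_inversion[OF p\<tau>] p_pos by simp
  finally have "r * t (- 1 / \<tau>) = lam * \<tau> ^ w * (of_nat p ^ w * E \<tau> - (E \<tau> + r * t \<tau>))"
    unfolding E_inversion[OF \<tau>] E_div_p by (simp add: power_mult_distrib algebra_simps)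
  also have "of_nat p ^ w * E \<tau> - (E \<tau> + r * t \<tau>) = (of_nat p ^ w - 1) * b 0 \<tau>"
    by (simp add: b_def r_conv_s algebra_simps)
  finally have "s * (of_nat p ^ w - 1) * t (- 1 / \<tau>) = lam * \<tau> ^ w * ((of_nat p ^ w - 1) * b 0 \<tau>)"
    by (simp only: r_conv_s)
  then have "(of_nat p ^ w - 1) * (s * t (- 1 / \<tau>)) = (of_nat p ^ w - 1) * (lam * \<tau> ^ w * b 0 \<tau>)"
    by (simp only: mult_ac)
  moreover have "of_nat p ^ w - 1 \<noteq> (0 :: complex)" using p_pos(5) by (simp add: r_conv_s)
  ultimately have "s * t (- 1 / \<tau>) = lam * \<tau> ^ w * b 0 \<tau>" using mult_left_cancel by blast
  then have "s * t (- 1 / \<tau>) / s = lam * \<tau> ^ w * b 0 \<tau> / s" by (simp only:)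
  then show ?thesis using p_pos(4) by simp
qed

text \<open>This arithmetic relation between the constants, which is special to \<open>p = 2\<close> and \<open>p = 3\<close>, lets the
  inversion permute the functions \<open>b j\<close>.\<close>
lemma primitive_root_sums:
  assumes "\<not> int p dvd j"
  shows "r = s * (1 - zeta j - zeta (- j))" "1 - (zeta j + zeta (- j)) + 1 = of_nat p ^ w"
proof -
  define z where "z = zeta j"
  have z: "z \<noteq> 1" "z \<noteq> 0" "z ^ p = 1" "zeta (- j) = 1 / z"
    using assms zeta_eq_1_iff[of j] zeta_power_p[of j] by (auto simp: z_def zeta_minus)
  have "z + 1 / z = 2 - of_nat p ^ w"
    using params
  proof (elim disjE conjE)
    assume p: "p = 2" "w = 2"
    then have "z ^ 2 = 1" using z by simp
    then have "z = - 1" using z by (simp add: power2_eq_1_iff)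
    then show ?thesis using p by simp
  next
    assume p: "p = 3" "w = 1"
    then have "(z - 1) * (z ^ 2 + z + 1) = 0"
      using z(3) by (simp add: algebra_simps power2_eq_square power3_eq_cube)
    then have "z ^ 2 + z + 1 = 0" using z by simp
    moreover have "z + 1 / z = (z ^ 2 + z + 1) / z - 1"
      using z by (simp add: field_simps power2_eq_square)
    ultimately show ?thesis using p by simp
  qed
  then have *: "zeta j + zeta (- j) = 2 - of_nat p ^ w" by (simp add: z z_def)
  show "1 - (zeta j + zeta (- j)) + 1 = of_nat p ^ w" unfolding * by simp
  have "s * (1 - zeta j - zeta (- j)) = s * (1 - (zeta j + zeta (- j)))" by (simp add: algebra_simps)
  also have "\<dots> = r" unfolding * by (simp add: r_conv_s algebra_simps)
  finally show "r = s * (1 - zeta j - zeta (- j))" ..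
qed

lemma b_inversion:
  assumes \<tau>: "\<tau> \<in> uhp" and j: "\<not> int p dvd j"
  shows "b j (- 1 / \<tau>) = lam * (1 - zeta j) * \<tau> ^ w * b (- j) \<tau>"
proof -
  have "b j (- 1 / \<tau>) = lam * \<tau> ^ w * (E \<tau> + r * t \<tau> - zeta j * b 0 \<tau>)"
    unfolding b_def[of j] t_inversion[OF \<tau>] E_inversion[OF \<tau>] E_div_p using p_pos by (simp add: field_simps)
  also have "E \<tau> + r * t \<tau> - zeta j * b 0 \<tau> = (1 - zeta j) * E \<tau> + (r + s * zeta j) * t \<tau>"
    by (simp add: b_def algebra_simps)
  also have "r + s * zeta j = - (1 - zeta j) * (s * zeta (- j))"
    by (subst primitive_root_sums(1)[OF j]) (simp add: zeta_minus field_simps)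
  also have "(1 - zeta j) * E \<tau> + - (1 - zeta j) * (s * zeta (- j)) * t \<tau> = (1 - zeta j) * b (- j) \<tau>"
    by (simp add: b_def algebra_simps)
  finally show ?thesis by simp
qed

lemma norm_b_inversion_factor:
  assumes j: "\<not> int p dvd j"
  shows "norm (lam * (1 - zeta j)) = 1"
proof -
  have cnj: "cnj (zeta j) = zeta (- j)"
    using complex_norm_square[of "zeta j"] by (simp add: zeta_minus field_simps)
  have zz: "zeta j * zeta (- j) = 1" by (simp add: zeta_minus)
  have "complex_of_real (norm (1 - zeta j) ^ 2) = (1 - zeta j) * (1 - zeta (- j))"
    using complex_norm_square[of "1 - zeta j"] by (simp add: cnj)
  also have "\<dots> = 1 - (zeta j + zeta (- j)) + 1"
    using zz by (simp add: algebra_simps)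
  also have "\<dots> = complex_of_real (real p ^ w)" unfolding primitive_root_sums(2)[OF j] by simp
  finally have "norm (1 - zeta j) ^ 2 = real p ^ w" by (simp only: of_real_eq_iff)
  then have "norm (lam * (1 - zeta j)) ^ 2 = 1"
    using p_pos by (simp add: norm_mult power_mult_distrib norm_lam)
  then show ?thesis using power2_eq_imp_eq[of "norm (lam * (1 - zeta j))" 1] by simp
qed

end

context level
begin

definition quot_top :: "complex \<Rightarrow> complex" where "quot_top \<tau> = eta (of_nat p * \<tau>) ^ (p * e) / eta \<tau> ^ e"
definition quot_bot :: "complex \<Rightarrow> complex" where "quot_bot \<tau> = eta (\<tau> / of_nat p) ^ (p * e) / eta \<tau> ^ e"

definition quot_top_disc :: "complex \<Rightarrow> complex" where
  "quot_top_disc y = euler_phi ((y ^ p) ^ p) ^ (p * e) / euler_phi (y ^ p) ^ e"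
definition quot_bot_disc :: "complex \<Rightarrow> complex" where
  "quot_bot_disc y = euler_phi y ^ (p * e) / euler_phi (y ^ p) ^ e"

lemma norm_power_less_1: "norm y < 1 \<Longrightarrow> norm ((y::complex) ^ p) < 1"
  using p_pos by (simp add: norm_power power_less_one_iff)

text \<open>The exponents satisfy \<open>e p (p^2 - 1) = 24\<close>, so the powers of \<open>q^(1/24)\<close> combine to \<open>q^(1/p)\<close>.\<close>
lemma top_conv_disc: "quot_top \<tau> = nome \<tau> * quot_top_disc (nome \<tau>)"
proof -
  define u where "u = q_pow (1 / 24) \<tau>"
  have 1: "q_pow (1 / 24) (of_nat p * \<tau>) = u ^ p" "q_pow 1 (of_nat p * \<tau>) = q_pow 1 \<tau> ^ p"
    by (simp_all only: u_def q_pow_of_nat_mult nome_power_p)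
  have "(u ^ p) ^ (p * e) / u ^ e = nome \<tau>"
  proof -
    have u0: "u \<noteq> 0" by (simp add: u_def)
    have le: "e \<le> p * (p * e)" using p_pos by (metis le_square mult.assoc nat_mult_le_cancel_disj mult.commute mult_le_mono2 le_trans mult_1 Suc_leI One_nat_def)
    have "(u ^ p) ^ (p * e) / u ^ e = u ^ (p * (p * e) - e)"
      unfolding power_mult[symmetric] using u0 le by (simp add: power_diff)
    also have "\<dots> = q_pow (real (p * (p * e) - e) * (1 / 24)) \<tau>"
      by (simp only: q_pow_mult_nat u_def)
    also have "real (p * (p * e) - e) * (1 / 24) = 1 / real p"
      using params by auto
    finally show ?thesis by (simp add: nome_def)
  qed
  then show ?thesis
    unfolding quot_top_def quot_top_disc_def eta_conv_euler_phi 1 nome_power_p u_def[symmetric]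
    by (simp only: power_mult_distrib times_divide_times_eq[symmetric])
qed

lemma bot_conv_disc: "quot_bot \<tau> = quot_bot_disc (nome \<tau>)"
proof -
  define v where "v = q_pow (1 / 24) (\<tau> / of_nat p)"
  have "of_nat p * (\<tau> / of_nat p) = \<tau>" using p_pos by simp
  then have 1: "q_pow (1 / 24) \<tau> = v ^ p"
    using q_pow_of_nat_mult[of "1 / 24" p "\<tau> / of_nat p"] by (simp add: v_def)
  have "v ^ (p * e) / (v ^ p) ^ e = 1"
    unfolding power_mult[symmetric] by (simp add: v_def)
  then show ?thesis
    unfolding quot_bot_def quot_bot_disc_def eta_conv_euler_phi q_pow_div_p 1 v_def[symmetric] nome_power_p
    by (simp only: power_mult_distrib times_divide_times_eq[symmetric] mult_1_left)
qed

lemma holomorphic_power_comp: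
  assumes "f holomorphic_on ball 0 1"
  shows "(\<lambda>y. f (y ^ p)) holomorphic_on ball 0 1"
proof -
  have "(\<lambda>y::complex. y ^ p) ` ball 0 1 \<subseteq> ball 0 1" using norm_power_less_1 by auto
  then show ?thesis
    using holomorphic_on_compose_gen[of "\<lambda>y. y ^ p" "ball 0 1" f "ball 0 1"] assms
    by (simp add: o_def holomorphic_intros)
qed

lemma holomorphic_top_bot_disc:
  "quot_top_disc holomorphic_on ball 0 1" "quot_bot_disc holomorphic_on ball 0 1"
proof -
  have 1: "(\<lambda>y. euler_phi (y ^ p)) holomorphic_on ball 0 1"
    by (rule holomorphic_power_comp[OF holomorphic_euler_phi])
  have 2: "(\<lambda>y. euler_phi ((y ^ p) ^ p)) holomorphic_on ball 0 1"
    by (rule holomorphic_power_comp[OF 1])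
  have 3: "euler_phi (y ^ p) \<noteq> 0" if "y \<in> ball 0 1" for y
    using that by (intro euler_phi_nonzero norm_power_less_1) auto
  show "quot_top_disc holomorphic_on ball 0 1" "quot_bot_disc holomorphic_on ball 0 1"
    unfolding quot_top_disc_def quot_bot_disc_def
    using 3 by (intro holomorphic_intros 1 2 holomorphic_euler_phi; simp)+
qed

lemma top_bot_disc_nonzero:
  assumes "norm y < 1"
  shows "quot_top_disc y \<noteq> 0" "quot_bot_disc y \<noteq> 0"
  using assms norm_power_less_1[OF assms] norm_power_less_1[OF norm_power_less_1[OF assms]]
  by (simp_all add: quot_top_disc_def quot_bot_disc_def euler_phi_nonzero)

lemma top_bot_disc_0: "quot_top_disc 0 = 1" "quot_bot_disc 0 = 1"
  using p_pos by (simp_all add: quot_top_disc_def quot_bot_disc_def power_0_left)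

lemma top_bot_nonzero:
  assumes "\<tau> \<in> uhp"
  shows "quot_top \<tau> \<noteq> 0" "quot_bot \<tau> \<noteq> 0"
  using top_bot_disc_nonzero[OF norm_nome[OF assms]] by (auto simp: top_conv_disc bot_conv_disc nome_def)

lemma exponent_eq: "p * e = e + 2 * w"
  using params by auto

lemma norm_top_inversion:
  assumes \<tau>: "\<tau> \<in> uhp"
  shows "norm (quot_top (- 1 / \<tau>)) = norm (lam / s) * norm \<tau> ^ w * norm (quot_bot \<tau>)"
proof -
  have \<tau>p: "\<tau> / of_nat p \<in> uhp" using scale_uhp(2)[OF \<tau>] p_pos by simp
  have nz: "norm \<tau> \<noteq> 0" "norm (eta \<tau>) \<noteq> 0" using uhp_nonzero[OF \<tau>] eta_nonzero[OF \<tau>] by auto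
  have e1: "of_nat p * (- 1 / \<tau>) = - 1 / (\<tau> / of_nat p)" by simp
  have "norm (quot_top (- 1 / \<tau>)) ^ 2 = (norm (eta (- 1 / (\<tau> / of_nat p))) ^ 2) ^ (p * e) / (norm (eta (- 1 / \<tau>)) ^ 2) ^ e"
    unfolding quot_top_def e1 norm_divide norm_power power_divide
    by (simp only: power_mult[symmetric] mult.commute[of _ 2])
  also have "\<dots> = (norm \<tau> / real p * norm (eta (\<tau> / of_nat p)) ^ 2) ^ (p * e) / (norm \<tau> * norm (eta \<tau>) ^ 2) ^ e"
    unfolding eta_inversion[OF \<tau>] eta_inversion[OF \<tau>p] by (simp add: norm_divide)
  also have "\<dots> = (norm \<tau> ^ (p * e) / norm \<tau> ^ e) / real p ^ (p * e) * ((norm (eta (\<tau> / of_nat p)) ^ 2) ^ (p * e) / (norm (eta \<tau>) ^ 2) ^ e)"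
    by (simp add: power_mult_distrib power_divide)
  also have "norm \<tau> ^ (p * e) / norm \<tau> ^ e = (norm \<tau> ^ w) ^ 2"
    unfolding exponent_eq using nz by (simp add: power_add power_mult mult.commute flip: power_mult)
  also have "real p ^ (p * e) = real p ^ w * norm s ^ 2"
    using params by auto
  also have "(norm (eta (\<tau> / of_nat p)) ^ 2) ^ (p * e) / (norm (eta \<tau>) ^ 2) ^ e = norm (quot_bot \<tau>) ^ 2"
    unfolding quot_bot_def norm_divide norm_power power_divide
    by (simp only: power_mult[symmetric] mult.commute[of _ 2])
  also have "(norm \<tau> ^ w) ^ 2 / (real p ^ w * norm s ^ 2) * norm (quot_bot \<tau>) ^ 2 =
      (norm (lam / s) * norm \<tau> ^ w * norm (quot_bot \<tau>)) ^ 2"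
    by (simp add: power_mult_distrib norm_divide power_divide norm_lam)
  finally show ?thesis
    by (subst (asm) power2_eq_iff_nonneg) auto
qed

text \<open>With \<open>u = (\<tau> - j) / p\<close> and \<open>j^2 = 1\<close>, the argument \<open>(-1/\<tau> + j) / p\<close> is \<open>u / (j p u + 1)\<close>.\<close>
lemma norm_bot_inversion:
  assumes \<tau>: "\<tau> \<in> uhp" and j: "j = 1 \<or> j = - 1"
  shows "norm (quot_bot (- 1 / \<tau> + of_int j)) = norm \<tau> ^ w * norm (quot_bot (\<tau> + of_int (- j)))"
proof -
  define u where "u = (\<tau> - of_int j) / of_nat p"
  have nz: "\<tau> \<noteq> 0" "norm \<tau> \<noteq> 0" using uhp_nonzero[OF \<tau>] by auto
  have u: "u \<in> uhp" using \<tau> p_pos by (simp add: u_def uhp_def)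
  have jj: "of_int j * of_int j = (1 :: complex)" "norm (of_int j :: complex) = 1" using j by auto
  have mu: "of_int (j * int p) * u + 1 = of_int j * \<tau>"
  proof -
    have pu: "of_nat p * u = \<tau> - of_int j" using p_pos by (simp add: u_def)
    have "of_int (j * int p) * u + 1 = of_int j * (of_nat p * u) + 1" by simp
    also have "\<dots> = of_int j * \<tau>" unfolding pu by (simp add: right_diff_distrib jj)
    finally show ?thesis .
  qed
  have "u / (of_int j * \<tau>) = (- 1 / \<tau> + of_int j) / of_nat p"
    using j nz p_pos by (auto simp: u_def field_simps)
  then have A: "norm (eta ((- 1 / \<tau> + of_int j) / of_nat p)) ^ 2 = norm \<tau> * norm (eta u) ^ 2"
    using eta_lower_unipotent[OF u, of "j * int p"] jj unfolding mu by (simp add: norm_mult)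
  have "norm (quot_bot (- 1 / \<tau> + of_int j)) ^ 2 =
      (norm (eta ((- 1 / \<tau> + of_int j) / of_nat p)) ^ 2) ^ (p * e) / (norm (eta (- 1 / \<tau>)) ^ 2) ^ e"
    unfolding quot_bot_def norm_divide norm_power power_divide norm_eta_add_int
    by (simp only: power_mult[symmetric] mult.commute[of _ 2])
  also have "\<dots> = (norm \<tau> ^ (p * e) / norm \<tau> ^ e) * ((norm (eta u) ^ 2) ^ (p * e) / (norm (eta \<tau>) ^ 2) ^ e)"
    unfolding A eta_inversion[OF \<tau>] by (simp add: power_mult_distrib)
  also have "norm \<tau> ^ (p * e) / norm \<tau> ^ e = (norm \<tau> ^ w) ^ 2"
    unfolding exponent_eq using nz by (simp add: power_add power_mult mult.commute flip: power_mult)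
  also have "(norm (eta u) ^ 2) ^ (p * e) / (norm (eta \<tau>) ^ 2) ^ e = norm (quot_bot (\<tau> + of_int (- j))) ^ 2"
    unfolding quot_bot_def norm_divide norm_power power_divide norm_eta_add_int
    by (simp add: u_def power_mult[symmetric] mult.commute[of _ 2])
  finally have "norm (quot_bot (- 1 / \<tau> + of_int j)) ^ 2 = (norm \<tau> ^ w * norm (quot_bot (\<tau> + of_int (- j)))) ^ 2"
    by (simp only: power_mult_distrib)
  then show ?thesis
    by (subst (asm) power2_eq_iff_nonneg) auto
qed

lemma norm_top_shift: "norm (quot_top (\<tau> + of_int n)) = norm (quot_top \<tau>)"
proof -
  have "of_nat p * (\<tau> + of_int n) = of_nat p * \<tau> + of_int (int p * n)" by (simp add: algebra_simps)
  then show ?thesis by (simp add: quot_top_def norm_divide norm_power norm_eta_add_int del: of_int_mult)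
qed

definition Rtop :: "complex \<Rightarrow> complex" where "Rtop \<tau> = t \<tau> / quot_top \<tau>"
definition Rbot :: "int \<Rightarrow> complex \<Rightarrow> complex" where "Rbot j \<tau> = b j \<tau> / quot_bot (\<tau> + of_int j)"

lemma Rbot_shift: "\<tau> \<in> uhp \<Longrightarrow> Rbot j (\<tau> + of_int n) = Rbot (j + n) \<tau>"
  by (simp add: Rbot_def b_shift add_ac)

lemma zeta_cong: "int p dvd i - j \<Longrightarrow> zeta i = zeta j"
  using zeta_add[of "i - j" j] zeta_eq_1_iff[of "i - j"] by simp

lemma Rbot_cong: "int p dvd i - j \<Longrightarrow> Rbot i \<tau> = Rbot j \<tau>"
  using zeta_cong[of i j] by (simp add: Rbot_def b_def bot_conv_disc nome_shift)

lemma norm_Rtop_shift: "\<tau> \<in> uhp \<Longrightarrow> norm (Rtop (\<tau> + of_int n)) = norm (Rtop \<tau>)"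
  by (simp add: Rtop_def norm_divide norm_top_shift t_shift norm_mult)

lemma lam_nonzero: "lam \<noteq> 0"
  using norm_lam p_pos by auto

lemma norm_Rtop_inversion:
  assumes \<tau>: "\<tau> \<in> uhp"
  shows "norm (Rtop (- 1 / \<tau>)) = norm (Rbot 0 \<tau>)" "norm (Rbot 0 (- 1 / \<tau>)) = norm (Rtop \<tau>)"
proof -
  have *: "norm (Rtop (- 1 / \<tau>)) = norm (Rbot 0 \<tau>)" if \<tau>: "\<tau> \<in> uhp" for \<tau>
    using uhp_nonzero[OF \<tau>] lam_nonzero p_pos
    unfolding Rtop_def norm_divide norm_top_inversion[OF \<tau>] t_inversion[OF \<tau>] Rbot_def
    by (simp add: norm_mult norm_divide norm_power)
  show "norm (Rtop (- 1 / \<tau>)) = norm (Rbot 0 \<tau>)" by (rule *[OF \<tau>])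
  from *[OF minus_inverse_uhp[OF \<tau>]] show "norm (Rbot 0 (- 1 / \<tau>)) = norm (Rtop \<tau>)" by simp
qed

lemma norm_Rbot_inversion:
  assumes \<tau>: "\<tau> \<in> uhp" and j: "j = 1 \<or> j = - 1"
  shows "norm (Rbot j (- 1 / \<tau>)) = norm (Rbot (- j) \<tau>)"
proof -
  have ndvd: "\<not> int p dvd j" using j params by auto
  have "norm (b j (- 1 / \<tau>)) = norm (lam * (1 - zeta j)) * norm \<tau> ^ w * norm (b (- j) \<tau>)"
    unfolding b_inversion[OF \<tau> ndvd] by (simp add: norm_mult norm_power)
  then have nb: "norm (b j (- 1 / \<tau>)) = norm \<tau> ^ w * norm (b (- j) \<tau>)"
    unfolding norm_b_inversion_factor[OF ndvd] by simp
  show ?thesis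
    unfolding Rbot_def norm_divide norm_bot_inversion[OF \<tau> j] nb using uhp_nonzero[OF \<tau>] by simp
qed

lemma t_factor:
  obtains h where "h holomorphic_on ball 0 1" "\<And>y. t_disc y = y * h y" "h 0 = 1"
proof -
  obtain l where l: "l holomorphic_on ball 0 1" "\<And>x. lambert a x = x * l x" "l 0 = a 1"
    using lambert_factor[OF a_bound] by blast
  show ?thesis
  proof (rule that[of "\<lambda>y. l y - y ^ (p - 1) * l (y ^ p)"])
    show "(\<lambda>y. l y - y ^ (p - 1) * l (y ^ p)) holomorphic_on ball 0 1"
      by (intro holomorphic_intros l(1) holomorphic_power_comp)
    show "t_disc y = y * (l y - y ^ (p - 1) * l (y ^ p))" for y
    proof -
      have "y ^ p = y * y ^ (p - 1)" using p_pos by (metis power_eq_if not_gr_zero)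
      then show ?thesis by (simp add: t_disc_def l(2) algebra_simps)
    qed
    show "l 0 - 0 ^ (p - 1) * l (0 ^ p) = 1"
      using params l(3) a_1 by auto
  qed
qed

lemma Rtop_disc:
  obtains g where "g holomorphic_on ball 0 1" "\<And>\<tau>. \<tau> \<in> uhp \<Longrightarrow> Rtop \<tau> = g (nome \<tau>)" "g 0 = 1"
proof -
  obtain h where h: "h holomorphic_on ball 0 1" "\<And>y. t_disc y = y * h y" "h 0 = 1"
    using t_factor by blast
  show ?thesis
  proof (rule that[of "\<lambda>y. h y / quot_top_disc y"])
    show "(\<lambda>y. h y / quot_top_disc y) holomorphic_on ball 0 1"
      by (intro holomorphic_intros h(1) holomorphic_top_bot_disc) (use top_bot_disc_nonzero in auto)
  qed (auto simp: Rtop_def t_def top_conv_disc h top_bot_disc_0, simp add: nome_def)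
qed

definition b_disc :: "int \<Rightarrow> complex \<Rightarrow> complex" where
  "b_disc j y = 1 + r * lambert a (y ^ p) - s * zeta j * t_disc y"

lemma b_conv_disc: "b j \<tau> = b_disc j (nome \<tau>)"
  by (simp add: b_def b_disc_def E_eq nome_power_p t_def)

lemma holomorphic_t_b_disc:
  "t_disc holomorphic_on ball 0 1" "b_disc j holomorphic_on ball 0 1"
proof -
  have 1: "lambert a holomorphic_on ball 0 1" by (rule holomorphic_lambert[OF a_bound])
  show *: "t_disc holomorphic_on ball 0 1"
    unfolding t_disc_def by (intro holomorphic_intros 1 holomorphic_power_comp)
  show "b_disc j holomorphic_on ball 0 1"
    unfolding b_disc_def by (intro holomorphic_intros 1 holomorphic_power_comp *)
qed

lemma Rbot_disc:
  obtains g where "g holomorphic_on ball 0 1" "\<And>\<tau>. \<tau> \<in> uhp \<Longrightarrow> Rbot j \<tau> = g (nome \<tau>)" "g 0 = 1"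
proof (rule that[of "\<lambda>y. b_disc j y / quot_bot_disc (zeta j * y)"])
  have "(\<lambda>y. zeta j * y) ` ball 0 1 \<subseteq> ball 0 1" by (auto simp: norm_mult)
  then have "(\<lambda>y. quot_bot_disc (zeta j * y)) holomorphic_on ball 0 1"
    using holomorphic_on_compose_gen[of "\<lambda>y. zeta j * y" "ball 0 1" quot_bot_disc "ball 0 1"] holomorphic_top_bot_disc(2)
    by (simp add: o_def holomorphic_intros)
  then show "(\<lambda>y. b_disc j y / quot_bot_disc (zeta j * y)) holomorphic_on ball 0 1"
    by (intro holomorphic_intros holomorphic_t_b_disc) (use top_bot_disc_nonzero in \<open>auto simp: norm_mult\<close>)
  show "b_disc j 0 / quot_bot_disc (zeta j * 0) = 1"
    using p_pos by (simp add: b_disc_def top_bot_disc_0 t_disc_def power_0_left)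
qed (simp add: Rbot_def b_conv_disc bot_conv_disc nome_shift)

lemma holo_Rtop: "holo_at_infinity p Rtop"
  unfolding holo_at_infinity_def using Rtop_disc unfolding nome_def by metis

lemma holo_Rbot: "holo_at_infinity p (Rbot j)"
  unfolding holo_at_infinity_def using Rbot_disc[of j] unfolding nome_def by metis

lemma residue_representative: obtains k where "k \<in> {0, 1, - 1}" "int p dvd n - k"
proof -
  have "\<exists>k\<in>{0, 1, - 1}. int p dvd n - k" using params
  proof (elim disjE conjE)
    assume "p = 2" then show ?thesis by (simp, presburger?)
  next
    assume "p = 3" then show ?thesis by (simp, presburger?)
  qed
  with that show ?thesis by blast
qed

text \<open>The maximum principle only makes one member of the family constant. Its modulus then passes on to
  the others through the inversion and the translations, and a holomorphic function of constant
  modulus is constant.\<close>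
theorem Rtop_Rbot_eq_1:
  assumes \<tau>: "\<tau> \<in> uhp"
  shows "Rtop \<tau> = 1" "Rbot j \<tau> = 1"
proof -
  define F where "F = {Rtop, Rbot 0, Rbot 1, Rbot (- 1)}"
  have "\<exists>f\<in>F. f constant_on uhp"
  proof (rule max_principle_family[OF p_pos(1)])
    show "finite F" "F \<noteq> {}" by (auto simp: F_def)
    show "holo_at_infinity p f" if "f \<in> F" for f
      using that holo_Rtop holo_Rbot by (auto simp: F_def)
    show "\<exists>g\<in>F. \<forall>\<tau>\<in>uhp. norm (f (\<tau> + of_int n)) = norm (g \<tau>)" if "f \<in> F" for f n
    proof -
      have "\<exists>g\<in>F. \<forall>\<tau>\<in>uhp. norm (Rbot j (\<tau> + of_int n)) = norm (g \<tau>)" for j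
      proof -
        obtain k where "k \<in> {0, 1, - 1}" "int p dvd (j + n) - k" by (rule residue_representative)
        then have "Rbot k \<in> F" "\<forall>\<tau>\<in>uhp. norm (Rbot j (\<tau> + of_int n)) = norm (Rbot k \<tau>)"
          using Rbot_cong by (auto simp: F_def Rbot_shift)
        then show ?thesis by blast
      qed
      moreover have "Rtop \<in> F" by (simp add: F_def)
      ultimately show ?thesis using that norm_Rtop_shift unfolding F_def by blast
    qed
    show "\<exists>g\<in>F. \<forall>\<tau>\<in>uhp. norm (f (- 1 / \<tau>)) = norm (g \<tau>)" if "f \<in> F" for f
    proof -
      from that consider "f = Rtop" | "f = Rbot 0" | "f = Rbot 1" | "f = Rbot (- 1)" by (auto simp: F_def)
      then show ?thesis
    proof cases
      assume "f = Rtop" then show ?thesis using norm_Rtop_inversion(1) unfolding F_def by blast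
    next
      assume "f = Rbot 0" then show ?thesis using norm_Rtop_inversion(2) unfolding F_def by blast
    next
      assume "f = Rbot 1" then show ?thesis using norm_Rbot_inversion[of _ 1] unfolding F_def by auto
    next
      assume "f = Rbot (- 1)" then show ?thesis using norm_Rbot_inversion[of _ "- 1"] unfolding F_def by auto
    qed
    qed
  qed
  then obtain f c where f: "f \<in> F" "\<And>\<tau>. \<tau> \<in> uhp \<Longrightarrow> f \<tau> = c" by (auto simp: constant_on_def)
  have nb: "norm (Rbot 0 \<tau>) = norm c" if \<tau>: "\<tau> \<in> uhp" for \<tau>
  proof (cases "f = Rtop")
    case True
    then show ?thesis using norm_Rtop_inversion(1)[OF \<tau>] f(2)[OF minus_inverse_uhp[OF \<tau>]] by simp
  next
    case False
    with f(1) obtain k where k: "f = Rbot k" by (auto simp: F_def)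
    have "\<tau> + of_int (- k) \<in> uhp" using \<tau> by (simp add: uhp_def)
    from f(2)[OF this] Rbot_shift[OF \<tau>, of k "- k"] k show ?thesis by simp
  qed
  have nt: "norm (Rtop \<tau>) = norm c" if \<tau>: "\<tau> \<in> uhp" for \<tau>
    using norm_Rtop_inversion(2)[OF \<tau>] nb[OF minus_inverse_uhp[OF \<tau>]] by simp
  have one: "g \<tau> = 1" if hol: "holo_at_infinity p g" and n: "\<And>\<tau>. \<tau> \<in> uhp \<Longrightarrow> norm (g \<tau>) = norm c"
    and G: "G holomorphic_on ball 0 1" "\<And>\<tau>. \<tau> \<in> uhp \<Longrightarrow> g \<tau> = G (nome \<tau>)" "G 0 = 1" and \<tau>: "\<tau> \<in> uhp" for g G \<tau>
  proof -
    obtain k where k: "\<And>\<tau>. \<tau> \<in> uhp \<Longrightarrow> g \<tau> = k"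
      using constant_norm_imp_constant[OF holo_at_infinity_imp_holomorphic[OF hol p_pos(1)] n] by metis
    have "G 0 = k"
      by (rule constant_at_infinity[OF G(1) p_pos(1)]) (use G(2) k in \<open>simp add: nome_def\<close>)
    with G(3) k[OF \<tau>] show ?thesis by simp
  qed
  show "Rtop \<tau> = 1"
    by (rule Rtop_disc, rule one[OF holo_Rtop nt _ _ _ \<tau>])
  have 0: "Rbot 0 \<tau> = 1" if "\<tau> \<in> uhp" for \<tau>
    by (rule Rbot_disc[of 0], rule one[OF holo_Rbot nb _ _ _ that])
  have "\<tau> + of_int j \<in> uhp" using \<tau> by (simp add: uhp_def)
  from 0[OF this] Rbot_shift[OF \<tau>, of 0 j] show "Rbot j \<tau> = 1" by simp
qed

corollary t_eq_top: "\<tau> \<in> uhp \<Longrightarrow> t \<tau> = quot_top \<tau>"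
  using Rtop_Rbot_eq_1(1)[of \<tau>] top_bot_nonzero[of \<tau>] by (simp add: Rtop_def)

corollary b_eq_bot: "\<tau> \<in> uhp \<Longrightarrow> b j \<tau> = quot_bot (\<tau> + of_int j)"
  using Rtop_Rbot_eq_1(2)[of \<tau> j] top_bot_nonzero(2)[of "\<tau> + of_int j"] by (auto simp: Rbot_def uhp_def divide_eq_1_iff)

end

section \<open>The cusps of \<open>Gamma 2\<close> and \<open>Gamma 3\<close>\<close>

lemma sign_representative:
  assumes p: "p = 2 \<or> p = (3::nat)" and a: "\<not> int p dvd a"
  obtains \<epsilon> :: int where "\<epsilon> * \<epsilon> = 1" "int p dvd a - \<epsilon>"
proof -
  have "int p dvd a - 1 \<or> int p dvd a - (- 1)"
    using p a by (elim disjE; simp; presburger)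
  then show ?thesis using that[of 1] that[of "- 1"] by auto
qed

lemma Gamma_iff:
  "A \<in> Gamma N \<longleftrightarrow> A \<in> SL2Z \<and> int N dvd A$1$1 - 1 \<and> int N dvd A$1$2 \<and> int N dvd A$2$1 \<and> int N dvd A$2$2 - 1"
  by (auto simp: Gamma_def forall_2 mat_def cong_iff_dvd_diff)

definition mat2 :: "int \<Rightarrow> int \<Rightarrow> int \<Rightarrow> int \<Rightarrow> int ^ 2 ^ 2" where
  "mat2 a b c d = vector [vector [a, b], vector [c, d]]"

lemma mat2_entries [simp]:
  "mat2 a b c d $1$1 = a" "mat2 a b c d $1$2 = b" "mat2 a b c d $2$1 = c" "mat2 a b c d $2$2 = d"
  by (simp_all add: mat2_def)

text \<open>The Bruhat decomposition of \<open>SL2Z\<close> modulo \<open>p\<close>, where the units are \<open>\<plusminus>1\<close>. The first case describes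
  the cusps equivalent to infinity, the second one all the others.\<close>
lemma SL2Z_decomposition:
  assumes p: "p = 2 \<or> p = (3::nat)" and A: "A \<in> SL2Z"
  obtains (cusp_infinity) \<gamma> \<epsilon> j where "\<gamma> \<in> Gamma p" "\<epsilon> * \<epsilon> = (1::int)"
      "\<And>\<tau>. \<tau> \<in> uhp \<Longrightarrow> moebius_act A \<tau> = moebius_act \<gamma> (\<tau> + of_int j)"
      "\<And>\<tau>. \<tau> \<in> uhp \<Longrightarrow> autom_factor A \<tau> = of_int \<epsilon> * autom_factor \<gamma> (\<tau> + of_int j)"
  | (other_cusp) \<gamma> \<epsilon> i j where "\<gamma> \<in> Gamma p" "\<epsilon> * \<epsilon> = (1::int)"
      "\<And>\<tau>. \<tau> \<in> uhp \<Longrightarrow> moebius_act A \<tau> = moebius_act \<gamma> (- 1 / (\<tau> + of_int j) + of_int i)"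
      "\<And>\<tau>. \<tau> \<in> uhp \<Longrightarrow> autom_factor A \<tau> = of_int \<epsilon> * (\<tau> + of_int j) * autom_factor \<gamma> (- 1 / (\<tau> + of_int j) + of_int i)"
proof -
  define a b c d where "a = A$1$1" and "b = A$1$2" and "c = A$2$1" and "d = A$2$2"
  have det: "a * d - b * c = 1" using A by (simp add: det_SL2Z a_def b_def c_def d_def)
  have Aact: "moebius_act A \<tau> = (of_int a * \<tau> + of_int b) / (of_int c * \<tau> + of_int d)"
    "autom_factor A \<tau> = of_int c * \<tau> + of_int d" for \<tau>
    by (simp_all add: moebius_act_def autom_factor_def a_def b_def c_def d_def)
  show ?thesis
  proof (cases "int p dvd c")
    case True
    then obtain l where l: "c = int p * l" by (auto simp: dvd_def)
    have "\<not> int p dvd a"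
    proof
      assume "int p dvd a"
      then have "int p dvd a * d - b * c" using True by simp
      then show False using p by (auto simp: det)
    qed
    then obtain \<epsilon> where e: "\<epsilon> * \<epsilon> = 1" "int p dvd a - \<epsilon>" by (rule sign_representative[OF p])
    then obtain k where k: "a = \<epsilon> + int p * k" by (metis add.commute diff_add_cancel dvdE)
    \<comment> \<open>Since \<open>a^2\<close> is 1 modulo \<open>p\<close>, this \<open>j\<close> solves \<open>a j = b\<close> modulo \<open>p\<close>.\<close>
    define j where "j = a * b"
    define \<gamma> where "\<gamma> = mat2 (\<epsilon> * a) (\<epsilon> * (b - a * j)) (\<epsilon> * c) (\<epsilon> * (d - c * j))"
    have e': "\<epsilon> * (\<epsilon> * z) = z" for z by (simp add: e mult.assoc[symmetric])
    have 1: "\<epsilon> * a - 1 = int p * (\<epsilon> * k)" using e by (simp add: k algebra_simps)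
    have 2: "\<epsilon> * d - 1 = int p * (b * l - k * d)"
      using det by (simp add: k l algebra_simps)
    have "a * a = 1 + int p * (k * (2 * \<epsilon> + int p * k))" using e by (simp add: k algebra_simps)
    then have aa: "a * a = 1 + int p * (k * (2 * \<epsilon> + int p * k))" .
    have "b - a * j = b - (a * a) * b" by (simp add: j_def)
    then have 3: "b - a * j = int p * (- b * (k * (2 * \<epsilon> + int p * k)))"
      unfolding aa by (simp add: algebra_simps)
    have "\<epsilon> * a * (\<epsilon> * (d - c * j)) - \<epsilon> * (b - a * j) * (\<epsilon> * c) = \<epsilon> * \<epsilon> * (a * d - b * c)"
      by (simp add: algebra_simps)
    then have "\<gamma> \<in> SL2Z" by (simp add: det_SL2Z \<gamma>_def e det)
    moreover have "\<epsilon> * (d - c * j) - 1 = int p * (b * l - k * d - \<epsilon> * l * j)"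
      using 2 by (simp add: l algebra_simps)
    ultimately have G: "\<gamma> \<in> Gamma p"
      unfolding Gamma_iff using 1 3 True by (simp add: \<gamma>_def)
    have ee: "of_int \<epsilon> * of_int \<epsilon> = (1::complex)" using e by (metis of_int_1 of_int_mult)
    have e0: "of_int \<epsilon> \<noteq> (0::complex)" using ee by auto
    have af: "autom_factor \<gamma> (\<tau> + of_int j) = of_int \<epsilon> * (of_int c * \<tau> + of_int d)" for \<tau>
      by (simp add: autom_factor_def \<gamma>_def algebra_simps)
    have nm: "of_int (\<gamma>$1$1) * (\<tau> + of_int j) + of_int (\<gamma>$1$2) = of_int \<epsilon> * (of_int a * \<tau> + of_int b)" for \<tau> :: complex
      by (simp add: \<gamma>_def algebra_simps)
    show ?thesis
    proof (rule cusp_infinity[OF G e(1)])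
      show "moebius_act A \<tau> = moebius_act \<gamma> (\<tau> + of_int j)" for \<tau>
        unfolding moebius_act_def[of \<gamma>] af nm Aact using e0 by simp
      show "autom_factor A \<tau> = of_int \<epsilon> * autom_factor \<gamma> (\<tau> + of_int j)" for \<tau>
        unfolding af Aact mult.assoc[symmetric] ee by simp
    qed
  next
    case False
    then obtain \<epsilon> where e: "\<epsilon> * \<epsilon> = 1" "int p dvd c - \<epsilon>" by (rule sign_representative[OF p])
    then obtain k where k: "c = \<epsilon> + int p * k" by (metis add.commute diff_add_cancel dvdE)
    \<comment> \<open>Since \<open>c^2\<close> is 1 modulo \<open>p\<close>, these solve \<open>c i = a\<close> and \<open>c j = d\<close> modulo \<open>p\<close>.\<close>
    define i j where "i = a * c" and "j = c * d"
    define \<gamma> where "\<gamma> = mat2 (\<epsilon> * (a * j - b)) (\<epsilon> * (a - i * (a * j - b))) (\<epsilon> * (c * j - d)) (\<epsilon> * (c - i * (c * j - d)))"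
    have cc: "c * c = 1 + int p * (k * (2 * \<epsilon> + int p * k))" using e by (simp add: k algebra_simps)
    define m where "m = k * (2 * \<epsilon> + int p * k)"
    have cc: "c * c = 1 + int p * m" unfolding cc m_def ..
    have ec: "\<epsilon> * c = 1 + int p * (\<epsilon> * k)" using e by (simp add: k algebra_simps)
    have ad: "a * d = 1 + b * c" using det by simp
    have g21: "c * j - d = int p * (m * d)"
    proof -
      have "c * j - d = (c * c) * d - d" by (simp add: j_def mult_ac)
      then show ?thesis unfolding cc by (simp add: algebra_simps)
    qed
    have g11: "a * j - b = c + int p * (b * m)"
    proof -
      have "a * j - b = c * (a * d) - b" by (simp add: j_def mult_ac)
      also have "\<dots> = c + b * (c * c) - b" unfolding ad by (simp add: algebra_simps)
      finally show ?thesis unfolding cc by (simp add: algebra_simps)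
    qed
    have g12: "a - i * (a * j - b) = int p * (- a * m - i * b * m)"
    proof -
      have "a - i * (a * j - b) = a - a * (c * c) - i * (int p * (b * m))"
        unfolding g11 by (simp add: i_def algebra_simps)
      then show ?thesis unfolding cc by (simp add: algebra_simps)
    qed
    have "\<epsilon> * (a * j - b) * (\<epsilon> * (c - i * (c * j - d))) - \<epsilon> * (a - i * (a * j - b)) * (\<epsilon> * (c * j - d)) =
        \<epsilon> * \<epsilon> * (a * d - b * c)"
      by (simp add: algebra_simps)
    then have "\<gamma> \<in> SL2Z" by (simp add: det_SL2Z \<gamma>_def e det)
    moreover have "\<epsilon> * (a * j - b) - 1 = int p * (\<epsilon> * k + \<epsilon> * (b * m))"
      unfolding g11 using ec by (simp add: algebra_simps)
    moreover have "\<epsilon> * (c - i * (c * j - d)) - 1 = int p * (\<epsilon> * k - \<epsilon> * i * (m * d))"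
      unfolding g21 using ec by (simp add: algebra_simps)
    ultimately have G: "\<gamma> \<in> Gamma p"
      unfolding Gamma_iff \<gamma>_def mat2_entries g12 g21 by simp
    have ee: "of_int \<epsilon> * of_int \<epsilon> = (1::complex)" using e by (metis of_int_1 of_int_mult)
    have e0: "of_int \<epsilon> \<noteq> (0::complex)" using ee by auto
    have af: "(\<tau> + of_int j) * autom_factor \<gamma> (- 1 / (\<tau> + of_int j) + of_int i) = of_int \<epsilon> * (of_int c * \<tau> + of_int d)"
      and nm: "(\<tau> + of_int j) * (of_int (\<gamma>$1$1) * (- 1 / (\<tau> + of_int j) + of_int i) + of_int (\<gamma>$1$2)) = of_int \<epsilon> * (of_int a * \<tau> + of_int b)"
      and nz: "\<tau> + of_int j \<noteq> 0" if "\<tau> \<in> uhp" for \<tau>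
    proof -
      have "\<tau> + of_int j \<in> uhp" using that by (simp add: uhp_def)
      then show nz: "\<tau> + of_int j \<noteq> 0" by (rule uhp_nonzero)
      show "(\<tau> + of_int j) * autom_factor \<gamma> (- 1 / (\<tau> + of_int j) + of_int i) = of_int \<epsilon> * (of_int c * \<tau> + of_int d)"
        using nz by (simp add: autom_factor_def \<gamma>_def distrib_left diff_divide_distrib) (simp add: field_simps)
      show "(\<tau> + of_int j) * (of_int (\<gamma>$1$1) * (- 1 / (\<tau> + of_int j) + of_int i) + of_int (\<gamma>$1$2)) = of_int \<epsilon> * (of_int a * \<tau> + of_int b)"
        using nz by (simp add: \<gamma>_def distrib_left diff_divide_distrib) (simp add: field_simps)
    qed
    show ?thesis
    proof (rule other_cusp[OF G e(1)])
      fix \<tau> assume \<tau>: "\<tau> \<in> uhp"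
      let ?v = "- 1 / (\<tau> + of_int j) + of_int i"
      have "moebius_act \<gamma> ?v = ((\<tau> + of_int j) * (of_int (\<gamma>$1$1) * ?v + of_int (\<gamma>$1$2))) / ((\<tau> + of_int j) * autom_factor \<gamma> ?v)"
        unfolding moebius_act_def mult_divide_mult_cancel_left[OF nz[OF \<tau>]] ..
      then show "moebius_act A \<tau> = moebius_act \<gamma> ?v"
        unfolding af[OF \<tau>] nm[OF \<tau>] Aact using e0 by simp
      show "autom_factor A \<tau> = of_int \<epsilon> * (\<tau> + of_int j) * autom_factor \<gamma> ?v"
        unfolding mult.assoc af[OF \<tau>] Aact unfolding mult.assoc[symmetric] ee by simp
    qed
  qed
qed

definition weakly_invariant :: "nat \<Rightarrow> nat \<Rightarrow> (complex \<Rightarrow> complex) \<Rightarrow> bool" where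
  "weakly_invariant N k f \<longleftrightarrow>
    (\<forall>A\<in>Gamma N. \<forall>\<tau>\<in>uhp. f (moebius_act A \<tau>) = autom_factor A \<tau> ^ k * f \<tau>)"

lemma Gamma_SL2Z: "A \<in> Gamma N \<Longrightarrow> A \<in> SL2Z"
  by (simp add: Gamma_def)

lemma slash_at_infinity_cases:
  assumes p: "p = 2 \<or> p = (3::nat)" and A: "A \<in> SL2Z"
  obtains (cusp_infinity) \<epsilon> j where
      "\<And>f k \<tau>. weakly_invariant p k f \<Longrightarrow> \<tau> \<in> uhp \<Longrightarrow> slash k f A \<tau> = (of_int \<epsilon>) ^ k * f (\<tau> + of_int j)"
  | (other_cusp) \<epsilon> i j where
      "\<And>f k \<tau>. weakly_invariant p k f \<Longrightarrow> \<tau> \<in> uhp \<Longrightarrow>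
         slash k f A \<tau> = (of_int \<epsilon>) ^ k * (f (- 1 / (\<tau> + of_int j) + of_int i) / (\<tau> + of_int j) ^ k)"
  using p A
proof (cases rule: SL2Z_decomposition)
  case (cusp_infinity \<gamma> \<epsilon> j)
  have ee: "1 / of_int \<epsilon> = (of_int \<epsilon> :: complex)"
    using cusp_infinity(2) by (metis divide_eq_eq mult_zero_left of_int_1 of_int_mult zero_neq_one)
  show ?thesis
  proof (rule that(1))
    fix f :: "complex \<Rightarrow> complex" and k \<tau> assume f: "weakly_invariant p k f" and \<tau>: "\<tau> \<in> uhp"
    have t: "\<tau> + of_int j \<in> uhp" using \<tau> by (simp add: uhp_def)
    have "f (moebius_act \<gamma> (\<tau> + of_int j)) = autom_factor \<gamma> (\<tau> + of_int j) ^ k * f (\<tau> + of_int j)"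
      using f cusp_infinity(1) t unfolding weakly_invariant_def by blast
    then have "slash k f A \<tau> = (1 / of_int \<epsilon> ^ k) * f (\<tau> + of_int j)"
      using autom_factor_nonzero[OF Gamma_SL2Z[OF cusp_infinity(1)] t]
      unfolding slash_def cusp_infinity(3,4)[OF \<tau>] by (simp add: power_mult_distrib)
    also have "1 / of_int \<epsilon> ^ k = (of_int \<epsilon> :: complex) ^ k"
      using arg_cong[OF ee, of "\<lambda>z. z ^ k"] by (simp only: power_one_over)
    finally show "slash k f A \<tau> = (of_int \<epsilon>) ^ k * f (\<tau> + of_int j)" .
  qed
next
  case (other_cusp \<gamma> \<epsilon> i j)
  have ee: "1 / of_int \<epsilon> = (of_int \<epsilon> :: complex)"
    using other_cusp(2) by (metis divide_eq_eq mult_zero_left of_int_1 of_int_mult zero_neq_one)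
  show ?thesis
  proof (rule that(2))
    fix f :: "complex \<Rightarrow> complex" and k \<tau> assume f: "weakly_invariant p k f" and \<tau>: "\<tau> \<in> uhp"
    have t: "\<tau> + of_int j \<in> uhp" using \<tau> by (simp add: uhp_def)
    have v: "- 1 / (\<tau> + of_int j) + of_int i \<in> uhp" using minus_inverse_uhp[OF t] by (simp add: uhp_def)
    have "f (moebius_act \<gamma> (- 1 / (\<tau> + of_int j) + of_int i)) = autom_factor \<gamma> (- 1 / (\<tau> + of_int j) + of_int i) ^ k * f (- 1 / (\<tau> + of_int j) + of_int i)"
      using f other_cusp(1) v unfolding weakly_invariant_def by blast
    then have "slash k f A \<tau> = (1 / of_int \<epsilon> ^ k) * (f (- 1 / (\<tau> + of_int j) + of_int i) / (\<tau> + of_int j) ^ k)"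
      using autom_factor_nonzero[OF Gamma_SL2Z[OF other_cusp(1)] v]
      unfolding slash_def other_cusp(3,4)[OF \<tau>] by (simp add: power_mult_distrib)
    also have "1 / of_int \<epsilon> ^ k = (of_int \<epsilon> :: complex) ^ k"
      using arg_cong[OF ee, of "\<lambda>z. z ^ k"] by (simp only: power_one_over)
    finally show "slash k f A \<tau> = (of_int \<epsilon>) ^ k * (f (- 1 / (\<tau> + of_int j) + of_int i) / (\<tau> + of_int j) ^ k)" .
  qed
qed

text \<open>By the decomposition it suffices to look at infinity and at the integers, which represent the
  remaining cusps.\<close>
lemma modular_formsI:
  assumes p: "p = 2 \<or> p = (3::nat)" and f: "f holomorphic_on uhp" and inv: "weakly_invariant p k f"
    and inf: "holo_at_infinity p f"
    and inf': "\<And>i::int. holo_at_infinity p (\<lambda>\<tau>. f (- 1 / \<tau> + of_int i) / \<tau> ^ k)"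
  shows "(\<lambda>\<tau>\<in>uhp. f \<tau>) \<in> modular_forms p k"
  unfolding modular_forms_def
proof (intro CollectI conjI ballI)
  have p0: "p > 0" using p by auto
  show "(\<lambda>\<tau>\<in>uhp. f \<tau>) \<in> carrier holo_ring" by (rule restrict_holo_carrier[OF f])
  show "(\<lambda>\<tau>\<in>uhp. f \<tau>) (moebius_act A \<tau>) = autom_factor A \<tau> ^ k * (\<lambda>\<tau>\<in>uhp. f \<tau>) \<tau>"
    if "A \<in> Gamma p" "\<tau> \<in> uhp" for A \<tau>
    using inv that moebius_act_uhp[OF Gamma_SL2Z] by (simp add: weakly_invariant_def)
  show "holo_at_infinity p (slash k (\<lambda>\<tau>\<in>uhp. f \<tau>) A)" if A: "A \<in> SL2Z" for A
  proof -
    have "holo_at_infinity p (slash k f A)"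
      using p A
    proof (cases rule: slash_at_infinity_cases)
      case (cusp_infinity \<epsilon> j)
      then show ?thesis
        using holo_at_infinity_cong[THEN iffD2, OF cusp_infinity[OF inv]
          holo_at_infinity_mult[OF holo_at_infinity_const holo_at_infinity_shift[OF inf p0]]] by blast
    next
      case (other_cusp \<epsilon> i j)
      then show ?thesis
        using holo_at_infinity_cong[THEN iffD2, OF other_cusp[OF inv]
          holo_at_infinity_mult[OF holo_at_infinity_const holo_at_infinity_shift[OF inf' p0]]] by blast
    qed
    also have "holo_at_infinity p (slash k f A) \<longleftrightarrow> holo_at_infinity p (slash k (\<lambda>\<tau>\<in>uhp. f \<tau>) A)"
      by (rule holo_at_infinity_cong) (simp add: slash_def moebius_act_uhp[OF A])
    finally show ?thesis .
  qed
qed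

section \<open>Spaces of modular forms\<close>

lemma restrict_mem:
  assumes "(\<lambda>\<tau>\<in>D. f \<tau>) \<in> S" "\<And>\<tau>. \<tau> \<in> D \<Longrightarrow> f \<tau> = g \<tau>"
  shows "(\<lambda>\<tau>\<in>D. g \<tau>) \<in> S"
  using assms restrict_ext[of D f g] by simp

lemma modular_forms_restrict: "f \<in> modular_forms N k \<Longrightarrow> (\<lambda>\<tau>\<in>uhp. f \<tau>) = f"
  by (auto simp: modular_forms_def holo_ring_def extensional_def fun_eq_iff)

lemma modular_formsD:
  assumes "f \<in> modular_forms N k"
  shows "f holomorphic_on uhp" "weakly_invariant N k f" "A \<in> SL2Z \<Longrightarrow> holo_at_infinity N (slash k f A)"
  using assms by (auto simp: modular_forms_def weakly_invariant_def holo_ring_def)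

lemma mat2_SL2Z: "a * d - b * c = 1 \<Longrightarrow> mat2 a b c d \<in> SL2Z"
  by (simp add: det_SL2Z)

lemma moebius_mat2:
  "moebius_act (mat2 a b c d) \<tau> = (of_int a * \<tau> + of_int b) / (of_int c * \<tau> + of_int d)"
  "autom_factor (mat2 a b c d) \<tau> = of_int c * \<tau> + of_int d"
  by (simp_all add: moebius_act_def autom_factor_def)

lemma modular_forms_cusps:
  assumes f: "f \<in> modular_forms N k"
  shows "holo_at_infinity N f" "holo_at_infinity N (\<lambda>\<tau>. f (- 1 / \<tau> + of_int i) / \<tau> ^ k)"
proof -
  have "slash k f (mat2 1 0 0 1) = f" by (simp add: slash_def moebius_mat2 fun_eq_iff)
  then show "holo_at_infinity N f"
    using modular_formsD(3)[OF f, of "mat2 1 0 0 1"] by (simp add: mat2_SL2Z)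
  have "slash k f (mat2 i (- 1) 1 0) \<tau> = f (- 1 / \<tau> + of_int i) / \<tau> ^ k" if "\<tau> \<in> uhp" for \<tau>
  proof -
    have "(of_int i * \<tau> + of_int (- 1)) / (of_int 1 * \<tau> + of_int 0) = - 1 / \<tau> + of_int i"
      using uhp_nonzero[OF that] by (simp add: field_simps)
    then show ?thesis by (simp only: slash_def moebius_mat2) simp
  qed
  then show "holo_at_infinity N (\<lambda>\<tau>. f (- 1 / \<tau> + of_int i) / \<tau> ^ k)"
    using modular_formsD(3)[OF f, of "mat2 i (- 1) 1 0"] holo_at_infinity_cong[of "slash k f (mat2 i (- 1) 1 0)"]
    by (simp add: mat2_SL2Z)
qed

lemma slash_add: "slash k (\<lambda>\<tau>. f \<tau> + g \<tau>) A \<tau> = slash k f A \<tau> + slash k g A \<tau>"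
  by (simp add: slash_def add_divide_distrib)

lemma slash_mult: "slash (k + l) (\<lambda>\<tau>. f \<tau> * g \<tau>) A \<tau> = slash k f A \<tau> * slash l g A \<tau>"
  by (simp add: slash_def power_add)

lemma slash_restrict: "A \<in> SL2Z \<Longrightarrow> \<tau> \<in> uhp \<Longrightarrow> slash k (\<lambda>\<tau>\<in>uhp. f \<tau>) A \<tau> = slash k f A \<tau>"
  by (simp add: slash_def moebius_act_uhp)

lemma modular_forms_add:
  assumes "f \<in> modular_forms N k" "g \<in> modular_forms N k"
  shows "(\<lambda>\<tau>\<in>uhp. f \<tau> + g \<tau>) \<in> modular_forms N k"
  unfolding modular_forms_def
proof (intro CollectI conjI ballI)
  note f = modular_formsD[OF assms(1)] and g = modular_formsD[OF assms(2)]
  show "(\<lambda>\<tau>\<in>uhp. f \<tau> + g \<tau>) \<in> carrier holo_ring"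
    by (intro restrict_holo_carrier holomorphic_intros f g)
  show "(\<lambda>\<tau>\<in>uhp. f \<tau> + g \<tau>) (moebius_act A \<tau>) = autom_factor A \<tau> ^ k * (\<lambda>\<tau>\<in>uhp. f \<tau> + g \<tau>) \<tau>"
    if "A \<in> Gamma N" "\<tau> \<in> uhp" for A \<tau>
    using f(2) g(2) that moebius_act_uhp[OF Gamma_SL2Z] by (simp add: weakly_invariant_def distrib_left)
  show "holo_at_infinity N (slash k (\<lambda>\<tau>\<in>uhp. f \<tau> + g \<tau>) A)" if A: "A \<in> SL2Z" for A
    using holo_at_infinity_add[OF f(3)[OF A] g(3)[OF A]]
    by (rule holo_at_infinity_cong[THEN iffD1, rotated]) (simp only: slash_restrict[OF A] slash_add)
qed

lemma modular_forms_mult: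
  assumes "f \<in> modular_forms N k" "g \<in> modular_forms N l"
  shows "(\<lambda>\<tau>\<in>uhp. f \<tau> * g \<tau>) \<in> modular_forms N (k + l)"
  unfolding modular_forms_def
proof (intro CollectI conjI ballI)
  note f = modular_formsD[OF assms(1)] and g = modular_formsD[OF assms(2)]
  show "(\<lambda>\<tau>\<in>uhp. f \<tau> * g \<tau>) \<in> carrier holo_ring"
    by (intro restrict_holo_carrier holomorphic_intros f g)
  show "(\<lambda>\<tau>\<in>uhp. f \<tau> * g \<tau>) (moebius_act A \<tau>) = autom_factor A \<tau> ^ (k + l) * (\<lambda>\<tau>\<in>uhp. f \<tau> * g \<tau>) \<tau>"
    if "A \<in> Gamma N" "\<tau> \<in> uhp" for A \<tau>
    using f(2) g(2) that moebius_act_uhp[OF Gamma_SL2Z] by (simp add: weakly_invariant_def power_add mult_ac)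
  show "holo_at_infinity N (slash (k + l) (\<lambda>\<tau>\<in>uhp. f \<tau> * g \<tau>) A)" if A: "A \<in> SL2Z" for A
    using holo_at_infinity_mult[OF f(3)[OF A] g(3)[OF A]]
    by (rule holo_at_infinity_cong[THEN iffD1, rotated]) (simp only: slash_restrict[OF A] slash_mult)
qed

lemma modular_forms_const: "(\<lambda>\<tau>\<in>uhp. c) \<in> modular_forms N 0"
  unfolding modular_forms_def
proof (intro CollectI conjI ballI)
  show "(\<lambda>\<tau>\<in>uhp. c) \<in> carrier holo_ring" by (intro restrict_holo_carrier holomorphic_intros)
  show "(\<lambda>\<tau>\<in>uhp. c) (moebius_act A \<tau>) = autom_factor A \<tau> ^ 0 * (\<lambda>\<tau>\<in>uhp. c) \<tau>"
    if "A \<in> Gamma N" "\<tau> \<in> uhp" for A \<tau>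
    using that moebius_act_uhp[OF Gamma_SL2Z] by simp
  show "holo_at_infinity N (slash 0 (\<lambda>\<tau>\<in>uhp. c) A)" if A: "A \<in> SL2Z" for A
    using holo_at_infinity_const
    by (rule holo_at_infinity_cong[THEN iffD1, rotated]) (simp add: slash_restrict[OF A], simp add: slash_def)
qed

lemma modular_forms_scale:
  assumes "f \<in> modular_forms N k"
  shows "(\<lambda>\<tau>\<in>uhp. c * f \<tau>) \<in> modular_forms N k"
proof -
  have "(\<lambda>\<tau>\<in>uhp. (\<lambda>\<tau>\<in>uhp. c) \<tau> * f \<tau>) \<in> modular_forms N (0 + k)"
    by (rule modular_forms_mult[OF modular_forms_const assms])
  then show ?thesis unfolding add_0 by (rule restrict_mem) simp
qed

lemma modular_forms_power:
  assumes "f \<in> modular_forms N k"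
  shows "(\<lambda>\<tau>\<in>uhp. f \<tau> ^ m) \<in> modular_forms N (k * m)"
proof (induction m)
  case 0
  show ?case using modular_forms_const[of 1 N] by (simp only: power_0 mult_0_right)
next
  case (Suc m)
  have "(\<lambda>\<tau>\<in>uhp. f \<tau> * (\<lambda>\<tau>\<in>uhp. f \<tau> ^ m) \<tau>) \<in> modular_forms N (k + k * m)"
    by (rule modular_forms_mult[OF assms Suc])
  then show ?case unfolding mult_Suc_right by (rule restrict_mem) simp
qed

text \<open>The functions \<open>f \<circ> A\<close>, where \<open>A\<close> runs over \<open>SL2Z\<close>, form a finite family that is permuted by \<open>SL2Z\<close>.\<close>
lemma modular_forms_weight_0:
  assumes p: "p = 2 \<or> p = (3::nat)" and f: "f \<in> modular_forms p 0"
  obtains c where "f = (\<lambda>\<tau>\<in>uhp. c)"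
proof -
  have p0: "p > 0" using p by auto
  define F where "F = (\<lambda>A. restrict (\<lambda>\<tau>. f (moebius_act A \<tau>)) uhp) ` SL2Z"
  have FI: "\<exists>g\<in>F. \<forall>\<tau>\<in>uhp. norm (f (h \<tau>)) = norm (g \<tau>)"
    if "A \<in> SL2Z" "\<And>\<tau>. \<tau> \<in> uhp \<Longrightarrow> h \<tau> = moebius_act A \<tau>" for A h
    unfolding F_def using that by (intro bexI[of _ "restrict (\<lambda>\<tau>. f (moebius_act A \<tau>)) uhp"]) auto
  have per: "g (\<tau> + of_int j) = g (\<tau> + of_int (j mod int p))"
    if "holo_at_infinity p g" "\<tau> \<in> uhp" for g \<tau> and j :: int
  proof -
    from that(1) obtain G where G: "\<And>\<tau>. \<tau> \<in> uhp \<Longrightarrow> g \<tau> = G (q_pow (1 / real p) \<tau>)"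
      by (auto simp: holo_at_infinity_def)
    have "j = j mod int p + int p * (j div int p)" by simp
    then have "of_int j = of_int (j mod int p) + of_nat p * (of_int (j div int p) :: complex)"
      by (metis of_int_add of_int_mult of_int_of_nat_eq)
    then have "q_pow (1 / real p) (\<tau> + of_int j) = q_pow (1 / real p) (\<tau> + of_int (j mod int p))"
      using p0 by (simp add: q_pow_conv_exp2pi add_divide_distrib exp2pi_add)
    moreover have "\<tau> + of_int j \<in> uhp" "\<tau> + of_int (j mod int p) \<in> uhp" using that(2) by (auto simp: uhp_def)
    ultimately show ?thesis using G by simp
  qed
  define h where "h = (\<lambda>i::int. \<lambda>\<tau>. f (- 1 / \<tau> + of_int i))"
  have hh: "holo_at_infinity p (h i)" for i
    using modular_forms_cusps(2)[OF f, of i] by (simp add: h_def)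
  note hf = modular_forms_cusps(1)[OF f]
  \<comment> \<open>The translations matter only modulo \<open>p\<close>, by periodicity of expansions at infinity.\<close>
  have "F \<subseteq> (\<lambda>j. restrict (\<lambda>\<tau>. f (\<tau> + of_int j)) uhp) ` {0..<int p} \<union>
      (\<lambda>(i, j). restrict (\<lambda>\<tau>. h i (\<tau> + of_int j)) uhp) ` ({0..<int p} \<times> {0..<int p})" (is "_ \<subseteq> ?X \<union> ?Y")
  proof
    fix g assume "g \<in> F"
    then obtain A where A: "A \<in> SL2Z" "g = restrict (\<lambda>\<tau>. f (moebius_act A \<tau>)) uhp" by (auto simp: F_def)
    have sl: "f (moebius_act A \<tau>) = slash 0 f A \<tau>" for \<tau> by (simp add: slash_def)
    note inv = modular_formsD(2)[OF f]
    from p A(1) show "g \<in> ?X \<union> ?Y"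
    proof (cases rule: slash_at_infinity_cases)
      case (cusp_infinity \<epsilon> j)
      have "slash 0 f A \<tau> = f (\<tau> + of_int (j mod int p))" if "\<tau> \<in> uhp" for \<tau>
        using cusp_infinity[OF inv that] per[OF hf that, of j] by (simp only: power_0 mult_1_left)
      then have "g = restrict (\<lambda>\<tau>. f (\<tau> + of_int (j mod int p))) uhp"
        unfolding A(2) sl by (simp cong: restrict_cong)
      moreover have "j mod int p \<in> {0..<int p}" using p0 by simp
      ultimately show ?thesis by blast
    next
      case (other_cusp \<epsilon> i j)
      have "h i (\<tau> + of_int j) = h (i mod int p) (\<tau> + of_int (j mod int p))" if "\<tau> \<in> uhp" for \<tau>
      proof -
        have "\<tau> + of_int (j mod int p) \<in> uhp" using that by (simp add: uhp_def)
        from per[OF hf minus_inverse_uhp[OF this], of i]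
        have "h i (\<tau> + of_int (j mod int p)) = h (i mod int p) (\<tau> + of_int (j mod int p))"
          by (simp only: h_def)
        with per[OF hh that, of i j] show ?thesis by (simp only:)
      qed
      moreover have "slash 0 f A \<tau> = h i (\<tau> + of_int j)" if "\<tau> \<in> uhp" for \<tau>
        using other_cusp[OF inv that] by (simp only: power_0 mult_1_left div_by_1 h_def)
      ultimately have "slash 0 f A \<tau> = h (i mod int p) (\<tau> + of_int (j mod int p))" if "\<tau> \<in> uhp" for \<tau>
        using that by (simp only:)
      then have "g = restrict (\<lambda>\<tau>. h (i mod int p) (\<tau> + of_int (j mod int p))) uhp"
        unfolding A(2) sl by (simp cong: restrict_cong)
      moreover have "i mod int p \<in> {0..<int p}" "j mod int p \<in> {0..<int p}" using p0 by simp_all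
      ultimately show ?thesis
        by (intro UnI2 image_eqI[of _ _ "(i mod int p, j mod int p)"]) auto
    qed
  qed
  moreover have "finite (?X \<union> ?Y)" by auto
  ultimately have fin: "finite F" by (rule finite_subset)
  have "mat2 1 0 0 1 \<in> SL2Z" by (simp add: mat2_SL2Z)
  then have ne: "F \<noteq> {}" by (auto simp: F_def)
  have "\<exists>g\<in>F. g constant_on uhp"
  proof (rule max_principle_family[OF p0 fin ne])
    fix g assume "g \<in> F"
    then obtain A where A: "A \<in> SL2Z" "g = restrict (\<lambda>\<tau>. f (moebius_act A \<tau>)) uhp" by (auto simp: F_def)
    show "holo_at_infinity p g"
      using modular_formsD(3)[OF f A(1)]
      by (rule holo_at_infinity_cong[THEN iffD1, rotated]) (simp add: A(2) slash_def)
    define a b c d where "a = A$1$1" and "b = A$1$2" and "c = A$2$1" and "d = A$2$2"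
    have det: "a * d - b * c = 1" using A(1) by (simp add: det_SL2Z a_def b_def c_def d_def)
    have act: "moebius_act A \<tau> = (of_int a * \<tau> + of_int b) / (of_int c * \<tau> + of_int d)" for \<tau>
      by (simp add: moebius_act_def autom_factor_def a_def b_def c_def d_def)
    show "\<exists>k\<in>F. \<forall>\<tau>\<in>uhp. norm (g (\<tau> + of_int n)) = norm (k \<tau>)" for n
    proof -
      have "mat2 a (a * n + b) c (c * n + d) \<in> SL2Z"
        by (rule mat2_SL2Z) (use det in \<open>simp add: algebra_simps\<close>)
      moreover have "moebius_act A (\<tau> + of_int n) = moebius_act (mat2 a (a * n + b) c (c * n + d)) \<tau>" for \<tau>
        by (simp add: act moebius_mat2 algebra_simps)
      ultimately have "\<exists>k\<in>F. \<forall>\<tau>\<in>uhp. norm (f (moebius_act A (\<tau> + of_int n))) = norm (k \<tau>)"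
        using FI[of _ "\<lambda>\<tau>. moebius_act A (\<tau> + of_int n)"] by blast
      then show ?thesis by (simp add: A(2) uhp_def)
    qed
    show "\<exists>k\<in>F. \<forall>\<tau>\<in>uhp. norm (g (- 1 / \<tau>)) = norm (k \<tau>)"
    proof -
      have "mat2 b (- a) d (- c) \<in> SL2Z"
        by (rule mat2_SL2Z) (use det in \<open>simp add: algebra_simps\<close>)
      moreover have "moebius_act A (- 1 / \<tau>) = moebius_act (mat2 b (- a) d (- c)) \<tau>" if "\<tau> \<in> uhp" for \<tau>
      proof -
        have "moebius_act A (- 1 / \<tau>) = (\<tau> * (of_int a * (- 1 / \<tau>) + of_int b)) / (\<tau> * (of_int c * (- 1 / \<tau>) + of_int d))"
          unfolding act mult_divide_mult_cancel_left[OF uhp_nonzero[OF that]] ..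
        also have "\<dots> = moebius_act (mat2 b (- a) d (- c)) \<tau>"
          using uhp_nonzero[OF that] by (simp add: moebius_mat2 algebra_simps)
        finally show ?thesis .
      qed
      ultimately have "\<exists>k\<in>F. \<forall>\<tau>\<in>uhp. norm (f (moebius_act A (- 1 / \<tau>))) = norm (k \<tau>)"
        using FI[of _ "\<lambda>\<tau>. moebius_act A (- 1 / \<tau>)"] by blast
      then show ?thesis using minus_inverse_uhp by (simp add: A(2))
    qed
  qed
  then obtain A k where A: "A \<in> SL2Z" "\<And>\<tau>. \<tau> \<in> uhp \<Longrightarrow> f (moebius_act A \<tau>) = k"
    by (auto simp: F_def constant_on_def)
  have sl: "slash 0 f A \<tau> = k" if "\<tau> \<in> uhp" for \<tau>
    using A(2)[OF that] by (simp add: slash_def)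
  note inv = modular_formsD(2)[OF f]
  have "f \<sigma> = k" if \<sigma>: "\<sigma> \<in> uhp" for \<sigma>
    using p A(1)
  proof (cases rule: slash_at_infinity_cases)
    case (cusp_infinity \<epsilon> j)
    have "\<sigma> - of_int j \<in> uhp" using \<sigma> by (simp add: uhp_def)
    from cusp_infinity[OF inv this] sl[OF this] show ?thesis by simp
  next
    case (other_cusp \<epsilon> i j)
    have "\<sigma> - of_int i \<in> uhp" using \<sigma> by (simp add: uhp_def)
    from minus_inverse_uhp[OF this] have "- 1 / (\<sigma> - of_int i) - of_int j \<in> uhp" by (simp add: uhp_def)
    from other_cusp[OF inv this] sl[OF this] show ?thesis by simp
  qed
  then have "f = (\<lambda>\<tau>\<in>uhp. k)"
    using modular_forms_restrict[OF f] restrict_ext[of uhp f "\<lambda>_. k"] by simp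
  then show ?thesis by (rule that)
qed

section \<open>Subalgebras and the ring of modular forms\<close>

lemma generators_in_carrier:
  assumes "S \<subseteq> carrier holo_ring"
  shows "range (\<lambda>c. \<lambda>\<tau>\<in>uhp. c) \<union> S \<subseteq> carrier holo_ring"
  using assms by (auto intro!: restrict_holo_carrier holomorphic_intros)

lemma generate_algebra_const: "(\<lambda>\<tau>\<in>uhp. c) \<in> generate_algebra S"
  unfolding generate_algebra_def by (rule generate_ring.incl) auto

lemma generate_algebra_incl: "f \<in> S \<Longrightarrow> f \<in> generate_algebra S"
  unfolding generate_algebra_def by (rule generate_ring.incl) auto

lemma generate_algebra_add:
  assumes "f \<in> generate_algebra S" "g \<in> generate_algebra S"
  shows "(\<lambda>\<tau>\<in>uhp. f \<tau> + g \<tau>) \<in> generate_algebra S"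
  using generate_ring.eng_add[OF assms[unfolded generate_algebra_def]]
  by (simp add: generate_algebra_def holo_ring_def)

lemma generate_algebra_mult:
  assumes "f \<in> generate_algebra S" "g \<in> generate_algebra S"
  shows "(\<lambda>\<tau>\<in>uhp. f \<tau> * g \<tau>) \<in> generate_algebra S"
  using generate_ring.eng_mult[OF assms[unfolded generate_algebra_def]]
  by (simp add: generate_algebra_def holo_ring_def)

lemma generate_algebra_scale:
  assumes "f \<in> generate_algebra S"
  shows "(\<lambda>\<tau>\<in>uhp. c * f \<tau>) \<in> generate_algebra S"
  by (rule restrict_mem[OF generate_algebra_mult[OF generate_algebra_const[of c] assms]]) simp

lemma generate_algebra_power:
  assumes "f \<in> generate_algebra S"
  shows "(\<lambda>\<tau>\<in>uhp. f \<tau> ^ n) \<in> generate_algebra S"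
proof (induction n)
  case 0
  show ?case unfolding power_0 by (rule generate_algebra_const)
next
  case (Suc n)
  show ?case by (rule restrict_mem[OF generate_algebra_mult[OF assms Suc]]) simp
qed

lemma generate_algebra_sum:
  assumes "finite K" "\<And>k. k \<in> K \<Longrightarrow> f k \<in> generate_algebra S"
  shows "(\<lambda>\<tau>\<in>uhp. \<Sum>k\<in>K. f k \<tau>) \<in> generate_algebra S"
  using assms
proof (induction K rule: finite_induct)
  case empty
  show ?case unfolding sum.empty by (rule generate_algebra_const)
next
  case (insert k K)
  then have "(\<lambda>\<tau>\<in>uhp. f k \<tau> + (\<lambda>\<tau>\<in>uhp. \<Sum>k\<in>K. f k \<tau>) \<tau>) \<in> generate_algebra S"
    by (intro generate_algebra_add) auto
  then show ?case by (rule restrict_mem) (use insert(1,2) in simp)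
qed

lemma generate_algebra_minimal:
  assumes S: "S \<subseteq> B" "S \<subseteq> carrier holo_ring" and const: "\<And>c. (\<lambda>\<tau>\<in>uhp. c) \<in> B"
    and add: "\<And>f g. f \<in> B \<Longrightarrow> g \<in> B \<Longrightarrow> (\<lambda>\<tau>\<in>uhp. f \<tau> + g \<tau>) \<in> B"
    and mult: "\<And>f g. f \<in> B \<Longrightarrow> g \<in> B \<Longrightarrow> (\<lambda>\<tau>\<in>uhp. f \<tau> * g \<tau>) \<in> B"
  shows "generate_algebra S \<subseteq> B"
proof
  interpret R: cring holo_ring by (rule cring_holo_ring)
  fix f assume "f \<in> generate_algebra S"
  then show "f \<in> B"
    unfolding generate_algebra_def
  proof (induction rule: generate_ring.induct)
    case one
    show ?case using const[of 1] by (simp only: holo_ring_def ring.simps monoid.simps)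
  next
    case (incl h)
    then show ?case using S const by auto
  next
    case (a_inv h)
    have h: "h \<in> carrier holo_ring"
      using R.generate_ring_in_carrier[OF generators_in_carrier[OF S(2)] a_inv(1)] .
    have m: "(\<lambda>\<tau>\<in>uhp. (- 1) * h \<tau>) \<in> carrier holo_ring"
      using h by (intro restrict_holo_carrier holomorphic_intros) (auto simp: holo_ring_def)
    have "(\<lambda>\<tau>\<in>uhp. (- 1) * h \<tau>) \<oplus>\<^bsub>holo_ring\<^esub> h = \<zero>\<^bsub>holo_ring\<^esub>"
      by (auto simp: holo_ring_def fun_eq_iff restrict_def)
    then have "\<ominus>\<^bsub>holo_ring\<^esub> h = (\<lambda>\<tau>\<in>uhp. (- 1) * h \<tau>)"
      by (rule R.minus_equality[OF _ h m])
    also have "\<dots> \<in> B"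
      by (rule restrict_mem[OF mult[OF const[of "- 1"] a_inv(2)]]) simp
    finally show ?case .
  next
    case (eng_add h1 h2)
    from add[OF eng_add(3,4)] show ?case by (simp only: holo_ring_def ring.simps monoid.simps)
  next
    case (eng_mult h1 h2)
    from mult[OF eng_mult(3,4)] show ?case by (simp only: holo_ring_def ring.simps monoid.simps)
  qed
qed

lemma generate_algebra_mono:
  assumes "S \<subseteq> generate_algebra T" "S \<subseteq> carrier holo_ring"
  shows "generate_algebra S \<subseteq> generate_algebra T"
  using assms generate_algebra_const generate_algebra_add generate_algebra_mult
  by (intro generate_algebra_minimal) auto

lemma modular_forms_ring_incl: "f \<in> modular_forms N k \<Longrightarrow> f \<in> modular_forms_ring N"
  unfolding modular_forms_ring_def
  by (rule CollectI, rule exI[of _ "{k}"], rule exI[of _ "\<lambda>_. f"]) (simp add: modular_forms_restrict)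

lemma modular_forms_ring_add_form:
  assumes f: "f \<in> modular_forms_ring N" and g: "g \<in> modular_forms N k"
  shows "(\<lambda>\<tau>\<in>uhp. f \<tau> + g \<tau>) \<in> modular_forms_ring N"
proof -
  from f obtain K F where F: "finite K" "\<And>k. k \<in> K \<Longrightarrow> F k \<in> modular_forms N k" "f = (\<lambda>\<tau>\<in>uhp. \<Sum>k\<in>K. F k \<tau>)"
    by (auto simp: modular_forms_ring_def)
  \<comment> \<open>A second form of weight \<open>k\<close> is absorbed by the one already present.\<close>
  define G where "G = F(k := if k \<in> K then (\<lambda>\<tau>\<in>uhp. F k \<tau> + g \<tau>) else g)"
  have "G l \<in> modular_forms N l" if "l \<in> insert k K" for l
    using that F(2) g modular_forms_add by (auto simp: G_def)
  moreover have "f \<tau> + g \<tau> = (\<Sum>l\<in>insert k K. G l \<tau>)" if "\<tau> \<in> uhp" for \<tau>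
  proof -
    have "(\<Sum>l\<in>insert k K. G l \<tau>) = G k \<tau> + (\<Sum>l\<in>K - {k}. G l \<tau>)"
      using F(1) by (subst sum.insert_remove) auto
    also have "(\<Sum>l\<in>K - {k}. G l \<tau>) = (\<Sum>l\<in>K - {k}. F l \<tau>)"
      by (rule sum.cong) (auto simp: G_def)
    also have "G k \<tau> + \<dots> = (\<Sum>l\<in>K. F l \<tau>) + g \<tau>"
      using that F(1) by (cases "k \<in> K") (auto simp: G_def sum.remove[of K k])
    finally show ?thesis using that by (simp add: F(3))
  qed
  ultimately show ?thesis
    unfolding modular_forms_ring_def using F(1)
    by (intro CollectI exI[of _ "insert k K"] exI[of _ G]) (auto cong: restrict_cong)
qed

text \<open>The summands may have equal weights, in contrast to those in the definition of the ring.\<close>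
lemma modular_forms_ring_sum:
  assumes "finite I" "\<And>i. i \<in> I \<Longrightarrow> g i \<in> modular_forms N (n i)"
  shows "(\<lambda>\<tau>\<in>uhp. \<Sum>i\<in>I. g i \<tau>) \<in> modular_forms_ring N"
  using assms
proof (induction I rule: finite_induct)
  case empty
  show ?case unfolding sum.empty by (rule modular_forms_ring_incl[OF modular_forms_const])
next
  case (insert i I)
  then have "(\<lambda>\<tau>\<in>uhp. (\<lambda>\<tau>\<in>uhp. \<Sum>i\<in>I. g i \<tau>) \<tau> + g i \<tau>) \<in> modular_forms_ring N"
    by (intro modular_forms_ring_add_form[of _ _ _ "n i"]) auto
  then show ?case by (rule restrict_mem) (use insert(1,2) in simp)
qed

lemma modular_forms_ring_add:
  assumes f: "f \<in> modular_forms_ring N" and g: "g \<in> modular_forms_ring N"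
  shows "(\<lambda>\<tau>\<in>uhp. f \<tau> + g \<tau>) \<in> modular_forms_ring N"
proof -
  from f obtain K F where F: "finite K" "\<And>k. k \<in> K \<Longrightarrow> F k \<in> modular_forms N k" "f = (\<lambda>\<tau>\<in>uhp. \<Sum>k\<in>K. F k \<tau>)"
    by (auto simp: modular_forms_ring_def)
  from g obtain L G where G: "finite L" "\<And>k. k \<in> L \<Longrightarrow> G k \<in> modular_forms N k" "g = (\<lambda>\<tau>\<in>uhp. \<Sum>k\<in>L. G k \<tau>)"
    by (auto simp: modular_forms_ring_def)
  have "(\<lambda>\<tau>\<in>uhp. \<Sum>i\<in>K <+> L. (case_sum F G i) \<tau>) \<in> modular_forms_ring N"
    by (rule modular_forms_ring_sum[where n = "case_sum id id"]) (use F G in auto)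
  also have "(\<lambda>\<tau>\<in>uhp. \<Sum>i\<in>K <+> L. (case_sum F G i) \<tau>) = (\<lambda>\<tau>\<in>uhp. f \<tau> + g \<tau>)"
    using F(1) G(1) by (auto simp: F(3) G(3) sum.Plus restrict_def fun_eq_iff)
  finally show ?thesis .
qed

lemma modular_forms_ring_mult:
  assumes f: "f \<in> modular_forms_ring N" and g: "g \<in> modular_forms_ring N"
  shows "(\<lambda>\<tau>\<in>uhp. f \<tau> * g \<tau>) \<in> modular_forms_ring N"
proof -
  from f obtain K F where F: "finite K" "\<And>k. k \<in> K \<Longrightarrow> F k \<in> modular_forms N k" "f = (\<lambda>\<tau>\<in>uhp. \<Sum>k\<in>K. F k \<tau>)"
    by (auto simp: modular_forms_ring_def)
  from g obtain L G where G: "finite L" "\<And>k. k \<in> L \<Longrightarrow> G k \<in> modular_forms N k" "g = (\<lambda>\<tau>\<in>uhp. \<Sum>k\<in>L. G k \<tau>)"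
    by (auto simp: modular_forms_ring_def)
  have "(\<lambda>\<tau>\<in>uhp. \<Sum>i\<in>K \<times> L. (\<lambda>\<tau>\<in>uhp. F (fst i) \<tau> * G (snd i) \<tau>) \<tau>) \<in> modular_forms_ring N"
  proof (rule modular_forms_ring_sum[where n = "\<lambda>i. fst i + snd i"])
    show "finite (K \<times> L)" using F(1) G(1) by simp
    show "(\<lambda>\<tau>\<in>uhp. F (fst i) \<tau> * G (snd i) \<tau>) \<in> modular_forms N (fst i + snd i)" if "i \<in> K \<times> L" for i
      by (rule modular_forms_mult) (use that F(2) G(2) in auto)
  qed
  also have "(\<lambda>\<tau>\<in>uhp. \<Sum>i\<in>K \<times> L. (\<lambda>\<tau>\<in>uhp. F (fst i) \<tau> * G (snd i) \<tau>) \<tau>) = (\<lambda>\<tau>\<in>uhp. f \<tau> * g \<tau>)"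
    by (auto simp: F(3) G(3) sum_product sum.cartesian_product restrict_def fun_eq_iff case_prod_unfold)
  finally show ?thesis .
qed

lemma generate_algebra_le_modular_forms_ring:
  assumes "\<And>f. f \<in> S \<Longrightarrow> \<exists>k. f \<in> modular_forms N k"
  shows "generate_algebra S \<subseteq> modular_forms_ring N"
proof (rule generate_algebra_minimal)
  show "S \<subseteq> modular_forms_ring N" using assms modular_forms_ring_incl by blast
  show "S \<subseteq> carrier holo_ring" using assms by (auto simp: modular_forms_def)
  show "(\<lambda>\<tau>\<in>uhp. c) \<in> modular_forms_ring N" for c
    by (rule modular_forms_ring_incl[OF modular_forms_const])
qed (auto intro: modular_forms_ring_add modular_forms_ring_mult)

section \<open>The structure theorem\<close>

lemma weakly_invariant_lincomb:
  assumes "weakly_invariant N k f" "weakly_invariant N k g"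
  shows "weakly_invariant N k (\<lambda>\<tau>. c * f \<tau> + d * g \<tau>)"
  using assms by (simp add: weakly_invariant_def distrib_left mult_ac)

context level
begin

lemma p_cases: "p = 2 \<or> p = 3"
  using params by auto

lemma weakly_invariant_E: "weakly_invariant p w E"
  unfolding weakly_invariant_def using E_modular by (auto simp: Gamma_iff)

lemma weakly_invariant_E_div: "weakly_invariant p w (\<lambda>\<tau>. E (\<tau> / of_nat p))"
  unfolding weakly_invariant_def
proof (intro ballI)
  fix A \<tau> assume A: "A \<in> Gamma p" and \<tau>: "\<tau> \<in> uhp"
  then obtain k where k: "A$1$2 = int p * k" by (auto simp: Gamma_iff dvd_def)
  \<comment> \<open>The matrix that acts on \<open>\<tau> / p\<close> as \<open>A\<close> acts on \<open>\<tau>\<close>.\<close>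
  define C where "C = mat2 (A$1$1) k (int p * A$2$1) (A$2$2)"
  have "A$1$1 * A$2$2 - A$1$2 * A$2$1 = 1" using A by (simp add: Gamma_iff det_SL2Z)
  then have C: "C \<in> SL2Z" unfolding C_def by (intro mat2_SL2Z) (simp add: k mult_ac)
  have af: "autom_factor C (\<tau> / of_nat p) = autom_factor A \<tau>"
    using p_pos by (simp add: C_def moebius_mat2 autom_factor_def[of A])
  have "of_int (A$1$1) * (\<tau> / of_nat p) + of_int k = (of_int (A$1$1) * \<tau> + of_int (A$1$2)) / of_nat p"
    using p_pos by (simp add: k field_simps)
  then have "moebius_act C (\<tau> / of_nat p) = moebius_act A \<tau> / of_nat p"
    unfolding moebius_act_def af by (simp add: C_def)
  then show "E (moebius_act A \<tau> / of_nat p) = autom_factor A \<tau> ^ w * E (\<tau> / of_nat p)"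
    using E_modular[OF C, of "\<tau> / of_nat p"] A scale_uhp(2)[OF \<tau> p_pos(1)] unfolding af
    by (simp add: C_def Gamma_iff)
qed

lemma weakly_invariant_t: "weakly_invariant p w t"
proof -
  have "t \<tau> = (1 / r) * E (\<tau> / of_nat p) + (- 1 / r) * E \<tau>" for \<tau>
    using p_pos by (simp add: E_div_p field_simps)
  then have "t = (\<lambda>\<tau>. (1 / r) * E (\<tau> / of_nat p) + (- 1 / r) * E \<tau>)" by blast
  then show ?thesis
    using weakly_invariant_lincomb[OF weakly_invariant_E_div weakly_invariant_E] by metis
qed

lemma weakly_invariant_b: "weakly_invariant p w (b 0)"
proof -
  have "b 0 = (\<lambda>\<tau>. 1 * E \<tau> + (- s) * t \<tau>)" by (simp add: b_def fun_eq_iff)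
  then show ?thesis
    using weakly_invariant_lincomb[OF weakly_invariant_E weakly_invariant_t] by metis
qed

lemma holo_t: "holo_at_infinity p t"
  unfolding holo_at_infinity_def using holomorphic_t_b_disc(1) by (auto simp: t_def nome_def)

lemma holo_b: "holo_at_infinity p (b j)"
  unfolding holo_at_infinity_def using holomorphic_t_b_disc(2)[of j] by (auto simp: b_conv_disc nome_def)

text \<open>At the cusps not equivalent to infinity \<open>t\<close> becomes a multiple of \<open>b 0\<close>, which does not vanish.\<close>
lemma t_cusp:
  assumes \<tau>: "\<tau> \<in> uhp"
  shows "t (- 1 / \<tau> + of_int i) / \<tau> ^ w = zeta i * (lam / s) * b 0 \<tau>"
  using uhp_nonzero[OF \<tau>] unfolding t_shift[OF minus_inverse_uhp[OF \<tau>]] t_inversion[OF \<tau>] by simp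

lemma t_modular: "(\<lambda>\<tau>\<in>uhp. t \<tau>) \<in> modular_forms p w"
proof (rule modular_formsI[OF p_cases _ weakly_invariant_t holo_t])
  show "t holomorphic_on uhp" by (rule holo_at_infinity_imp_holomorphic[OF holo_t p_pos(1)])
  show "holo_at_infinity p (\<lambda>\<tau>. t (- 1 / \<tau> + of_int i) / \<tau> ^ w)" for i
    using holo_at_infinity_mult[OF holo_at_infinity_const holo_b]
    by (rule holo_at_infinity_cong[THEN iffD2, rotated]) (rule t_cusp)
qed

lemma b_cusp:
  assumes \<tau>: "\<tau> \<in> uhp"
  shows "b 0 (- 1 / \<tau> + of_int i) / \<tau> ^ w = lam * (b 0 \<tau> + (s + r) * t \<tau>) + - zeta i * lam * b 0 \<tau>"
proof -
  have "b 0 (- 1 / \<tau> + of_int i) = E (- 1 / \<tau>) - s * zeta i * t (- 1 / \<tau>)"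
    using b_shift[OF minus_inverse_uhp[OF \<tau>], of 0 i] by (simp add: b_def)
  also have "\<dots> = \<tau> ^ w * (lam * (b 0 \<tau> + (s + r) * t \<tau>) + - zeta i * lam * b 0 \<tau>)"
    unfolding E_inversion[OF \<tau>] t_inversion[OF \<tau>] E_div_p using p_pos by (simp add: b_def algebra_simps)
  finally show ?thesis using uhp_nonzero[OF \<tau>] by simp
qed

lemma b_modular: "(\<lambda>\<tau>\<in>uhp. b 0 \<tau>) \<in> modular_forms p w"
proof (rule modular_formsI[OF p_cases _ weakly_invariant_b holo_b])
  show "b 0 holomorphic_on uhp" by (rule holo_at_infinity_imp_holomorphic[OF holo_b p_pos(1)])
  have "holo_at_infinity p (\<lambda>\<tau>. lam * (b 0 \<tau> + (s + r) * t \<tau>) + - zeta i * lam * b 0 \<tau>)" for i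
    by (intro holo_at_infinity_add holo_at_infinity_mult holo_at_infinity_const holo_b holo_t)
  then show "holo_at_infinity p (\<lambda>\<tau>. b 0 (- 1 / \<tau> + of_int i) / \<tau> ^ w)" for i
    by (rule holo_at_infinity_cong[THEN iffD2, rotated]) (rule b_cusp)
qed

lemma t_nonzero: "\<tau> \<in> uhp \<Longrightarrow> t \<tau> \<noteq> 0"
  using t_eq_top top_bot_nonzero(1) by simp

text \<open>At infinity the zero of \<open>f\<close> cancels the simple zero of \<open>t\<close>; everywhere else, including the other
  cusps, \<open>t\<close> does not vanish.\<close>
lemma divide_by_t:
  assumes f: "f \<in> modular_forms p (w * Suc m)"
    and G: "G holomorphic_on ball 0 1" "G 0 = 0" "\<And>\<tau>. \<tau> \<in> uhp \<Longrightarrow> f \<tau> = G (nome \<tau>)"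
  shows "(\<lambda>\<tau>\<in>uhp. f \<tau> / t \<tau>) \<in> modular_forms p (w * m)"
proof (rule modular_formsI[OF p_cases])
  have th: "t holomorphic_on uhp" by (rule holo_at_infinity_imp_holomorphic[OF holo_t p_pos(1)])
  show "(\<lambda>\<tau>. f \<tau> / t \<tau>) holomorphic_on uhp"
    by (intro holomorphic_intros modular_formsD(1)[OF f] th t_nonzero)
  show "weakly_invariant p (w * m) (\<lambda>\<tau>. f \<tau> / t \<tau>)"
    unfolding weakly_invariant_def
  proof (intro ballI)
    fix A \<tau> assume A: "A \<in> Gamma p" and \<tau>: "\<tau> \<in> uhp"
    have "f (moebius_act A \<tau>) = autom_factor A \<tau> ^ (w * Suc m) * f \<tau>"
      "t (moebius_act A \<tau>) = autom_factor A \<tau> ^ w * t \<tau>"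
      using modular_formsD(2)[OF f] weakly_invariant_t A \<tau> by (auto simp: weakly_invariant_def)
    then show "f (moebius_act A \<tau>) / t (moebius_act A \<tau>) = autom_factor A \<tau> ^ (w * m) * (f \<tau> / t \<tau>)"
      using autom_factor_nonzero[OF Gamma_SL2Z[OF A] \<tau>] by (simp add: power_add)
  qed
  obtain g where g: "g holomorphic_on ball 0 1" "\<And>y. G y = y * g y"
    using holomorphic_divide_identity[OF G(1,2)] by blast
  show "holo_at_infinity p (\<lambda>\<tau>. f \<tau> / t \<tau>)"
    unfolding holo_at_infinity_def
  proof (intro exI conjI ballI)
    show "(\<lambda>y. g y / quot_top_disc y) holomorphic_on ball 0 1"
      by (intro holomorphic_intros g(1) holomorphic_top_bot_disc) (use top_bot_disc_nonzero in auto)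
    show "f \<tau> / t \<tau> = g (q_pow (1 / real p) \<tau>) / quot_top_disc (q_pow (1 / real p) \<tau>)" if "\<tau> \<in> uhp" for \<tau>
    proof -
      have "nome \<tau> \<noteq> 0" by (simp add: nome_def)
      then show ?thesis
        unfolding nome_def[symmetric] using that by (simp add: G(3) g(2) t_eq_top top_conv_disc)
    qed
  qed
  show "holo_at_infinity p (\<lambda>\<tau>. f (- 1 / \<tau> + of_int i) / t (- 1 / \<tau> + of_int i) / \<tau> ^ (w * m))" for i
  proof -
    obtain F where F: "F holomorphic_on ball 0 1"
      "\<And>\<tau>. \<tau> \<in> uhp \<Longrightarrow> f (- 1 / \<tau> + of_int i) / \<tau> ^ (w * Suc m) = F (nome \<tau>)"
      using modular_forms_cusps(2)[OF f, of i] unfolding holo_at_infinity_def nome_def by blast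
    show ?thesis
      unfolding holo_at_infinity_def
    proof (intro exI conjI ballI)
      show "(\<lambda>y. F y / (zeta i * (lam / s) * quot_bot_disc y)) holomorphic_on ball 0 1"
        by (intro holomorphic_intros F(1) holomorphic_top_bot_disc) (use top_bot_disc_nonzero lam_nonzero p_pos in auto)
      fix \<tau> assume \<tau>: "\<tau> \<in> uhp"
      have "f (- 1 / \<tau> + of_int i) / t (- 1 / \<tau> + of_int i) / \<tau> ^ (w * m) =
          (f (- 1 / \<tau> + of_int i) / \<tau> ^ (w * Suc m)) / (t (- 1 / \<tau> + of_int i) / \<tau> ^ w)"
        using uhp_nonzero[OF \<tau>] by (simp add: power_add)
      also have "\<dots> = F (nome \<tau>) / (zeta i * (lam / s) * quot_bot_disc (nome \<tau>))"
        unfolding F(2)[OF \<tau>] t_cusp[OF \<tau>] using b_eq_bot[OF \<tau>, of 0] by (simp add: bot_conv_disc)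
      finally show "f (- 1 / \<tau> + of_int i) / t (- 1 / \<tau> + of_int i) / \<tau> ^ (w * m) =
          F (q_pow (1 / real p) \<tau>) / (zeta i * (lam / s) * quot_bot_disc (q_pow (1 / real p) \<tau>))"
        by (simp only: nome_def)
    qed
  qed
qed

definition algebra_tb :: "(complex \<Rightarrow> complex) set" where
  "algebra_tb = generate_algebra {\<lambda>\<tau>\<in>uhp. b 0 \<tau>, \<lambda>\<tau>\<in>uhp. t \<tau>}"

text \<open>If \<open>c\<close> is the value of \<open>f\<close> at infinity, then \<open>f = c b^(m+1) + t h\<close> with a form \<open>h\<close> of smaller weight.\<close>
theorem modular_form_in_algebra_tb:
  "f \<in> modular_forms p (w * m) \<Longrightarrow> f \<in> algebra_tb"
proof (induction m arbitrary: f)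
  case 0
  then obtain c where "f = (\<lambda>\<tau>\<in>uhp. c)" using modular_forms_weight_0[OF p_cases, of f] by auto
  then show ?case unfolding algebra_tb_def by (simp only: generate_algebra_const)
next
  case (Suc m)
  obtain G where G: "G holomorphic_on ball 0 1" "\<And>\<tau>. \<tau> \<in> uhp \<Longrightarrow> f \<tau> = G (nome \<tau>)"
    using modular_forms_cusps(1)[OF Suc.prems] unfolding holo_at_infinity_def nome_def by blast
  define c where "c = G 0"
  define bm where "bm = (\<lambda>\<tau>\<in>uhp. b 0 \<tau> ^ Suc m)"
  have bm: "bm \<in> modular_forms p (w * Suc m)"
    unfolding bm_def by (rule restrict_mem[OF modular_forms_power[OF b_modular]]) simp
  define h where "h = (\<lambda>\<tau>\<in>uhp. f \<tau> + (\<lambda>\<tau>\<in>uhp. (- c) * bm \<tau>) \<tau>)"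
  have h: "h \<in> modular_forms p (w * Suc m)"
    unfolding h_def by (intro modular_forms_add[OF Suc.prems] modular_forms_scale bm)
  have "(\<lambda>\<tau>\<in>uhp. h \<tau> / t \<tau>) \<in> modular_forms p (w * m)"
  proof (rule divide_by_t[OF h])
    show "(\<lambda>y. G y - c * b_disc 0 y ^ Suc m) holomorphic_on ball 0 1"
      by (intro holomorphic_intros G(1) holomorphic_t_b_disc)
    show "G 0 - c * b_disc 0 0 ^ Suc m = 0"
      using p_pos by (simp add: c_def b_disc_def t_disc_def power_0_left)
    show "h \<tau> = G (nome \<tau>) - c * b_disc 0 (nome \<tau>) ^ Suc m" if "\<tau> \<in> uhp" for \<tau>
      using that by (simp add: h_def bm_def G(2) b_conv_disc)
  qed
  then have ht: "(\<lambda>\<tau>\<in>uhp. h \<tau> / t \<tau>) \<in> algebra_tb" by (rule Suc.IH)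
  have tt: "(\<lambda>\<tau>\<in>uhp. t \<tau>) \<in> algebra_tb" and bb: "(\<lambda>\<tau>\<in>uhp. b 0 \<tau>) \<in> algebra_tb"
    unfolding algebra_tb_def by (auto intro: generate_algebra_incl)
  have "(\<lambda>\<tau>\<in>uhp. (\<lambda>\<tau>\<in>uhp. c * (\<lambda>\<tau>\<in>uhp. (\<lambda>\<tau>\<in>uhp. b 0 \<tau>) \<tau> ^ Suc m) \<tau>) \<tau> +
      (\<lambda>\<tau>\<in>uhp. (\<lambda>\<tau>\<in>uhp. t \<tau>) \<tau> * (\<lambda>\<tau>\<in>uhp. h \<tau> / t \<tau>) \<tau>) \<tau>) \<in> algebra_tb"
    using ht tt bb unfolding algebra_tb_def
    by (intro generate_algebra_add generate_algebra_scale generate_algebra_power generate_algebra_mult)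
  also have "(\<lambda>\<tau>\<in>uhp. (\<lambda>\<tau>\<in>uhp. c * (\<lambda>\<tau>\<in>uhp. (\<lambda>\<tau>\<in>uhp. b 0 \<tau>) \<tau> ^ Suc m) \<tau>) \<tau> +
      (\<lambda>\<tau>\<in>uhp. (\<lambda>\<tau>\<in>uhp. t \<tau>) \<tau> * (\<lambda>\<tau>\<in>uhp. h \<tau> / t \<tau>) \<tau>) \<tau>) = (\<lambda>\<tau>\<in>uhp. f \<tau>)"
    by (rule restrict_ext) (simp add: t_nonzero h_def bm_def del: power_Suc)
  also have "\<dots> = f" by (rule modular_forms_restrict[OF Suc.prems])
  finally show ?case .
qed

text \<open>Such a weight is odd and the level is 2, so that \<open>-1\<close> is in the group and acts by a sign.\<close>
lemma modular_forms_other_weights: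
  assumes f: "f \<in> modular_forms p k" and k: "\<not> w dvd k"
  shows "f = (\<lambda>\<tau>\<in>uhp. 0)"
proof -
  have p: "p = 2" "odd k" using params k by auto
  have "mat2 (- 1) 0 0 (- 1) \<in> Gamma p"
    by (simp add: Gamma_iff det_SL2Z p)
  have "f \<tau> = 0" if \<tau>: "\<tau> \<in> uhp" for \<tau>
  proof -
    have "f (moebius_act (mat2 (- 1) 0 0 (- 1)) \<tau>) = autom_factor (mat2 (- 1) 0 0 (- 1)) \<tau> ^ k * f \<tau>"
      using modular_formsD(2)[OF f] \<open>mat2 (- 1) 0 0 (- 1) \<in> Gamma p\<close> \<tau> by (auto simp: weakly_invariant_def)
    then show ?thesis using p by (simp add: moebius_mat2)
  qed
  then show ?thesis using modular_forms_restrict[OF f] restrict_ext[of uhp f "\<lambda>_. 0"] by simp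
qed

theorem modular_forms_ring_eq_tb: "modular_forms_ring p = algebra_tb"
proof
  show "algebra_tb \<subseteq> modular_forms_ring p"
    unfolding algebra_tb_def
    by (rule generate_algebra_le_modular_forms_ring) (use b_modular t_modular in auto)
  have form: "f \<in> algebra_tb" if f: "f \<in> modular_forms p k" for f k
  proof (cases "w dvd k")
    case True
    then obtain m where "k = w * m" by (auto simp: dvd_def)
    with f show ?thesis using modular_form_in_algebra_tb by blast
  next
    case False
    show ?thesis
      unfolding modular_forms_other_weights[OF f False] algebra_tb_def by (rule generate_algebra_const)
  qed
  show "modular_forms_ring p \<subseteq> algebra_tb"
  proof
    fix f assume "f \<in> modular_forms_ring p"
    then obtain K F where F: "finite K" "\<And>k. k \<in> K \<Longrightarrow> F k \<in> modular_forms p k" "f = (\<lambda>\<tau>\<in>uhp. \<Sum>k\<in>K. F k \<tau>)"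
      by (auto simp: modular_forms_ring_def)
    show "f \<in> algebra_tb"
      unfolding F(3) algebra_tb_def
      by (rule generate_algebra_sum[OF F(1)]) (use form F(2) in \<open>auto simp: algebra_tb_def\<close>)
  qed
qed

lemma algebra_tb_eq_eisenstein:
  "algebra_tb = generate_algebra {\<lambda>\<tau>\<in>uhp. E (\<tau> / of_nat p), \<lambda>\<tau>\<in>uhp. E \<tau>}" (is "_ = generate_algebra ?S")
proof
  have tb: "(\<lambda>\<tau>\<in>uhp. b 0 \<tau>) \<in> carrier holo_ring" "(\<lambda>\<tau>\<in>uhp. t \<tau>) \<in> carrier holo_ring"
    using b_modular t_modular by (auto simp: modular_forms_def)
  have lin: "(\<lambda>\<tau>\<in>uhp. c * f \<tau> + d * g \<tau>) \<in> generate_algebra S"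
    if "(\<lambda>\<tau>\<in>uhp. f \<tau>) \<in> generate_algebra S" "(\<lambda>\<tau>\<in>uhp. g \<tau>) \<in> generate_algebra S" for f g c d S
    by (rule restrict_mem[OF generate_algebra_add[OF generate_algebra_scale[OF that(1), of c] generate_algebra_scale[OF that(2), of d]]])
       simp
  let ?T = "{\<lambda>\<tau>\<in>uhp. b 0 \<tau>, \<lambda>\<tau>\<in>uhp. t \<tau>}"
  have T: "(\<lambda>\<tau>\<in>uhp. b 0 \<tau>) \<in> generate_algebra ?T" "(\<lambda>\<tau>\<in>uhp. t \<tau>) \<in> generate_algebra ?T"
    by (auto intro: generate_algebra_incl)
  have e1: "E \<tau> = 1 * b 0 \<tau> + s * t \<tau>" for \<tau> by (simp add: b_def)
  have e2: "E (\<tau> / of_nat p) = 1 * b 0 \<tau> + (s + r) * t \<tau>" for \<tau> by (simp add: b_def E_div_p algebra_simps)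
  have E1: "(\<lambda>\<tau>\<in>uhp. E \<tau>) \<in> generate_algebra ?T" "(\<lambda>\<tau>\<in>uhp. E (\<tau> / of_nat p)) \<in> generate_algebra ?T"
    by (rule restrict_mem[OF lin[OF T, of 1 s]], rule e1[symmetric])
       (rule restrict_mem[OF lin[OF T, of 1 "s + r"]], rule e2[symmetric])
  have bh: "b 0 holomorphic_on uhp" "t holomorphic_on uhp"
    by (rule holo_at_infinity_imp_holomorphic[OF holo_b p_pos(1)] holo_at_infinity_imp_holomorphic[OF holo_t p_pos(1)])+
  have Ecar: "(\<lambda>\<tau>\<in>uhp. E \<tau>) \<in> carrier holo_ring" "(\<lambda>\<tau>\<in>uhp. E (\<tau> / of_nat p)) \<in> carrier holo_ring"
  proof -
    have car: "(\<lambda>\<tau>\<in>uhp. 1 * b 0 \<tau> + d * t \<tau>) \<in> carrier holo_ring" for d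
      by (intro restrict_holo_carrier holomorphic_intros bh)
    show "(\<lambda>\<tau>\<in>uhp. E \<tau>) \<in> carrier holo_ring" "(\<lambda>\<tau>\<in>uhp. E (\<tau> / of_nat p)) \<in> carrier holo_ring"
      by (rule restrict_mem[OF car[of s]], rule e1[symmetric])
         (rule restrict_mem[OF car[of "s + r"]], rule e2[symmetric])
  qed
  show "generate_algebra ?S \<subseteq> algebra_tb"
    unfolding algebra_tb_def by (rule generate_algebra_mono) (use E1 Ecar in auto)
  have S: "(\<lambda>\<tau>\<in>uhp. E (\<tau> / of_nat p)) \<in> generate_algebra ?S" "(\<lambda>\<tau>\<in>uhp. E \<tau>) \<in> generate_algebra ?S"
    by (auto intro: generate_algebra_incl)
  have t: "t \<tau> = (1 / r) * E (\<tau> / of_nat p) + (- 1 / r) * E \<tau>" for \<tau>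
    using p_pos by (simp add: E_div_p field_simps)
  have b: "b 0 \<tau> = (- s / r) * E (\<tau> / of_nat p) + (1 + s / r) * E \<tau>" for \<tau>
    using p_pos by (simp add: E_div_p b_def field_simps)
  have "(\<lambda>\<tau>\<in>uhp. b 0 \<tau>) \<in> generate_algebra ?S" "(\<lambda>\<tau>\<in>uhp. t \<tau>) \<in> generate_algebra ?S"
    by (rule restrict_mem[OF lin[OF S, of "- s / r" "1 + s / r"]], rule b[symmetric])
       (rule restrict_mem[OF lin[OF S, of "1 / r" "- 1 / r"]], rule t[symmetric])
  then show "algebra_tb \<subseteq> generate_algebra ?S"
    unfolding algebra_tb_def by (intro generate_algebra_mono) (use tb in auto)
qed

lemma algebra_tb_eq_eta_quotients: "algebra_tb = generate_algebra {\<lambda>\<tau>\<in>uhp. quot_bot \<tau>, \<lambda>\<tau>\<in>uhp. quot_top \<tau>}"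
proof -
  have "(\<lambda>\<tau>\<in>uhp. b 0 \<tau>) = (\<lambda>\<tau>\<in>uhp. quot_bot \<tau>)" "(\<lambda>\<tau>\<in>uhp. t \<tau>) = (\<lambda>\<tau>\<in>uhp. quot_top \<tau>)"
    using b_eq_bot[of _ 0] t_eq_top by (auto intro!: restrict_ext)
  then show ?thesis by (simp only: algebra_tb_def)
qed

end

lemma level_2: "level 2 2 4 (\<lambda>d. if odd d then of_nat d else 0) 24 8 (- (1 / 2)) E22"
proof
  show "E22 (moebius_act A \<tau>) = autom_factor A \<tau> ^ 2 * E22 \<tau>"
    if "A \<in> SL2Z" "int 2 dvd A$2$1" "int 2 dvd A$2$2 - 1" "\<tau> \<in> uhp" for A \<tau>
    using E22_modular[of A \<tau>] that by simp
  show "E22 (- 1 / \<tau>) = - (1 / 2) * \<tau> ^ 2 * E22 (\<tau> / of_nat 2)" if "\<tau> \<in> uhp" for \<tau>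
    using E22_inversion[OF that] by simp
qed (auto simp: E22_conv_lambert divisor_sum_odd power_divide norm_divide)

lemma level_3: "level 3 1 1 chi3c 6 3 (- (\<i> / of_real (sqrt 3))) E_chi3"
proof
  show "E_chi3 (moebius_act A \<tau>) = autom_factor A \<tau> ^ 1 * E_chi3 \<tau>"
    if "A \<in> SL2Z" "int 3 dvd A$2$1" "int 3 dvd A$2$2 - 1" "\<tau> \<in> uhp" for A \<tau>
    using E_chi3_modular[of A \<tau>] that by simp
  show "E_chi3 (- 1 / \<tau>) = - (\<i> / of_real (sqrt 3)) * \<tau> ^ 1 * E_chi3 (\<tau> / of_nat 3)" if "\<tau> \<in> uhp" for \<tau>
    using E_chi3_inversion[OF that] by simp
  show "(\<Sum>d | d dvd n. chi3c d) = 0" if "n mod 3 \<noteq> 0" "n mod 3 \<noteq> 1" for n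
    by (rule divisor_sum_chi3_eq_0) (use that in linarith)
  show "chi3c 1 = 1" by (simp add: chi3c_def chi3_mod)
qed (auto simp: E_chi3_conv_lambert norm_chi3c divisor_sum_chi3 norm_divide power_divide)

theorem theorem22:
  shows "(modular_forms_ring 2 = generate_algebra {\<lambda>\<tau>\<in>uhp. E22 (\<tau> / 2), \<lambda>\<tau>\<in>uhp. E22 \<tau>} \<and>
          generate_algebra {\<lambda>\<tau>\<in>uhp. E22 (\<tau> / 2), \<lambda>\<tau>\<in>uhp. E22 \<tau>} =
            generate_algebra {\<lambda>\<tau>\<in>uhp. eta_flat \<tau> ^ 4, \<lambda>\<tau>\<in>uhp. eta_sharp \<tau> ^ 4}) \<and>
         (modular_forms_ring 3 = generate_algebra {\<lambda>\<tau>\<in>uhp. E_chi3 (\<tau> / 3), \<lambda>\<tau>\<in>uhp. E_chi3 \<tau>} \<and>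
          generate_algebra {\<lambda>\<tau>\<in>uhp. E_chi3 (\<tau> / 3), \<lambda>\<tau>\<in>uhp. E_chi3 \<tau>} =
            generate_algebra {\<lambda>\<tau>\<in>uhp. eta_bot \<tau>, \<lambda>\<tau>\<in>uhp. eta_top \<tau>})"
proof -
  interpret L2: level 2 2 4 "\<lambda>d. if odd d then of_nat d else 0" 24 8 "- (1 / 2)" E22 by (rule level_2)
  interpret L3: level 3 1 1 chi3c 6 3 "- (\<i> / of_real (sqrt 3))" E_chi3 by (rule level_3)
  have "L2.quot_bot = (\<lambda>\<tau>. eta_flat \<tau> ^ 4)" "L2.quot_top = (\<lambda>\<tau>. eta_sharp \<tau> ^ 4)"
    unfolding fun_eq_iff L2.quot_bot_def L2.quot_top_def eta_flat_def eta_sharp_def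
    by (simp_all add: power_divide flip: power_mult)
  moreover have "L3.quot_bot = eta_bot" "L3.quot_top = eta_top"
    unfolding fun_eq_iff L3.quot_bot_def L3.quot_top_def eta_bot_def eta_top_def by simp_all
  ultimately show ?thesis
    using L2.modular_forms_ring_eq_tb L2.algebra_tb_eq_eisenstein L2.algebra_tb_eq_eta_quotients
      L3.modular_forms_ring_eq_tb L3.algebra_tb_eq_eisenstein L3.algebra_tb_eq_eta_quotients
    by simp
qed

end
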